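(* Let $0<q<1$ and let $k_1,\dots,k_g$ be positive integers. Partition the index set into two arbitrary sets $J$ and $K$ of $\alpha$ and $\beta$ elements respectively, $\alpha,\beta\ge0$, $\alpha+\beta=g$. Consider the $\alpha$ points $q^{k_i/2}+q^{-k_i/2}$, $i\in J$, and the $\beta$ points $-(q^{k_i/2}+q^{-k_i/2})$, $i\in K$, and assume that all these $g$ points are distinct. (i) The tridiagonal operator $\hat L$ which is obtained by iteration of the Darboux process starting at $L=E+E^{-1}$, and adding bound states at these $g=\alpha+\beta$ distinct points, is part of a commutative rank 1 ring of difference operators, with spectral curve $$v^2=(u^2-4)\prod_{i\in J}\big(u-(q^{k_i/2}+q^{-k_i/2})\big)^2\prod_{i\in K}\big(u+(q^{k_i/2}+q^{-k_i/2})\big)^2 .$$ (ii) The (reduced) wave function $\Psi(n,z)$ of this rank 1 commutative ring of difference operators is also a common eigenfunction of a rank 1 commutative ring of $q$-difference operators in the spectral variable $z$.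
   Context: $E^{\pm1}$ are the shifts $E^{\pm1}h(n)=h(n\pm1)$, $n\in\mathbb Z$; difference operators are finite sums $\sum_jh_j(n)E^j$ and $q$-difference operators in $z$ are finite sums $\sum_jD_j(z)D_z^j$, where $D_zh(z)=h(qz)$. The rank of a commutative ring of ($q$-)difference operators is the greatest common divisor of the orders of all operators in the ring (order: highest power of the shift occurring). "Spectral curve" means that the ring is isomorphic to the coordinate ring of the indicated affine curve (its Spec). Darboux process: if $L\psi=x\psi$ with $\psi\ne0$, and $Q$ is a first-order difference operator with kernel spanned by $\psi$, then $L=x\,\mathrm{Id}+PQ$ and the Darboux transform of $L$ at $x$ is $x\,\mathrm{Id}+QP$; this is iterated at the $g$ points. Put $\lambda_i=q^{k_i/2}$ for $i\in J$ and $\lambda_i=-q^{k_i/2}$ for $i\in K$, and $\mu_i=\lambda_i^{-1}$. Adding a bound state at $\lambda_i+\lambda_i^{-1}$ means that the eigenfunction of $E+E^{-1}$ used is (up to scale) $\lambda_i^n-\delta_i\lambda_i^{-n}$ with an arbitrary parameter $\delta_i\in\mathbb C\setminus\{0\}$; so the operator intertwining $E+E^{-1}$ and $\hat L$ has kernel spanned by these $g$ functions. The normalization of $\hat L$ is the one for which $\hat L\Psi(n,z)=(z+z^{-1})\Psi(n,z)$, with the reduced wave function $$\Psi(n,z)=\frac{1}{\prod_{j=1}^g(z-\lambda_j)}\,\frac{\det\big(\lambda_j^{n+i-1}-\delta_j\mu_j^{n+i-1};\ z^{n+i-1}\big)}{\det\big(\lambda_j^{n+i-1}-\delta_j\mu_j^{n+i-1}\big)_{1\le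 i,j\le g}},$$ where the numerator is the determinant of the $(g+1)\times(g+1)$ matrix with $(i,j)$ entry as indicated for $1\le i\le g+1$, $1\le j\le g$, and last column $z^{n+i-1}$, $1\le i\le g+1$. The $\delta_j$ are assumed such that the denominator is nonzero for all $n\in\mathbb Z$. The ring in (i) consists of the operators $L_f$ with $L_f\Psi(n,z)=f(z)\Psi(n,z)$. *)

theory Defs
  imports
    "HOL-Analysis.Analysis"
    "HOL-Library.Function_Algebras"
    "HOL-Algebra.QuotRing"
    "HOL-Computational_Algebra.Polynomial_Factorial"
    "Jordan_Normal_Form.Determinant"
begin

section \<open>Difference operators on complex sequences\<close>

text \<open>An operator is identified with the linear map it induces; composition is \<open>\<circ>\<close>, and
  sums of operators are pointwise. The coefficients are determined by the map.\<close>

type_synonym seq = "int \<Rightarrow> complex"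

definition diff_op :: "int set \<Rightarrow> (int \<Rightarrow> seq) \<Rightarrow> seq \<Rightarrow> seq" where
  "diff_op S a = (\<lambda>h n. \<Sum>j\<in>S. a j n * h (n + j))"

definition is_diff_op :: "(seq \<Rightarrow> seq) \<Rightarrow> bool" where
  "is_diff_op L \<longleftrightarrow> (\<exists>S a. finite S \<and> L = diff_op S a)"

text \<open>The order may be negative, and the zero operator has none.\<close>

definition diff_order :: "(seq \<Rightarrow> seq) \<Rightarrow> int \<Rightarrow> bool" where
  "diff_order L m \<longleftrightarrow>
     (\<exists>S a. finite S \<and> m \<in> S \<and> (\<forall>j\<in>S. j \<le> m) \<and> a m \<noteq> 0 \<and> L = diff_op S a)"

definition tridiagonal :: "(seq \<Rightarrow> seq) \<Rightarrow> bool" where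
  "tridiagonal L \<longleftrightarrow> (\<exists>a. L = diff_op {-1, 0, 1} a)"

definition scalar_op :: "complex \<Rightarrow> seq \<Rightarrow> seq" where
  "scalar_op x = (\<lambda>h n. x * h n)"

definition mult_op :: "seq \<Rightarrow> seq \<Rightarrow> seq" where
  "mult_op \<gamma> = (\<lambda>h n. \<gamma> n * h n)"

definition free_op :: "seq \<Rightarrow> seq" where
  "free_op = (\<lambda>h n. h (n + 1) + h (n - 1))"


section \<open>The Darboux process\<close>

definition first_order :: "(seq \<Rightarrow> seq) \<Rightarrow> bool" where
  "first_order Q \<longleftrightarrow> (\<exists>a b. Q = (\<lambda>h n. a n * h (n + 1) + b n * h n))"

definition seq_span :: "seq list \<Rightarrow> seq set" where
  "seq_span fs = {h. \<exists>c. h = (\<lambda>n. \<Sum>j<length fs. c j * (fs ! j) n)}"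

text \<open>\<open>darboux bs L T\<close>: starting from \<open>E + E\<^sup>-\<^sup>1\<close>, the process performed successively at the
  points \<open>x\<close> with eigenfunctions \<open>\<phi>\<close> of \<open>E + E\<^sup>-\<^sup>1\<close>, for the entries \<open>(x, \<phi>)\<close> of \<open>bs\<close>, yields \<open>L\<close>.
  Here \<open>T\<close> is the product of the first-order operators used so far, so that \<open>L \<circ> T = T \<circ> free_op\<close>,
  and \<open>\<phi>\<close> enters through the eigenfunction \<open>T \<phi>\<close> of the current operator.\<close>

inductive darboux :: "(complex \<times> seq) list \<Rightarrow> (seq \<Rightarrow> seq) \<Rightarrow> (seq \<Rightarrow> seq) \<Rightarrow> bool" where
  start: "darboux [] free_op id"
| step: "darboux (bs @ [(x, \<phi>)]) (scalar_op x + (Q \<circ> P)) (Q \<circ> T)"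
    if "darboux bs L T" "T \<phi> = \<psi>" "\<psi> \<noteq> 0" "L \<psi> = scalar_op x \<psi>"
      "first_order Q" "{h. Q h = 0} = seq_span [\<psi>]"
      "is_diff_op P" "L = scalar_op x + (P \<circ> Q)"


section \<open>Bound states and the reduced wave function\<close>

definition bound_pt :: "real \<Rightarrow> (nat \<Rightarrow> nat) \<Rightarrow> nat set \<Rightarrow> nat \<Rightarrow> complex" where
  "bound_pt q k J i =
     (if i \<in> J then 1 else -1) * of_real (q powr (real (k i) / 2) + q powr (- real (k i) / 2))"

definition bound_lam :: "real \<Rightarrow> (nat \<Rightarrow> nat) \<Rightarrow> nat set \<Rightarrow> nat \<Rightarrow> complex" where
  "bound_lam q k J i = (if i \<in> J then 1 else -1) * of_real (q powr (real (k i) / 2))"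

definition bound_state :: "complex \<Rightarrow> complex \<Rightarrow> seq" where
  "bound_state l d = (\<lambda>n. l powi n - d * inverse l powi n)"

definition casorati :: "seq list \<Rightarrow> seq" where
  "casorati fs n = det (mat (length fs) (length fs) (\<lambda>(i, j). (fs ! j) (n + int i)))"

text \<open>The reduced wave function with parameters \<open>\<lambda>\<^sub>j = l j\<close> and \<open>\<delta>\<^sub>j = d j\<close> for \<open>j < g\<close>; row and
  column indices start at \<open>0\<close>. The formula makes sense for \<open>z\<close> in any field \<open>'a\<close> containing the
  complex numbers via \<open>emb\<close>: it is used for complex \<open>z\<close> (with \<open>emb = id\<close>) and for the generic
  point \<open>z\<close> of the field \<open>\<complex>(z)\<close>, where it gives \<open>\<Psi>(n, z)\<close> as a rational function of \<open>z\<close>.\<close>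

definition wave :: "(complex \<Rightarrow> 'a::field) \<Rightarrow> nat \<Rightarrow> (nat \<Rightarrow> complex) \<Rightarrow> (nat \<Rightarrow> complex) \<Rightarrow> int \<Rightarrow> 'a \<Rightarrow> 'a"
  where
  "wave emb g l d n z =
     1 / (\<Prod>j<g. z - emb (l j)) *
     (det (mat (g + 1) (g + 1) (\<lambda>(i, j).
        if j < g then emb (bound_state (l j) (d j) (n + int i)) else z powi (n + int i)))
      / emb (casorati (map (\<lambda>j. bound_state (l j) (d j)) [0..<g]) n))"

definition has_symbol ::
  "nat \<Rightarrow> (nat \<Rightarrow> complex) \<Rightarrow> (nat \<Rightarrow> complex) \<Rightarrow> (seq \<Rightarrow> seq) \<Rightarrow> (complex \<Rightarrow> complex) \<Rightarrow> bool" where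
  "has_symbol g l d L f \<longleftrightarrow>
     (\<forall>n z. z \<noteq> 0 \<and> (\<forall>j<g. z \<noteq> l j) \<longrightarrow>
        L (\<lambda>m. wave id g l d m z) n = f z * wave id g l d n z)"

definition spectral_ring ::
  "nat \<Rightarrow> (nat \<Rightarrow> complex) \<Rightarrow> (nat \<Rightarrow> complex) \<Rightarrow> (seq \<Rightarrow> seq) set" where
  "spectral_ring g l d = {L. is_diff_op L \<and> (\<exists>f. has_symbol g l d L f)}"


section \<open>\<open>q\<close>-difference operators with rational coefficients\<close>

type_synonym ratfun = "complex poly fract"

definition rat_const :: "complex \<Rightarrow> ratfun" where
  "rat_const c = to_fract [:c:]"

definition rat_z :: ratfun where
  "rat_z = to_fract [:0, 1:]"

text \<open>The substitution \<open>h(z) \<mapsto> h(c z)\<close>, for \<open>c \<noteq> 0\<close>.\<close>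

definition dilate :: "complex \<Rightarrow> ratfun \<Rightarrow> ratfun" where
  "dilate c h =
     (THE s. \<exists>a b. b \<noteq> 0 \<and> h = Fract a b \<and>
                  s = Fract (pcompose a [:0, c:]) (pcompose b [:0, c:]))"

lemma dilate_Fract:
  assumes "c \<noteq> 0" "b \<noteq> 0"
  shows "dilate c (Fract a b) = Fract (pcompose a [:0, c:]) (pcompose b [:0, c:])"
  unfolding dilate_def
proof (rule the_equality)
  show "\<exists>a' b'. b' \<noteq> 0 \<and> Fract a b = Fract a' b' \<and>
      Fract (pcompose a [:0, c:]) (pcompose b [:0, c:]) =
      Fract (pcompose a' [:0, c:]) (pcompose b' [:0, c:])"
    using \<open>b \<noteq> 0\<close> by blast
next
  fix s
  assume "\<exists>a' b'. b' \<noteq> 0 \<and> Fract a b = Fract a' b' \<and>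
      s = Fract (pcompose a' [:0, c:]) (pcompose b' [:0, c:])"
  then obtain p r where r: "r \<noteq> 0" and eq: "Fract a b = Fract p r"
    and s: "s = Fract (pcompose p [:0, c:]) (pcompose r [:0, c:])"
    by blast
  have deg: "degree [:0, c:] > 0"
    using \<open>c \<noteq> 0\<close> by simp
  have nz: "pcompose w [:0, c:] \<noteq> 0" if "w \<noteq> 0" for w
    using pcompose_eq_0[OF _ deg, of w] that by blast
  have "p * b = a * r"
    using eq by (simp only: eq_fract(1)[OF \<open>b \<noteq> 0\<close> r])
  then have "pcompose p [:0, c:] * pcompose b [:0, c:] = pcompose a [:0, c:] * pcompose r [:0, c:]"
    by (simp only: pcompose_mult [symmetric])
  then show "s = Fract (pcompose a [:0, c:]) (pcompose b [:0, c:])"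
    unfolding s by (simp only: eq_fract(1)[OF nz[OF r] nz[OF \<open>b \<noteq> 0\<close>]])
qed

text \<open>\<open>\<Sum>\<^sub>j D\<^sub>j(z) D\<^sub>z\<^sup>j\<close> acting on \<open>\<complex>(z)\<close>. For \<open>0 < q < 1\<close> the dilations by the powers of \<open>q\<close> are
  distinct automorphisms, so the map determines the coefficients.\<close>

definition qdiff_op :: "real \<Rightarrow> int set \<Rightarrow> (int \<Rightarrow> ratfun) \<Rightarrow> ratfun \<Rightarrow> ratfun" where
  "qdiff_op q S D = (\<lambda>h. \<Sum>j\<in>S. D j * dilate (of_real q powi j) h)"

definition is_qdiff_op :: "real \<Rightarrow> (ratfun \<Rightarrow> ratfun) \<Rightarrow> bool" where
  "is_qdiff_op q B \<longleftrightarrow> (\<exists>S D. finite S \<and> B = qdiff_op q S D)"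

definition qdiff_order :: "real \<Rightarrow> (ratfun \<Rightarrow> ratfun) \<Rightarrow> int \<Rightarrow> bool" where
  "qdiff_order q B m \<longleftrightarrow>
     (\<exists>S D. finite S \<and> m \<in> S \<and> (\<forall>j\<in>S. j \<le> m) \<and> D m \<noteq> 0 \<and> B = qdiff_op q S D)"


section \<open>Rings of operators and plane curves\<close>

definition op_ring :: "('v::ab_group_add \<Rightarrow> 'v) set \<Rightarrow> ('v \<Rightarrow> 'v) ring" where
  "op_ring R = \<lparr>carrier = R, monoid.mult = (\<circ>), one = id, zero = 0, add = (+)\<rparr>"

definition op_rank :: "(('v \<Rightarrow> 'v) \<Rightarrow> int \<Rightarrow> bool) \<Rightarrow> ('v \<Rightarrow> 'v) set \<Rightarrow> int" where
  "op_rank ord R = Gcd {m. \<exists>L\<in>R. ord L m}"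

text \<open>Elements of \<open>\<complex>[u][v]\<close> are polynomials in \<open>v\<close> whose coefficients are polynomials in \<open>u\<close>.\<close>

definition plane_ring :: "complex poly poly ring" where
  "plane_ring = \<lparr>carrier = UNIV, monoid.mult = (*), one = 1, zero = 0, add = (+)\<rparr>"

definition curve_ideal :: "complex poly poly \<Rightarrow> complex poly poly set" where
  "curve_ideal F = genideal plane_ring {F}"

definition curve_ring :: "complex poly poly \<Rightarrow> complex poly poly set ring" where
  "curve_ring F = plane_ring Quot curve_ideal F"

text \<open>The isomorphism is required to be one of \<open>\<complex>\<close>-algebras.\<close>

definition has_spectral_curve :: "(seq \<Rightarrow> seq) set \<Rightarrow> complex poly poly \<Rightarrow> bool" where
  "has_spectral_curve R F \<longleftrightarrow>
     (\<exists>\<Phi> \<in> ring_iso (op_ring R) (curve_ring F).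
        \<forall>c. \<Phi> (scalar_op c) = a_r_coset plane_ring (curve_ideal F) [:[:c:]:])"

definition bound_curve :: "real \<Rightarrow> (nat \<Rightarrow> nat) \<Rightarrow> nat set \<Rightarrow> nat set \<Rightarrow> complex poly poly" where
  "bound_curve q k J K =
     (let a = (\<lambda>i. of_real (q powr (real (k i) / 2) + q powr (- real (k i) / 2)));
          u = [:0, 1:]; v = [:0, 1:]
      in v\<^sup>2 - [: (u\<^sup>2 - 4) * (\<Prod>i\<in>J. (u - [:a i:])\<^sup>2) * (\<Prod>i\<in>K. (u + [:a i:])\<^sup>2) :])"

end

theory Submission
  imports Defs
begin

text \<open>Up to the factor \<open>\<Prod>\<^sub>j (z - \<lambda>\<^sub>j)\<close>, the functions \<open>\<Psi>(n, z)\<close> form a basis, triangular with respect to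
  the degree, of the space \<open>V\<close> of Laurent polynomials \<open>w\<close> with \<open>w(\<lambda>\<^sub>j) = \<delta>\<^sub>j w(\<lambda>\<^sub>j\<^sup>-\<^sup>1)\<close> for all \<open>j\<close>. A
  difference operator with symbol \<open>f\<close> is therefore multiplication by \<open>f\<close> on \<open>V\<close>, and \<open>f\<close> must be a
  Laurent polynomial with \<open>f(\<lambda>\<^sub>j) = f(\<lambda>\<^sub>j\<^sup>-\<^sup>1)\<close>. With \<open>u = z + z\<^sup>-\<^sup>1\<close>, these are the \<open>a(u) + b(u) v\<close> where
  \<open>v = (z - z\<^sup>-\<^sup>1) \<Prod>\<^sub>j (u - \<lambda>\<^sub>j - \<lambda>\<^sub>j\<^sup>-\<^sup>1)\<close>, that is, the functions on the curve.

  For the second part, since \<open>\<lambda>\<^sub>j\<^sup>2\<close> is a power of \<open>q\<close>, the evaluations at \<open>\<lambda>\<^sub>j\<close> and \<open>\<lambda>\<^sub>j\<^sup>-\<^sup>1\<close> are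
  related by a power of the dilation \<open>D\<close>. This yields \<open>q\<close>-difference operators \<open>Y\<close> and \<open>X\<close> that map the
  \<open>n\<close>-th element of the basis of \<open>V\<close> to a multiple of \<open>z\<^sup>n\<close>, and \<open>z\<^sup>n\<close> to a multiple of that element. The
  operators \<open>X D\<^sup>e Y\<close> for \<open>e = 0, 1\<close> then have consecutive orders and the required eigenfunctions.\<close>

section \<open>Linear algebra\<close>

text \<open>The symbol \<open>f\<close> of an operator is a priori just a function of z away from
  the \<open>l j\<close>. That it is a Laurent polynomial with equal values at the two points of
  each pair must be extracted from f V \<subseteq> V: elements of V vanishing at all pairs bound the
  poles, elements that do not vanish at the j-th pair then remove them, and continuity carries the
  identities to the excluded points.

  The operator of part (i) is built from its symbol and not by the Darboux process, because in a
  given order of the points the process calls for nonvanishing intermediate Casoratians.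

  Since q^(k_j) times the inverse of \<open>l j\<close> is \<open>l j\<close> for either sign, J and
  K are treated alike. The coefficients of X and Y come from counting unknowns, so their orders stay
  unknown and their factors may vanish for some n. For rank 1 it suffices that both operators are
  nonzero, as one more dilation between them raises the order by exactly one.\<close>

lemma underdetermined_solution:
  fixes M :: "'b \<Rightarrow> 'a \<Rightarrow> 'f::field"
  assumes "finite B" "finite A" "card B < card A"
  shows "\<exists>\<eta>. (\<exists>a\<in>A. \<eta> a \<noteq> 0) \<and> (\<forall>b\<in>B. (\<Sum>a\<in>A. M b a * \<eta> a) = 0)"
  using assms
proof (induction B arbitrary: A M rule: finite_induct)
  case empty
  then have "A \<noteq> {}" by auto
  then show ?case by (intro exI[of _ "\<lambda>_. 1"]) auto
next
  case (insert b B)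
  show ?case
  proof (cases "\<forall>a\<in>A. M b a = 0")
    case True
    have "card B < card A" using insert by simp
    from insert.IH[OF insert.prems(1) this, of M] obtain \<eta> where
      "\<exists>a\<in>A. \<eta> a \<noteq> 0" "\<forall>b\<in>B. (\<Sum>a\<in>A. M b a * \<eta> a) = 0" by blast
    then show ?thesis using True by (intro exI[of _ \<eta>]) auto
  next
    case False
    then obtain p where p: "p \<in> A" "M b p \<noteq> 0" by blast
    define A' where "A' = A - {p}"
    have A': "finite A'" "A = insert p A'" "p \<notin> A'" using p insert.prems by (auto simp: A'_def)
    have "card B < card A'" using insert A' by simp
    \<comment> \<open>Gaussian elimination: equation b is solved for the unknown \<open>p\<close>,
      with value \<open>s\<close>, and substituted into the other equations.\<close>
    from insert.IH[OF A'(1) this, of "\<lambda>c a. M c a - M c p * M b a / M b p"]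
    obtain \<eta> where \<eta>: "\<exists>a\<in>A'. \<eta> a \<noteq> 0"
      "\<And>c. c \<in> B \<Longrightarrow> (\<Sum>a\<in>A'. (M c a - M c p * M b a / M b p) * \<eta> a) = 0" by blast
    define s where "s = - (\<Sum>a\<in>A'. M b a * \<eta> a) / M b p"
    define \<zeta> where "\<zeta> = \<eta>(p := s)"
    have S: "(\<Sum>a\<in>A. M c a * \<zeta> a) = M c p * s + (\<Sum>a\<in>A'. M c a * \<eta> a)" for c
    proof -
      have "(\<Sum>a\<in>A'. M c a * \<zeta> a) = (\<Sum>a\<in>A'. M c a * \<eta> a)"
        by (rule sum.cong) (use A' in \<open>auto simp: \<zeta>_def\<close>)
      then show ?thesis using A' by (simp add: \<zeta>_def)
    qed
    have "(\<Sum>a\<in>A. M c a * \<zeta> a) = 0" if "c \<in> insert b B" for c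
    proof (cases "c = b")
      case True
      then show ?thesis using p by (simp add: S s_def)
    next
      case False
      have "0 = (\<Sum>a\<in>A'. (M c a - M c p * M b a / M b p) * \<eta> a)" using \<eta>(2)[of c] that False by auto
      also have "\<dots> = (\<Sum>a\<in>A'. M c a * \<eta> a) - M c p / M b p * (\<Sum>a\<in>A'. M b a * \<eta> a)"
        by (simp add: sum_subtractf[symmetric] sum_distrib_left algebra_simps)
      finally show ?thesis by (simp add: S s_def)
    qed
    moreover have "\<exists>a\<in>A. \<zeta> a \<noteq> 0" using \<eta>(1) A' by (auto simp: \<zeta>_def)
    ultimately show ?thesis by blast
  qed
qed

lemma det_nonzero_left_kernel:
  fixes f :: "nat \<Rightarrow> nat \<Rightarrow> 'f::field"
  assumes "det (mat n n (\<lambda>(i, j). f i j)) \<noteq> 0" "\<And>j. j < n \<Longrightarrow> (\<Sum>i<n. t i * f i j) = 0" "i < n"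
  shows "t i = 0"
proof (rule ccontr)
  assume ti: "t i \<noteq> 0"
  define M where "M = transpose_mat (mat n n (\<lambda>(i, j). f i j))"
  have M: "M \<in> carrier_mat n n" by (simp add: M_def)
  have "det M \<noteq> 0" using assms(1) by (simp add: M_def det_transpose[of _ n])
  moreover have "vec n t \<noteq> 0\<^sub>v n" using ti \<open>i < n\<close> by (metis index_vec index_zero_vec(1))
  moreover have "M *\<^sub>v vec n t = 0\<^sub>v n"
    using assms(2)
    by (intro eq_vecI) (auto simp: M_def scalar_prod_def atLeast0LessThan mult.commute)
  moreover have "vec n t \<in> carrier_vec n" by simp
  ultimately show False using det_0_iff_vec_prod_zero_field[OF M] by blast
qed

lemma det_nonzero_right_kernel:
  fixes f :: "nat \<Rightarrow> nat \<Rightarrow> 'f::field"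
  assumes "det (mat n n (\<lambda>(i, j). f i j)) \<noteq> 0" "\<And>i. i < n \<Longrightarrow> (\<Sum>j<n. f i j * c j) = 0" "j < n"
  shows "c j = 0"
proof -
  have "transpose_mat (mat n n (\<lambda>(i, j). f j i)) = mat n n (\<lambda>(i, j). f i j)"
    by (intro eq_matI) auto
  then have "det (mat n n (\<lambda>(i, j). f j i)) \<noteq> 0"
    using assms(1) det_transpose[of "mat n n (\<lambda>(i, j). f j i)" n] by simp
  then show ?thesis
    using det_nonzero_left_kernel[of n "\<lambda>i j. f j i" c j] assms(2,3) by (simp add: mult.commute)
qed

text \<open>A Vandermonde argument: vanishing power moments make \<open>D\<close> orthogonal to
  every polynomial in the nodes, and a polynomial vanishing at all nodes but \<open>r i\<close>
  isolates \<open>D i\<close>. With nodes q^j this later separates the terms of a q-difference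
  operator.\<close>

lemma power_sum_independent:
  fixes r D :: "'b \<Rightarrow> 'f::field"
  assumes S: "finite S" "inj_on r S" and z: "\<And>m::nat. (\<Sum>j\<in>S. D j * r j ^ m) = 0" and i: "i \<in> S"
  shows "D i = 0"
proof -
  have P: "(\<Sum>j\<in>S. D j * poly p (r j)) = 0" for p
  proof -
    have "(\<Sum>j\<in>S. D j * poly p (r j)) = (\<Sum>j\<in>S. \<Sum>m\<le>degree p. coeff p m * (D j * r j ^ m))"
      by (simp add: poly_altdef sum_distrib_left mult_ac)
    also have "\<dots> = (\<Sum>m\<le>degree p. coeff p m * (\<Sum>j\<in>S. D j * r j ^ m))"
      by (subst sum.swap) (simp add: sum_distrib_left)
    finally show ?thesis by (simp add: z)
  qed
  define p where "p = (\<Prod>j\<in>S-{i}. [:- r j, 1:])"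
  have "poly p (r j) = 0" if "j \<in> S - {i}" for j
    using that S by (force simp: p_def poly_prod)
  then have "(\<Sum>j\<in>S. D j * poly p (r j)) = D i * poly p (r i)"
    using S i by (subst sum.remove[of _ i]) auto
  moreover have "poly p (r i) \<noteq> 0"
    using S i by (force simp: p_def poly_prod inj_on_def)
  ultimately show ?thesis using P by simp
qed

lemma prod_linear_dvd:
  fixes p :: "'f::field poly"
  assumes "finite S" "inj_on x S" "\<And>i. i \<in> S \<Longrightarrow> poly p (x i) = 0"
  shows "(\<Prod>i\<in>S. [:- x i, 1:]) dvd p"
  using assms
proof (induction S rule: finite_induct)
  case (insert i S)
  then have "(\<Prod>i\<in>S. [:- x i, 1:]) dvd p" by auto
  then obtain r where r: "p = (\<Prod>i\<in>S. [:- x i, 1:]) * r" by (auto elim: dvdE)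
  have "(\<Prod>j\<in>S. x i - x j) \<noteq> 0" using insert by (auto simp: inj_on_def)
  moreover have "poly p (x i) = 0" using insert by auto
  ultimately have "poly r (x i) = 0" by (simp add: r poly_prod)
  then have "[:- x i, 1:] dvd r" by (simp add: poly_eq_0_iff_dvd)
  then show ?case
    unfolding r prod.insert[OF insert.hyps] mult.commute[of "[:- x i, 1:]"] by (rule mult_dvd_mono[OF dvd_refl])
qed simp

section \<open>Operators with coefficients in a ring with shifts\<close>

text \<open>Difference operators and \<open>q\<close>-difference operators are both of the form
  \<open>\<Sum>\<^sub>j a\<^sub>j \<sigma>\<^sub>j\<close> for an action \<open>\<sigma>\<close> of the integers on a commutative ring.\<close>

locale int_action =
  fixes s :: "int \<Rightarrow> 'v::comm_ring \<Rightarrow> 'v"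
  assumes s_add: "s j (x + y) = s j x + s j y"
    and s_mult: "s j (x * y) = s j x * s j y"
    and s_comp: "s i (s j x) = s (i + j) x"
    and s_0: "s 0 x = x"
begin

definition opr :: "int set \<Rightarrow> (int \<Rightarrow> 'v) \<Rightarrow> 'v \<Rightarrow> 'v" where
  "opr S a = (\<lambda>h. \<Sum>j\<in>S. a j * s j h)"

definition is_opr :: "('v \<Rightarrow> 'v) \<Rightarrow> bool" where
  "is_opr L \<longleftrightarrow> (\<exists>S a. finite S \<and> L = opr S a)"

lemma s_zero [simp]: "s j 0 = 0"
  using s_add[of j 0 0] by simp

lemma s_sum: "s j (sum f A) = (\<Sum>a\<in>A. s j (f a))"
  by (induction A rule: infinite_finite_induct) (auto simp: s_add)

lemma opr_extend: "finite S' \<Longrightarrow> S \<subseteq> S' \<Longrightarrow> opr S a = opr S' (\<lambda>j. if j \<in> S then a j else 0)"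
  unfolding opr_def by (intro ext sum.mono_neutral_cong_left) auto

lemma is_opr_monomial: "is_opr (\<lambda>h. b * s j h)"
  unfolding is_opr_def by (intro exI[of _ "{j}"] exI[of _ "\<lambda>_. b"]) (auto simp: opr_def)

lemma is_opr_zero: "is_opr 0"
  unfolding is_opr_def by (intro exI[of _ "{}"]) (auto simp: opr_def)

lemma is_opr_id': "is_opr (\<lambda>h. b * h)"
  using is_opr_monomial[of b 0] by (simp add: s_0)

lemma is_opr_add:
  assumes "is_opr L" "is_opr M" shows "is_opr (L + M)"
proof -
  obtain S a S' b where *: "finite S" "L = opr S a" "finite S'" "M = opr S' b"
    using assms unfolding is_opr_def by blast
  have "L + M = opr (S \<union> S') (\<lambda>j. (if j \<in> S then a j else 0) + (if j \<in> S' then b j else 0))"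
    unfolding *(2,4) using *(1,3) opr_extend[of "S \<union> S'" S a] opr_extend[of "S \<union> S'" S' b]
    by (auto simp: fun_eq_iff opr_def distrib_right sum.distrib)
  then show ?thesis unfolding is_opr_def using *(1,3) by blast
qed

lemma is_opr_sum: "(\<And>i. i \<in> A \<Longrightarrow> is_opr (f i)) \<Longrightarrow> is_opr (\<lambda>h. \<Sum>i\<in>A. f i h)"
proof (induction A rule: infinite_finite_induct)
  case (insert i A)
  then show ?case using is_opr_add[of "f i" "\<lambda>h. \<Sum>i\<in>A. f i h"] by (simp add: plus_fun_def)
qed (use is_opr_zero in \<open>auto simp: zero_fun_def\<close>)

lemma opr_additive: "is_opr L \<Longrightarrow> L (x + y) = L x + L y"
  by (auto simp: is_opr_def opr_def s_add distrib_left sum.distrib)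

lemma opr_compose_eq:
  "opr S a \<circ> opr S' b = (\<lambda>h. \<Sum>i\<in>S. \<Sum>j\<in>S'. (a i * s i (b j)) * s (i + j) h)"
  by (auto simp: opr_def fun_eq_iff s_sum s_mult s_comp sum_distrib_left mult_ac)

lemma is_opr_compose:
  assumes "is_opr L" "is_opr M" shows "is_opr (L \<circ> M)"
proof -
  obtain S a S' b where *: "finite S" "L = opr S a" "finite S'" "M = opr S' b"
    using assms unfolding is_opr_def by blast
  show ?thesis unfolding * opr_compose_eq by (intro is_opr_sum is_opr_monomial)
qed

lemma is_opr_uminus:
  assumes "is_opr L" shows "is_opr (- L)"
proof -
  obtain S a where "finite S" "L = opr S a" using assms by (auto simp: is_opr_def)
  then show ?thesis unfolding is_opr_def
    by (intro exI[of _ S] exI[of _ "\<lambda>j. - a j"]) (auto simp: opr_def fun_eq_iff sum_negf)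
qed

lemma is_opr_diff: "is_opr L \<Longrightarrow> is_opr M \<Longrightarrow> is_opr (L - M)"
  using is_opr_add[of L "- M"] is_opr_uminus[of M] by simp

end

lemma cring_op_ring:
  fixes R :: "('v::ab_group_add \<Rightarrow> 'v) set"
  assumes additive: "\<And>L x y. L \<in> R \<Longrightarrow> L (x + y) = L x + L y"
    and zero: "0 \<in> R" and one: "id \<in> R"
    and add: "\<And>L M. L \<in> R \<Longrightarrow> M \<in> R \<Longrightarrow> L + M \<in> R"
    and uminus: "\<And>L. L \<in> R \<Longrightarrow> - L \<in> R"
    and comp: "\<And>L M. L \<in> R \<Longrightarrow> M \<in> R \<Longrightarrow> L \<circ> M \<in> R"
    and comm: "\<And>L M. L \<in> R \<Longrightarrow> M \<in> R \<Longrightarrow> L \<circ> M = M \<circ> L"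
  shows "cring (op_ring R)"
proof -
  have "abelian_group (op_ring R)"
  proof (rule abelian_groupI)
    fix L assume "L \<in> carrier (op_ring R)"
    then show "\<exists>M\<in>carrier (op_ring R). M \<oplus>\<^bsub>op_ring R\<^esub> L = \<zero>\<^bsub>op_ring R\<^esub>"
      using uminus[of L] by (intro bexI[of _ "- L"]) (auto simp: op_ring_def)
  qed (auto simp: op_ring_def zero add add.assoc add.commute)
  moreover have "comm_monoid (op_ring R)"
    by (rule comm_monoidI) (auto simp: op_ring_def one comp comp_assoc comm)
  ultimately show ?thesis
    by (rule cringI) (auto simp: op_ring_def fun_eq_iff)
qed

section \<open>Difference operators and the Darboux process\<close>

lemma sum_fun_apply: "(\<Sum>i\<in>A. f i) x = (\<Sum>i\<in>A. f i x)"
  by (induction A rule: infinite_finite_induct) auto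

interpretation seq_ops: int_action "\<lambda>j (h::seq) n. h (n + j)"
  by unfold_locales (auto simp: fun_eq_iff add_ac)

lemma diff_op_eq_opr: "diff_op S a = seq_ops.opr S a"
  by (auto simp: diff_op_def seq_ops.opr_def fun_eq_iff sum_fun_apply)

lemma is_diff_op_eq: "is_diff_op = seq_ops.is_opr"
  by (auto simp: is_diff_op_def seq_ops.is_opr_def diff_op_eq_opr fun_eq_iff)

lemmas diff_op_closed =
  seq_ops.is_opr_zero seq_ops.is_opr_add seq_ops.is_opr_uminus seq_ops.is_opr_diff
  seq_ops.is_opr_compose seq_ops.is_opr_sum

lemma is_diff_op_shift: "is_diff_op (\<lambda>h n. a n * h (n + j))"
  using seq_ops.is_opr_monomial[of a j] by (simp add: is_diff_op_eq times_fun_def)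

lemma is_diff_op_mult: "is_diff_op (mult_op a)"
  using is_diff_op_shift[of a 0] by (simp add: mult_op_def)

lemma is_diff_op_scalar: "is_diff_op (scalar_op c)"
  using is_diff_op_shift[of "\<lambda>_. c" 0] by (simp add: scalar_op_def)

lemma diff_op_scale: "is_diff_op L \<Longrightarrow> L (\<lambda>n. c * h n) n = c * L h n"
  by (auto simp: is_diff_op_def diff_op_def sum_distrib_left mult_ac)

lemma diff_op_sum: "is_diff_op L \<Longrightarrow> L (\<lambda>n. \<Sum>i\<in>A. c i * h i n) n = (\<Sum>i\<in>A. c i * L (h i) n)"
  by (auto simp: is_diff_op_def diff_op_def sum_distrib_left mult_ac intro: sum.swap)

lemma diff_op_additive: "is_diff_op L \<Longrightarrow> L (x + y) = L x + L y"
  unfolding is_diff_op_eq by (rule seq_ops.opr_additive)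

section \<open>Coefficients of difference operators, and operators killing given sequences\<close>

definition dirac :: "int \<Rightarrow> seq" where
  "dirac m n = (if n = m then 1 else 0)"

text \<open>The coefficient of E^j at n, expressed through the map alone: a delta at n + j is seen
  only by that term.\<close>

definition op_coeff :: "(seq \<Rightarrow> seq) \<Rightarrow> int \<Rightarrow> seq" where
  "op_coeff L j n = L (dirac (n + j)) n"

lemma op_coeff_diff_op: "finite S \<Longrightarrow> op_coeff (diff_op S a) j n = (if j \<in> S then a j n else 0)"
  by (simp add: op_coeff_def diff_op_def dirac_def if_distrib cong: if_cong)

lemma diff_op_eq_op_coeff:
  assumes "is_diff_op L" "\<And>j n. j \<notin> S \<Longrightarrow> op_coeff L j n = 0" "finite S"
  shows "L = diff_op S (op_coeff L)"
proof -
  obtain S' a where S': "finite S'" "L = diff_op S' a" using assms(1) by (auto simp: is_diff_op_def)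
  show ?thesis
  proof (intro ext)
    fix h n
    have "L h n = (\<Sum>j\<in>S'. op_coeff L j n * h (n + j))"
      unfolding S'(2) op_coeff_diff_op[OF S'(1)] by (simp add: diff_op_def)
    also have "\<dots> = (\<Sum>j\<in>S' \<union> S. op_coeff L j n * h (n + j))"
      using S' assms(3) by (intro sum.mono_neutral_left) (auto simp: op_coeff_diff_op)
    also have "\<dots> = (\<Sum>j\<in>S. op_coeff L j n * h (n + j))"
      using S' assms(2,3) by (intro sum.mono_neutral_right) auto
    finally show "L h n = diff_op S (op_coeff L) h n" by (simp add: diff_op_def)
  qed
qed

lemma op_coeff_finite: "is_diff_op L \<Longrightarrow> finite {j. op_coeff L j n \<noteq> 0}"
  proof -
  assume "is_diff_op L"
  then obtain S a where "finite S" "L = diff_op S a" by (auto simp: is_diff_op_def)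
  then show ?thesis by (auto simp: op_coeff_diff_op split: if_splits elim!: rev_finite_subset)
qed

definition forward_op :: "nat \<Rightarrow> (nat \<Rightarrow> seq) \<Rightarrow> seq \<Rightarrow> seq" where
  "forward_op m t h n = (\<Sum>i\<le>m. t i n * h (n + int i))"

lemma is_diff_op_forward: "is_diff_op (forward_op m t)"
proof -
  have "is_diff_op (\<lambda>h n. \<Sum>i\<le>m. t i n * h (n + int i))"
    using seq_ops.is_opr_sum[of "{..m}" "\<lambda>i h n. t i n * h (n + int i)"] is_diff_op_shift
    by (auto simp: is_diff_op_eq sum_fun_apply[abs_def] fun_eq_iff sum_fun_apply elim: back_subst[of seq_ops.is_opr])
  then show ?thesis by (simp add: forward_op_def[abs_def])
qed

text \<open>Subtracting \<open>t m n\<close> times the monic operator leaves an operator of order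
  below \<open>m\<close> that still kills the \<open>m\<close> sequences at \<open>n\<close>; its
  coefficients are a left null vector of the Casorati matrix.\<close>

lemma forward_op_unique:
  assumes "casorati fs n \<noteq> 0" "m = length fs"
    and "\<And>f. f \<in> set fs \<Longrightarrow> forward_op m t f n = 0" "\<And>f. f \<in> set fs \<Longrightarrow> forward_op m c f n = 0"
    and "c m n = 1" "i \<le> m"
  shows "t i n = t m n * c i n"
proof (cases "i = m")
  case False
  define e where "e i = t i n - t m n * c i n" for i
  have "e i = 0"
  proof (rule det_nonzero_left_kernel[of m "\<lambda>i j. (fs ! j) (n + int i)"])
    show "det (mat m m (\<lambda>(i, j). (fs ! j) (n + int i))) \<noteq> 0"
      using assms(1,2) by (simp add: casorati_def)
    fix j assume "j < m"
    then have mem: "fs ! j \<in> set fs" using assms(2) by simp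
    have "e m = 0" by (simp add: e_def assms(5))
    then have "(\<Sum>i<m. e i * (fs ! j) (n + int i)) = (\<Sum>i\<le>m. e i * (fs ! j) (n + int i))"
      by (simp add: lessThan_Suc_atMost[symmetric])
    also have "\<dots> = forward_op m t (fs ! j) n - t m n * forward_op m c (fs ! j) n"
      by (simp add: e_def forward_op_def sum_subtractf[symmetric] sum_distrib_left algebra_simps)
    finally show "(\<Sum>i<m. e i * (fs ! j) (n + int i)) = 0" using assms(3,4)[OF mem] by simp
  qed (use False assms(6) in auto)
  then show ?thesis by (simp add: e_def)
qed (use assms in auto)

text \<open>Otherwise the coefficients would be a nonzero left null vector of the Casorati matrix of
  \<open>fs @ [f]\<close>. This keeps the eigenfunction used in the next Darboux step free of
  zeros.\<close>

lemma forward_op_nonzero: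
  assumes "casorati (fs @ [f]) n \<noteq> 0" "\<And>f. f \<in> set fs \<Longrightarrow> forward_op (length fs) t f n = 0"
    and "t (length fs) n \<noteq> 0"
  shows "forward_op (length fs) t f n \<noteq> 0"
proof
  assume z: "forward_op (length fs) t f n = 0"
  let ?m = "length fs"
  have "t ?m n = 0"
  proof (rule det_nonzero_left_kernel[of "Suc ?m" "\<lambda>i j. ((fs @ [f]) ! j) (n + int i)" "\<lambda>i. t i n"])
    show "det (mat (Suc ?m) (Suc ?m) (\<lambda>(i, j). ((fs @ [f]) ! j) (n + int i))) \<noteq> 0"
      using assms(1) by (simp add: casorati_def)
    fix j assume "j < Suc ?m"
    then have "(fs @ [f]) ! j \<in> set fs \<or> (fs @ [f]) ! j = f"
      by (auto simp: nth_append)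
    then show "(\<Sum>i<Suc ?m. t i n * ((fs @ [f]) ! j) (n + int i)) = 0"
      using z assms(2) by (auto simp: forward_op_def lessThan_Suc_atMost)
  qed simp
  then show False using assms(3) by simp
qed

section \<open>The Darboux process\<close>

definition nondegenerate_tridiagonal :: "(seq \<Rightarrow> seq) \<Rightarrow> bool" where
  "nondegenerate_tridiagonal L \<longleftrightarrow>
     (\<exists>\<alpha>. L = diff_op {-1, 0, 1} \<alpha> \<and> (\<forall>n. \<alpha> 1 n \<noteq> 0 \<and> \<alpha> (-1) n \<noteq> 0))"

text \<open>The eigenvalue equation is a three-term recursion, solvable in both directions because
  both outer coefficients are nonzero.\<close>

lemma tridiagonal_eigenfunction_zeros:
  assumes L: "nondegenerate_tridiagonal L" "L \<psi> = scalar_op x \<psi>" and z: "\<psi> k = 0" "\<psi> (k + 1) = 0"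
  shows "\<psi> n = 0"
proof -
  obtain \<alpha> where \<alpha>: "L = diff_op {-1, 0, 1} \<alpha>" "\<And>n. \<alpha> 1 n \<noteq> 0" "\<And>n. \<alpha> (-1) n \<noteq> 0"
    using L(1) by (auto simp: nondegenerate_tridiagonal_def)
  have eq: "\<alpha> (-1) n * \<psi> (n - 1) + \<alpha> 0 n * \<psi> n + \<alpha> 1 n * \<psi> (n + 1) = x * \<psi> n" for n
    using fun_cong[OF L(2), of n] by (simp add: \<alpha>(1) diff_op_def scalar_op_def add.assoc)
  have "\<psi> n = 0 \<and> \<psi> (n + 1) = 0"
  proof (induction n rule: int_induct[of _ k])
    case (step1 i)
    then show ?case using eq[of "i + 1"] \<alpha>(2)[of "i + 1"] by (simp add: add.commute)
  next
    case (step2 i)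
    then show ?case using eq[of i] \<alpha>(3)[of i] by simp
  qed (use z in auto)
  then show ?thesis by simp
qed

lemma seq_span_singleton: "seq_span [\<psi>] = {h. \<exists>c. h = (\<lambda>n. c * \<psi> n)}"
  proof (rule Set.set_eqI, rule iffI)
  fix h assume "h \<in> {h. \<exists>c. h = (\<lambda>n. c * \<psi> n)}"
  then obtain c where "h = (\<lambda>n. c * \<psi> n)" by blast
  then show "h \<in> seq_span [\<psi>]" by (auto simp: seq_span_def intro!: exI[of _ "\<lambda>_. c"])
qed (auto simp: seq_span_def)

text \<open>If a coefficient of \<open>Q\<close> vanished at \<open>k\<close>, then cutting \<open>\<psi>\<close> off at \<open>k\<close> would give a second
  element of the kernel.\<close>

lemma first_order_coeffs_nonzero:
  assumes ker: "{h. (\<lambda>n. a n * h (n + 1) + b n * h n) = (0::seq)} = seq_span [\<psi>]"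
    and zeros: "\<And>k. \<psi> k = 0 \<Longrightarrow> \<psi> (k + 1) \<noteq> 0"
  shows "a k \<noteq> 0" "b k \<noteq> 0"
proof -
  have K: "(\<forall>n. a n * h (n + 1) + b n * h n = 0) \<longleftrightarrow> (\<exists>c. h = (\<lambda>n. c * \<psi> n))" for h
    using ker unfolding seq_span_singleton by (auto simp: set_eq_iff fun_eq_iff)
  have Q: "a n * \<psi> (n + 1) + b n * \<psi> n = 0" for n
    using K[of \<psi>] by (metis mult_1)
  have no_cut: False if cut: "\<And>n. a n * (if n + 1 \<le> k then \<psi> (n + 1) else 0) + b n * (if n \<le> k then \<psi> n else 0) = 0"
  proof -
    obtain c where c: "(\<lambda>n. if n \<le> k then \<psi> n else 0) = (\<lambda>n. c * \<psi> n)"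
      using iffD1[OF K[of "\<lambda>n. if n \<le> k then \<psi> n else 0"]] cut by auto
    have "c * \<psi> (k + 1) = 0" "c * \<psi> (k + 2) = 0"
      using fun_cong[OF c, of "k + 1"] fun_cong[OF c, of "k + 2"] by auto
    then have "c = 0" using zeros[of "k + 1"] by (auto simp: add.assoc)
    moreover have "\<psi> k = c * \<psi> k" "\<psi> (k - 1) = c * \<psi> (k - 1)"
      using fun_cong[OF c, of k] fun_cong[OF c, of "k - 1"] by auto
    ultimately show False using zeros[of "k - 1"] by auto
  qed
  show "a k \<noteq> 0"
  proof
    assume "a k = 0"
    have "a n * (if n + 1 \<le> k then \<psi> (n + 1) else 0) + b n * (if n \<le> k then \<psi> n else 0) = 0" for n
      using Q[of n] \<open>a k = 0\<close> by (cases "n = k") (auto split: if_splits)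
    then show False using no_cut by blast
  qed
  show "b k \<noteq> 0"
  proof
    assume "b k = 0"
    have "a n * (if n + 1 \<le> k then \<psi> (n + 1) else 0) + b n * (if n \<le> k then \<psi> n else 0) = 0" for n
      using Q[of n] \<open>b k = 0\<close> by (cases "n = k") (auto split: if_splits)
    then show False using no_cut by blast
  qed
qed

text \<open>Compare the coefficients of E^j in \<open>L' \<circ> Q = Q \<circ> L\<close>. An
  extremal shift of \<open>L'\<close> beyond 1 or -1 would, multiplied by a nonzero coefficient of
  \<open>Q\<close>, give a term that the right-hand side does not have.\<close>

lemma first_order_intertwined_tridiagonal:
  assumes L: "nondegenerate_tridiagonal L" and L': "is_diff_op L'"
    and Q: "Q = (\<lambda>h n. a n * h (n + 1) + b n * h n)" "\<And>n. a n \<noteq> 0" "\<And>n. b n \<noteq> 0"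
    and comm: "L' \<circ> Q = Q \<circ> L"
  shows "nondegenerate_tridiagonal L'"
proof -
  obtain \<alpha> where \<alpha>: "L = diff_op {-1, 0, 1} \<alpha>" "\<And>n. \<alpha> 1 n \<noteq> 0" "\<And>n. \<alpha> (-1) n \<noteq> 0"
    using L by (auto simp: nondegenerate_tridiagonal_def)
  define c where "c = op_coeff L'"
  define A where "A j n = (if j \<in> {-1, 0, 1} then \<alpha> j n else 0)" for j n
  have Ldirac: "L (dirac m) n = A (m - n) n" for m n
    using op_coeff_diff_op[of "{-1,0,1}" \<alpha> "m - n" n] by (simp add: op_coeff_def \<alpha>(1) A_def)
  have eq: "a (n + j - 1) * c (j - 1) n + b (n + j) * c j n = a n * A (j - 1) (n + 1) + b n * A j n" for n j
  proof -
    have "Q (dirac (n + j)) = (\<lambda>k. a (n + j - 1) * dirac (n + j - 1) k) + (\<lambda>k. b (n + j) * dirac (n + j) k)"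
      by (auto simp: Q(1) dirac_def fun_eq_iff)
    then have "L' (Q (dirac (n + j))) n = a (n + j - 1) * c (j - 1) n + b (n + j) * c j n"
      by (simp add: diff_op_additive[OF L'] diff_op_scale[OF L'] c_def op_coeff_def add_diff_eq)
    moreover have "Q (L (dirac (n + j))) n = a n * A (j - 1) (n + 1) + b n * A j n"
      by (simp add: Q(1) Ldirac algebra_simps)
    ultimately show ?thesis using comm by (metis comp_apply)
  qed
  have up: "c j n = 0" if "j > 1" for j n
  proof (rule ccontr)
    assume "c j n \<noteq> 0"
    let ?S = "{j. j > 1 \<and> c j n \<noteq> 0}"
    have fin: "finite ?S" by (rule finite_subset[OF _ op_coeff_finite[OF L', of n]]) (auto simp: c_def)
    have ne: "?S \<noteq> {}" using that \<open>c j n \<noteq> 0\<close> by blast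
    define m where "m = Max ?S"
    have m: "m > 1" "c m n \<noteq> 0" using Max_in[OF fin ne] by (auto simp: m_def)
    have "c (m + 1) n = 0"
    proof (rule ccontr)
      assume "c (m + 1) n \<noteq> 0"
      then have "m + 1 \<le> m" using m Max_ge[OF fin, of "m + 1"] by (simp add: m_def)
      then show False by simp
    qed
    then show False using eq[of n "m + 1"] m Q(2) by (simp add: A_def)
  qed
  have down: "c j n = 0" if "j < -1" for j n
  proof (rule ccontr)
    assume "c j n \<noteq> 0"
    let ?S = "{j. j < -1 \<and> c j n \<noteq> 0}"
    have fin: "finite ?S" by (rule finite_subset[OF _ op_coeff_finite[OF L', of n]]) (auto simp: c_def)
    have ne: "?S \<noteq> {}" using that \<open>c j n \<noteq> 0\<close> by blast
    define m where "m = Min ?S"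
    have m: "m < -1" "c m n \<noteq> 0" using Min_in[OF fin ne] by (auto simp: m_def)
    have "c (m - 1) n = 0"
    proof (rule ccontr)
      assume "c (m - 1) n \<noteq> 0"
      then have "m \<le> m - 1" using m Min_le[OF fin, of "m - 1"] by (simp add: m_def)
      then show False by simp
    qed
    then show False using eq[of n m] m Q(3) by (simp add: A_def)
  qed
  have "L' = diff_op {-1, 0, 1} c"
    unfolding c_def
  proof (rule diff_op_eq_op_coeff[OF L'])
    fix j :: int and n assume "j \<notin> {-1, 0, 1}"
    then have "j > 1 \<or> j < -1" by auto
    then show "op_coeff L' j n = 0" using up down by (auto simp: c_def)
  qed simp
  moreover have "c 1 n \<noteq> 0" for n
    using eq[of n 2] up[of 2 n] \<alpha>(2) Q(2,3) by (auto simp: A_def)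
  moreover have "c (-1) n \<noteq> 0" for n
    using eq[of n "-1"] down[of "-2" n] \<alpha>(3) Q(2,3) by (auto simp: A_def)
  ultimately show ?thesis unfolding nondegenerate_tridiagonal_def by blast
qed

lemma is_diff_op_first_order: "is_diff_op (\<lambda>h n. a n * h (n + 1) + b n * h n)"
proof -
  have "is_diff_op ((\<lambda>h n. a n * h (n + 1)) + (\<lambda>h n. b n * h (n + 0)))"
    unfolding is_diff_op_eq
    by (rule seq_ops.is_opr_add) (use is_diff_op_shift[unfolded is_diff_op_eq] in blast)+
  then show ?thesis by (simp add: plus_fun_def)
qed

lemma first_order_comp_forward:
  assumes "Q = (\<lambda>h n. a n * h (n + 1) + b n * h n)"
  shows "Q \<circ> forward_op m t =
    forward_op (Suc m) (\<lambda>i n. (if i = 0 then 0 else a n * t (i - 1) (n + 1)) + (if i \<le> m then b n * t i n else 0))"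
proof (intro ext)
  fix h n
  have "(\<Sum>i\<le>Suc m. (if i = 0 then 0 else a n * t (i - 1) (n + 1)) * h (n + int i)) =
      a n * (\<Sum>i\<le>m. t i (n + 1) * h (n + 1 + int i))"
    by (subst sum.atMost_Suc_shift) (simp add: sum_distrib_left algebra_simps)
  moreover have "(\<Sum>i\<le>Suc m. (if i \<le> m then b n * t i n else 0) * h (n + int i)) =
      b n * (\<Sum>i\<le>m. t i n * h (n + int i))"
    by (simp add: sum_distrib_left mult_ac)
  ultimately show "(Q \<circ> forward_op m t) h n = forward_op (Suc m)
      (\<lambda>i n. (if i = 0 then 0 else a n * t (i - 1) (n + 1)) + (if i \<le> m then b n * t i n else 0)) h n"
    by (simp only: comp_apply assms forward_op_def distrib_right sum.distrib)
qed

lemma nondegenerate_tridiagonal_free: "nondegenerate_tridiagonal free_op"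
  unfolding nondegenerate_tridiagonal_def
  by (intro exI[of _ "\<lambda>j n. if j = 0 then 0 else 1"]) (auto simp: free_op_def diff_op_def fun_eq_iff)

text \<open>The invariants support each other: nondegeneracy of \<open>L\<close> excludes two
  consecutive zeros of \<open>\<psi>\<close>, hence the coefficients of \<open>Q\<close> vanish
  nowhere, hence the leading coefficient of \<open>Q \<circ> T\<close> does not vanish and the new
  operator is nondegenerate again.\<close>

lemma darboux_invariants:
  assumes "darboux bs L T"
  shows "L \<circ> T = T \<circ> free_op" "nondegenerate_tridiagonal L"
    "\<exists>t. T = forward_op (length bs) t \<and> (\<forall>n. t (length bs) n \<noteq> 0)"
    "\<And>x \<phi>. (x, \<phi>) \<in> set bs \<Longrightarrow> T \<phi> = 0"
proof -
  have "L \<circ> T = T \<circ> free_op \<and> nondegenerate_tridiagonal L \<and>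
    (\<exists>t. T = forward_op (length bs) t \<and> (\<forall>n. t (length bs) n \<noteq> 0)) \<and>
    (\<forall>x \<phi>. (x, \<phi>) \<in> set bs \<longrightarrow> T \<phi> = 0)"
    using assms
  proof induction
    case start
    have "id = forward_op (length ([] :: (complex \<times> seq) list)) (\<lambda>_ _. 1)"
      by (auto simp: forward_op_def fun_eq_iff)
    then have "\<exists>t. id = forward_op (length ([] :: (complex \<times> seq) list)) t \<and> (\<forall>n. t (length ([] :: (complex \<times> seq) list)) n \<noteq> 0)"
      by (intro exI[of _ "\<lambda>_ _. 1"] conjI) auto
    moreover have "free_op \<circ> id = id \<circ> free_op" by simp
    moreover have "\<forall>x \<phi>. (x, \<phi>) \<in> set [] \<longrightarrow> id \<phi> = 0" by simp
    ultimately show ?case using nondegenerate_tridiagonal_free by (intro conjI)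
  next
    case (step bs L T \<phi> \<psi> x Q P)
    obtain a b where Q: "Q = (\<lambda>h n. a n * h (n + 1) + b n * h n)"
      using step.hyps by (auto simp: first_order_def)
    obtain t where t: "T = forward_op (length bs) t" "\<And>n. t (length bs) n \<noteq> 0" using step.IH by blast
    have zeros: "\<psi> (k + 1) \<noteq> 0" if "\<psi> k = 0" for k
    proof
      assume "\<psi> (k + 1) = 0"
      then have "\<psi> n = 0" for n
        using tridiagonal_eigenfunction_zeros[of L \<psi> x k n] that step.IH step.hyps by blast
      then show False using \<open>\<psi> \<noteq> 0\<close> by (auto simp: fun_eq_iff)
    qed
    have "{h. (\<lambda>n. a n * h (n + 1) + b n * h n) = (0::seq)} = seq_span [\<psi>]"
      using step.hyps unfolding Q by blast
    note ab = first_order_coeffs_nonzero[OF this zeros]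
    define L' where "L' = scalar_op x + (Q \<circ> P)"
    have Qd: "is_diff_op Q" unfolding Q by (rule is_diff_op_first_order)
    then have L'd: "is_diff_op L'"
      using is_diff_op_scalar[of x] \<open>is_diff_op P\<close>
      unfolding L'_def is_diff_op_eq by (intro diff_op_closed)
    have LPQ: "L h n = x * h n + P (Q h) n" for h n
      using \<open>L = scalar_op x + (P \<circ> Q)\<close> by (simp add: scalar_op_def)
    have Q_lin: "Q (\<lambda>n. x * h n + k n) = (\<lambda>n. x * Q h n + Q k n)" for h k
      by (auto simp: Q algebra_simps fun_eq_iff)
    have L'Q: "L' \<circ> Q = Q \<circ> L"
    proof (rule ext)
      fix h
      have Lh: "L h = (\<lambda>n. x * h n + P (Q h) n)" using LPQ by blast
      show "(L' \<circ> Q) h = (Q \<circ> L) h"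
        by (simp add: Lh Q_lin) (simp add: L'_def scalar_op_def fun_eq_iff)
    qed
    have "L' \<circ> (Q \<circ> T) = (Q \<circ> T) \<circ> free_op"
      using L'Q step.IH by (metis comp_assoc)
    moreover have "nondegenerate_tridiagonal L'"
      using first_order_intertwined_tridiagonal[OF _ L'd Q ab L'Q] step.IH by blast
    moreover have "\<exists>t. Q \<circ> T = forward_op (length (bs @ [(x, \<phi>)])) t \<and> (\<forall>n. t (length (bs @ [(x, \<phi>)])) n \<noteq> 0)"
      unfolding t first_order_comp_forward[OF Q] by (intro exI conjI) (auto simp: t(2) ab)
    moreover have "(Q \<circ> T) f = 0" if "(y, f) \<in> set (bs @ [(x, \<phi>)])" for y f
    proof (cases "(y, f) \<in> set bs")
      case True
      then have "T f = 0" using step.IH by blast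
      then show ?thesis by (auto simp: Q fun_eq_iff)
    next
      case False
      then have "f = \<phi>" using that by auto
      moreover have "Q \<psi> = 0"
      proof -
        have "\<psi> = (\<lambda>n. 1 * \<psi> n)" by simp
        then have "\<psi> \<in> seq_span [\<psi>]" unfolding seq_span_singleton by blast
        then show ?thesis using step.hyps by blast
      qed
      ultimately show ?thesis using step.hyps by simp
    qed
    ultimately show ?case unfolding L'_def by blast
  qed
  then show "L \<circ> T = T \<circ> free_op" "nondegenerate_tridiagonal L"
    "\<exists>t. T = forward_op (length bs) t \<and> (\<forall>n. t (length bs) n \<noteq> 0)"
    "\<And>x \<phi>. (x, \<phi>) \<in> set bs \<Longrightarrow> T \<phi> = 0" by blast+
qed

lemma first_order_kernel:
  assumes "\<And>n. \<psi> n \<noteq> 0"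
  shows "{h. (\<lambda>n. h (n + 1) - \<psi> (n + 1) / \<psi> n * h n) = (0::seq)} = seq_span [\<psi>]"
proof -
  have "\<exists>c. h = (\<lambda>n. c * \<psi> n)" if h: "\<And>n. h (n + 1) - \<psi> (n + 1) / \<psi> n * h n = 0" for h :: seq
  proof -
    have "h n = h 0 / \<psi> 0 * \<psi> n" for n
    proof (induction n rule: int_induct[of _ 0])
      case (step1 i)
      have "h (i + 1) = \<psi> (i + 1) / \<psi> i * h i" using h[of i] by (simp only: right_minus_eq)
      also have "\<dots> = \<psi> (i + 1) / \<psi> i * (h 0 / \<psi> 0 * \<psi> i)" by (simp only: step1(2)[symmetric])
      finally show ?case using assms[of i] by (simp add: mult_ac)
    next
      case (step2 i)
      have "\<psi> i * h (i - 1) = \<psi> (i - 1) * h i"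
        using h[of "i - 1"] assms[of "i - 1"] by (simp add: field_simps)
      then have "\<psi> i * h (i - 1) = \<psi> i * (h 0 / \<psi> 0 * \<psi> (i - 1))"
        unfolding step2 by (simp add: mult_ac)
      then show ?case by (rule iffD1[OF mult_left_cancel[OF assms[of i]]])
    qed (use assms in auto)
    then show ?thesis by blast
  qed
  then show ?thesis unfolding seq_span_singleton using assms by (auto simp: fun_eq_iff)
qed

text \<open>A nonzero Casoratian of each initial segment makes \<open>T \<phi>\<close> nowhere zero,
  so that E - r(n) with r(n) = \<psi>(n+1) / \<psi>(n) exists at every step. Its leading coefficient
  1 keeps the product monic.\<close>

lemma darboux_exists:
  assumes eig: "\<And>x \<phi>. (x, \<phi>) \<in> set bs \<Longrightarrow> free_op \<phi> = scalar_op x \<phi>"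
    and cas: "\<And>m n. m \<le> length bs \<Longrightarrow> casorati (map snd (take m bs)) n \<noteq> 0"
  shows "\<exists>L t. darboux bs L (forward_op (length bs) t) \<and> (\<forall>n. t (length bs) n = 1)"
  using assms
proof (induction bs rule: rev_induct)
  case Nil
  have "id = forward_op 0 (\<lambda>_ _. 1)" by (auto simp: forward_op_def fun_eq_iff)
  then have "darboux [] free_op (forward_op 0 (\<lambda>_ _. 1))" using darboux.start by simp
  then show ?case by (intro exI conjI) auto
next
  case (snoc y bs)
  obtain x \<phi> where y: "y = (x, \<phi>)" by (cases y)
  have "\<exists>L t. darboux bs L (forward_op (length bs) t) \<and> (\<forall>n. t (length bs) n = 1)"
  proof (rule snoc.IH)
    show "casorati (map snd (take m bs)) n \<noteq> 0" if "m \<le> length bs" for m n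
      using snoc.prems(2)[of m n] that by simp
  qed (use snoc.prems in auto)
  then obtain L t where D: "darboux bs L (forward_op (length bs) t)" and t: "\<And>n. t (length bs) n = 1" by blast
  define T where "T = forward_op (length bs) t"
  note inv = darboux_invariants[OF D, folded T_def]
  define \<psi> where "\<psi> = T \<phi>"
  have \<psi>: "\<psi> n \<noteq> 0" for n
  proof -
    have "casorati (map snd bs @ [\<phi>]) n \<noteq> 0" using snoc.prems(2)[of "Suc (length bs)" n] by (simp add: y)
    moreover have "forward_op (length (map snd bs)) t f n = 0" if "f \<in> set (map snd bs)" for f
      using that inv(4) by (auto simp: T_def)
    ultimately show ?thesis
      using forward_op_nonzero[of "map snd bs" \<phi> n t] t by (simp add: \<psi>_def T_def)
  qed
  obtain \<alpha> where \<alpha>: "L = diff_op {-1, 0, 1} \<alpha>"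
    using inv(2) by (auto simp: nondegenerate_tridiagonal_def)
  have L\<psi>: "L \<psi> = scalar_op x \<psi>"
  proof -
    have "L \<psi> = T (free_op \<phi>)" using inv(1) by (metis \<psi>_def comp_apply)
    also have "free_op \<phi> = (\<lambda>n. x * \<phi> n)" using snoc.prems(1)[of x \<phi>] by (simp add: y scalar_op_def)
    also have "T \<dots> = scalar_op x \<psi>"
      using diff_op_scale[OF is_diff_op_forward[of "length bs" t]] by (auto simp: scalar_op_def \<psi>_def T_def fun_eq_iff)
    finally show ?thesis .
  qed
  have L\<psi>': "\<alpha> (-1) n * \<psi> (n - 1) + \<alpha> 0 n * \<psi> n + \<alpha> 1 n * \<psi> (n + 1) = x * \<psi> n" for n
    using fun_cong[OF L\<psi>, of n] by (simp add: \<alpha>(1) diff_op_def scalar_op_def add.assoc)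
  define r where "r n = \<psi> (n + 1) / \<psi> n" for n
  define Q where "Q = (\<lambda>(h::seq) n. 1 * h (n + 1) + (- r n) * h n)"
  \<comment> \<open>The outer coefficients of L - x = P Q dictate \<open>P\<close>; the middle one
    then agrees because \<open>\<psi>\<close> is an eigenfunction with eigenvalue
    \<open>x\<close>.\<close>
  define P where "P = (\<lambda>(h::seq) n. \<alpha> 1 n * h n + (- \<alpha> (-1) n / r (n - 1)) * h (n - 1))"
  have r0: "r n \<noteq> 0" for n using \<psi> by (simp add: r_def)
  have "\<alpha> 0 n = x - \<alpha> (-1) n / r (n - 1) - \<alpha> 1 n * r n" for n
  proof -
    have "\<psi> n * \<alpha> 0 n = \<psi> n * (x - \<alpha> (-1) n / r (n - 1) - \<alpha> 1 n * r n)"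
      using L\<psi>'[of n] \<psi>[of n] \<psi>[of "n - 1"] by (simp add: r_def right_diff_distrib mult_ac eq_diff_eq add_ac)
    then show ?thesis using \<psi>[of n] by simp
  qed
  then have LPQ: "L = scalar_op x + (P \<circ> Q)"
  proof (intro ext)
    fix h n
    assume "\<And>n. \<alpha> 0 n = x - \<alpha> (-1) n / r (n - 1) - \<alpha> 1 n * r n"
    note \<alpha>0 = this[of n]
    show "L h n = (scalar_op x + (P \<circ> Q)) h n"
      using r0[of "n - 1"]
      by (simp add: \<alpha> \<alpha>0 diff_op_def scalar_op_def P_def Q_def left_diff_distrib right_diff_distrib
          diff_divide_distrib mult_ac)
  qed
  have "{h. Q h = 0} = seq_span [\<psi>]" using first_order_kernel[of \<psi>] \<psi> by (simp add: Q_def r_def)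
  moreover have "is_diff_op P"
  proof -
    have "is_diff_op ((\<lambda>h n. \<alpha> 1 n * h (n + 0)) + (\<lambda>h n. (- \<alpha> (-1) n / r (n - 1)) * h (n + (-1))))"
      using is_diff_op_shift[of "\<alpha> 1" 0] is_diff_op_shift[of "\<lambda>n. - \<alpha> (-1) n / r (n - 1)" "-1"]
      unfolding is_diff_op_eq by (rule seq_ops.is_opr_add)
    then show ?thesis by (simp add: plus_fun_def P_def)
  qed
  moreover have "\<psi> \<noteq> 0" using \<psi>[of 0] by (auto simp: fun_eq_iff)
  moreover have "first_order Q" unfolding first_order_def Q_def by (intro exI) (rule refl)
  ultimately have "darboux (bs @ [(x, \<phi>)]) (scalar_op x + (Q \<circ> P)) (Q \<circ> T)"
    using darboux.step[of bs L T \<phi> \<psi> x Q P] D L\<psi> LPQ unfolding T_def[symmetric] \<psi>_def by blast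
  then show ?case unfolding y T_def first_order_comp_forward[OF Q_def] by (intro exI conjI) (auto simp: t)
qed

section \<open>The reduced wave function\<close>

text \<open>The functions z^n P(n) have degree n + g and leading coefficient 1. If m is the largest
  shift with \<open>a m n\<close> nonzero, nothing cancels \<open>a m n\<close> as the leading
  coefficient of the image at n. Polynomials have finitely many roots, so finitely many z may be
  ignored.\<close>

lemma diff_op_faithful:
  assumes L: "is_diff_op L" and F: "finite F" "0 \<in> F"
    and P: "\<And>n. degree (P n) \<le> g" "\<And>n. coeff (P n) g = 1"
    and zero: "\<And>n z. z \<notin> F \<Longrightarrow> L (\<lambda>m. z powi m * poly (P m) z) n = 0"
  shows "L = 0"
proof -
  obtain S a where S: "finite S" "L = diff_op S a" using L by (auto simp: is_diff_op_def)
  have "a j n = 0" if "j \<in> S" for j n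
  proof (rule ccontr)
    assume "a j n \<noteq> 0"
    let ?S = "{j \<in> S. a j n \<noteq> 0}"
    have fin: "finite ?S" "?S \<noteq> {}" using S that \<open>a j n \<noteq> 0\<close> by auto
    define m where "m = Max ?S"
    have m: "m \<in> S" "a m n \<noteq> 0" using Max_in[OF fin] by (auto simp: m_def)
    have max: "i \<le> m" if "i \<in> S" "a i n \<noteq> 0" for i
      using that Max_ge[OF fin(1), of i] by (simp add: m_def)
    \<comment> \<open>The lowest exponent that can occur; dividing by z^N leaves a
      polynomial.\<close>
    define N where "N = Min S + n"
    have N: "n + i - N \<ge> 0" if "i \<in> S" for i using Min_le[OF S(1) that] by (simp add: N_def)
    define p where "p = (\<Sum>i\<in>S. Polynomial.smult (a i n) (monom 1 (nat (n + i - N)) * P (n + i)))"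
    have "poly p z = 0" if "z \<notin> F" for z
    proof -
      have "z \<noteq> 0" using that F by auto
      have "poly p z = (\<Sum>i\<in>S. a i n * (z ^ nat (n + i - N) * poly (P (n + i)) z))"
        by (simp add: p_def poly_sum poly_monom)
      also have "\<dots> = z powi (- N) * (\<Sum>i\<in>S. a i n * (z powi (n + i) * poly (P (n + i)) z))"
        unfolding sum_distrib_left
      proof (rule sum.cong)
        fix i assume "i \<in> S"
        have "z ^ nat (n + i - N) = z powi (n + i - N)" using N[OF \<open>i \<in> S\<close>] by (simp add: power_int_def)
        also have "\<dots> = z powi (- N) * z powi (n + i)"
          using \<open>z \<noteq> 0\<close> by (simp add: power_int_add[symmetric])
        finally show "a i n * (z ^ nat (n + i - N) * poly (P (n + i)) z) =
          z powi (- N) * (a i n * (z powi (n + i) * poly (P (n + i)) z))" by simp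
      qed simp
      also have "\<dots> = 0" using zero[OF that, of n] by (simp add: S diff_op_def)
      finally show ?thesis .
    qed
    then have "UNIV - F \<subseteq> {z. poly p z = 0}" by auto
    then have "infinite {z. poly p z = 0}" using F infinite_UNIV_char_0 by (metis Diff_infinite_finite finite_subset)
    then have "p = 0" using poly_roots_finite by blast
    have "coeff p (nat (n + m - N) + g) =
        (\<Sum>i\<in>S. a i n * coeff (monom 1 (nat (n + i - N)) * P (n + i)) (nat (n + m - N) + g))"
      by (simp add: p_def coeff_sum)
    also have "\<dots> = (\<Sum>i\<in>S. if i = m then a m n else 0)"
    proof (rule sum.cong)
      fix i assume i: "i \<in> S"
      show "a i n * coeff (monom 1 (nat (n + i - N)) * P (n + i)) (nat (n + m - N) + g) = (if i = m then a m n else 0)"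
      proof (cases "a i n = 0 \<or> i = m")
        case True
        then show ?thesis using P by (auto simp: coeff_monom_mult)
      next
        case False
        then have "i < m" using max[OF i] by auto
        then have "nat (n + i - N) < nat (n + m - N)" using N[OF i] by auto
        then have "coeff (monom 1 (nat (n + i - N)) * P (n + i)) (nat (n + m - N) + g) = 0"
          using P(1)[of "n + i"] by (auto simp: coeff_monom_mult intro!: coeff_eq_0)
        then show ?thesis using False by simp
      qed
    qed simp
    also have "\<dots> = a m n" using S m by simp
    finally show False using \<open>p = 0\<close> m by simp
  qed
  then show ?thesis unfolding S(2) by (auto simp: diff_op_def fun_eq_iff)
qed

text \<open>The 2g points \<open>l j\<close> and \<open>inverse (l j)\<close> are pairwise distinct;
  \<open>l_mult\<close> with i = j separates the two points of a pair. Each pair is going to be one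
  node of the curve.\<close>

locale bound_states =
  fixes g :: nat and l d :: "nat \<Rightarrow> complex"
  assumes l_nonzero: "i < g \<Longrightarrow> l i \<noteq> 0"
    and l_distinct: "i < g \<Longrightarrow> j < g \<Longrightarrow> i \<noteq> j \<Longrightarrow> l i \<noteq> l j"
    and l_mult: "i < g \<Longrightarrow> j < g \<Longrightarrow> l i * l j \<noteq> 1"
    and d_nonzero: "i < g \<Longrightarrow> d i \<noteq> 0"
    and casorati_nonzero: "casorati (map (\<lambda>j. bound_state (l j) (d j)) [0..<g]) n \<noteq> 0"
begin

abbreviation \<phi> :: "nat \<Rightarrow> seq" where
  "\<phi> j \<equiv> bound_state (l j) (d j)"

abbreviation states :: "seq list" where
  "states \<equiv> map \<phi> [0..<g]"

text \<open>Cramer's rule for the monic operator of order g that kills the bound states: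
  \<open>c i\<close> is its coefficient of E^i. The 0 in the last column is a filler that these
  cofactors do not see.\<close>

definition c :: "nat \<Rightarrow> seq" where
  "c i n = cofactor (mat (g + 1) (g + 1) (\<lambda>(i, j). if j < g then \<phi> j (n + int i) else 0)) i g
     / casorati states n"

definition P :: "int \<Rightarrow> complex poly" where
  "P n = (\<Sum>i\<le>g. monom (c i n) i)"

definition W :: "int \<Rightarrow> complex \<Rightarrow> complex" where
  "W n z = z powi n * poly (P n) z"

lemma mat_delete_last_column:
  assumes "i \<le> g"
  shows "mat_delete (mat (g + 1) (g + 1) (\<lambda>(i, j). if j < g then f i j else r i)) i g =
    mat g g (\<lambda>(i', j). f (if i' < i then i' else Suc i') j)"
  using assms by (intro eq_matI) (auto simp: mat_delete_def)

lemma casorati_states: "casorati states n = det (mat g g (\<lambda>(i, j). \<phi> j (n + int i)))"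
proof -
  have "mat g g (\<lambda>(i, j). (states ! j) (n + int i)) = mat g g (\<lambda>(i, j). \<phi> j (n + int i))"
    by (intro eq_matI) auto
  then show ?thesis by (simp add: casorati_def)
qed

lemma det_last_column:
  assumes "comm_ring_hom emb"
  shows "det (mat (g + 1) (g + 1) (\<lambda>(i, j). if j < g then emb (\<phi> j (n + int i)) else r i)) =
    emb (casorati states n) * (\<Sum>i\<le>g. emb (c i n) * r i)" (is "det ?A = _")
proof -
  interpret comm_ring_hom emb by fact
  have A: "?A \<in> carrier_mat (g + 1) (g + 1)" by simp
  let ?B = "mat (g + 1) (g + 1) (\<lambda>(i, j). if j < g then \<phi> j (n + int i) else 0)"
  have "cofactor ?A i g = emb (casorati states n) * emb (c i n)" if "i \<le> g" for i
  proof -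
    have "mat_delete ?A i g = map_mat emb (mat_delete ?B i g)"
      unfolding mat_delete_last_column[OF that] by (intro eq_matI) auto
    then have "cofactor ?A i g = emb (cofactor ?B i g)"
      by (simp add: cofactor_def hom_distribs)
    also have "cofactor ?B i g = casorati states n * c i n"
      using casorati_nonzero[of n] by (simp add: c_def)
    finally show ?thesis by (simp add: hom_distribs)
  qed
  then have "(\<Sum>i<g + 1. ?A $$ (i, g) * cofactor ?A i g) =
      (\<Sum>i<g + 1. r i * (emb (casorati states n) * emb (c i n)))"
    by (intro sum.cong) auto
  then show ?thesis
    using laplace_expansion_column[OF A, of g]
    by (simp add: sum_distrib_left mult_ac lessThan_Suc_atMost)
qed

lemma coeff_P: "coeff (P n) i = (if i \<le> g then c i n else 0)"
  by (simp add: P_def coeff_sum if_distrib cong: if_cong)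

lemma degree_P: "degree (P n) \<le> g"
  by (rule degree_le) (simp add: coeff_P)

lemma c_top: "c g n = 1"
proof -
  have "mat_delete (mat (g + 1) (g + 1) (\<lambda>(i, j). if j < g then \<phi> j (n + int i) else 0)) g g =
      mat g g (\<lambda>(i, j). \<phi> j (n + int i))"
    unfolding mat_delete_last_column[OF order_refl] by (intro eq_matI) auto
  then show ?thesis
    using casorati_nonzero[of n] by (simp add: c_def cofactor_def casorati_states)
qed

lemma c_annihilates:
  assumes "j < g" shows "(\<Sum>i\<le>g. c i n * \<phi> j (n + int i)) = 0"
proof -
  \<comment> \<open>With the state j itself in the last column, two columns coincide.\<close>
  let ?A = "mat (g + 1) (g + 1) (\<lambda>(i, k). if k < g then id (\<phi> k (n + int i)) else \<phi> j (n + int i))"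
  have "det ?A = 0"
    by (rule det_identical_columns[of _ "g + 1" j g]) (use assms in \<open>auto intro!: eq_vecI\<close>)
  moreover have "comm_ring_hom (id :: complex \<Rightarrow> complex)" by unfold_locales auto
  ultimately show ?thesis
    using det_last_column[of id n "\<lambda>i. \<phi> j (n + int i)"] casorati_nonzero[of n] by simp
qed

lemma wave_eq:
  assumes "comm_ring_hom emb" "emb (casorati states n) \<noteq> 0" "z \<noteq> 0"
  shows "wave emb g l d n z = z powi n * (\<Sum>i\<le>g. emb (c i n) * z ^ i) / (\<Prod>j<g. z - emb (l j))"
proof -
  have "(\<Sum>i\<le>g. emb (c i n) * z powi (n + int i)) = z powi n * (\<Sum>i\<le>g. emb (c i n) * z ^ i)"
    using assms(3) by (simp add: power_int_add sum_distrib_left mult_ac)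
  then show ?thesis
    unfolding wave_def det_last_column[OF assms(1)] using assms(2) by simp
qed

lemma poly_P: "poly (P n) z = (\<Sum>i\<le>g. c i n * z ^ i)"
  by (simp add: P_def poly_sum poly_monom)

lemma wave_id: "z \<noteq> 0 \<Longrightarrow> wave id g l d n z = W n z / (\<Prod>j<g. z - l j)"
proof -
  have "comm_ring_hom (id :: complex \<Rightarrow> complex)" by unfold_locales auto
  then show "z \<noteq> 0 \<Longrightarrow> ?thesis"
    using wave_eq[of id n z] casorati_nonzero[of n] by (simp add: W_def poly_P)
qed

section \<open>Laurent polynomials satisfying the gluing conditions\<close>

definition gluing :: "int \<Rightarrow> complex poly \<Rightarrow> bool" where
  "gluing n G \<longleftrightarrow> (\<forall>j<g. l j powi n * poly G (l j) = d j * inverse (l j) powi n * poly G (inverse (l j)))"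

text \<open>The j-th gluing condition on z^n G(z) says that G, with z read as the shift E, kills the
  j-th bound state at n. Membership in V thus becomes a statement about difference
  operators.\<close>

lemma poly_bound_state:
  assumes "j < g" "degree G \<le> N"
  shows "(\<Sum>i\<le>N. coeff G i * \<phi> j (n + int i)) =
    l j powi n * poly G (l j) - d j * inverse (l j) powi n * poly G (inverse (l j))"
proof -
  have "poly G z = (\<Sum>i\<le>N. coeff G i * z ^ i)" for z
    unfolding poly_altdef using assms(2) by (intro sum.mono_neutral_left) (auto simp: coeff_eq_0)
  then show ?thesis
    using l_nonzero[OF assms(1)]
    by (simp add: bound_state_def power_int_add sum_subtractf[symmetric] sum_distrib_left algebra_simps)
qed

lemma gluing_P: "gluing n (P n)"
  unfolding gluing_def
proof (intro allI impI)
  fix j assume "j < g"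
  then show "l j powi n * poly (P n) (l j) = d j * inverse (l j) powi n * poly (P n) (inverse (l j))"
    using poly_bound_state[OF \<open>j < g\<close> degree_P, of n n] c_annihilates[of j n] by (simp add: coeff_P)
qed

lemma gluing_unique:
  assumes "gluing n G" "degree G \<le> g"
  shows "G = Polynomial.smult (coeff G g) (P n)"
proof (rule poly_eqI)
  fix i
  show "coeff G i = coeff (Polynomial.smult (coeff G g) (P n)) i"
  proof (cases "i \<le> g")
    case True
    have "forward_op g (\<lambda>i n. coeff G i) f n = 0" if "f \<in> set states" for f
    proof -
      from that obtain j where "j < g" "f = \<phi> j" by auto
      then show ?thesis
        using poly_bound_state[of j G g n] assms by (simp add: forward_op_def gluing_def)
    qed
    moreover have "forward_op g c f n = 0" if "f \<in> set states" for f
      using that c_annihilates by (auto simp: forward_op_def)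
    ultimately show ?thesis
      using forward_op_unique[of states n g "\<lambda>i n. coeff G i" c i] casorati_nonzero True
      by (simp add: coeff_P c_top)
  qed (use assms in \<open>auto simp: coeff_P coeff_eq_0\<close>)
qed

lemma gluing_shift: "gluing (n + int k) G \<Longrightarrow> gluing n (monom 1 k * G)"
  using l_nonzero by (auto simp: gluing_def poly_monom power_int_add mult_ac)

lemma gluing_diff_smult: "gluing n G \<Longrightarrow> gluing n H \<Longrightarrow> gluing n (G - Polynomial.smult a H)"
  by (simp add: gluing_def right_diff_distrib)

text \<open>Induction on the excess degree, subtracting the multiple of the basis element that
  cancels the top coefficient. The value of \<open>a N\<close> is recorded since it becomes the
  leading coefficient of an operator with prescribed symbol.\<close>

lemma gluing_expansion:
  assumes "gluing n G" "degree G \<le> g + N"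
  shows "\<exists>a. a N = coeff G (g + N) \<and> G = (\<Sum>i\<le>N. Polynomial.smult (a i) (monom 1 i * P (n + int i)))"
  using assms
proof (induction N arbitrary: G)
  case 0
  then show ?case using gluing_unique[of n G] by (intro exI[of _ "\<lambda>_. coeff G g"]) simp
next
  case (Suc N)
  define b where "b = coeff G (g + Suc N)"
  let ?M = "monom 1 (Suc N) * P (n + int (Suc N))"
  define H where "H = G - Polynomial.smult b ?M"
  have "gluing n H"
    unfolding H_def by (intro gluing_diff_smult gluing_shift gluing_P Suc.prems)
  moreover have "degree H \<le> g + N"
  proof (rule degree_le, intro allI impI)
    fix i assume i: "i > g + N"
    show "coeff H i = 0"
    proof (cases "i = g + Suc N")
      case True
      then show ?thesis by (simp add: H_def b_def coeff_monom_mult coeff_P c_top)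
    next
      case False
      then have "coeff G i = 0" using i Suc.prems(2) by (intro coeff_eq_0) auto
      then show ?thesis using i False by (simp add: H_def coeff_monom_mult coeff_P)
    qed
  qed
  ultimately obtain a where a: "H = (\<Sum>i\<le>N. Polynomial.smult (a i) (monom 1 i * P (n + int i)))"
    using Suc.IH by blast
  let ?a = "a(Suc N := b)"
  have "(\<Sum>i\<le>N. Polynomial.smult (?a i) (monom 1 i * P (n + int i))) = H"
    unfolding a by (intro sum.cong) auto
  then have "G = (\<Sum>i\<le>Suc N. Polynomial.smult (?a i) (monom 1 i * P (n + int i)))"
    by (simp add: H_def)
  then show ?case by (intro exI[of _ ?a]) (simp add: b_def)
qed

lemma W_expansion:
  assumes "gluing n G" "degree G \<le> g + N"
  shows "\<exists>a. a N = coeff G (g + N) \<and>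
    (\<forall>z. z \<noteq> 0 \<longrightarrow> z powi n * poly G z = (\<Sum>i\<le>N. a i * W (n + int i) z))"
proof -
  obtain a where a: "a N = coeff G (g + N)" "G = (\<Sum>i\<le>N. Polynomial.smult (a i) (monom 1 i * P (n + int i)))"
    using gluing_expansion[OF assms] by blast
  have "z powi n * poly G z = (\<Sum>i\<le>N. a i * W (n + int i) z)" if "z \<noteq> 0" for z
    by (subst a(2)) (simp add: poly_sum poly_monom W_def sum_distrib_left power_int_add that mult_ac)
  then show ?thesis using a(1) by blast
qed

section \<open>The monic intertwiner and its kernel\<close>

definition T :: "seq \<Rightarrow> seq" where
  "T = forward_op g c"

lemma is_diff_op_T: "is_diff_op T"
  unfolding T_def by (rule is_diff_op_forward)

lemma T_exp: "z \<noteq> 0 \<Longrightarrow> T (\<lambda>n. z powi n) n = W n z"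
  by (simp add: T_def forward_op_def W_def poly_P power_int_add sum_distrib_left mult_ac)

text \<open>If \<open>c 0 n\<close> vanished, the other coefficients would form a left null vector
  of the Casorati matrix at n + 1, against \<open>c g n = 1\<close>. So the recursion
  \<open>T h = 0\<close> can also be run towards smaller n.\<close>

lemma c_0_nonzero: "c 0 n \<noteq> 0"
proof
  assume c0: "c 0 n = 0"
  show False
  proof (cases g)
    case 0
    then show False using c0 c_top[of n] by simp
  next
    case (Suc g')
    have "c (Suc g') n = 0"
    proof (rule det_nonzero_left_kernel[of g "\<lambda>i j. \<phi> j (n + 1 + int i)" "\<lambda>i. c (Suc i) n"])
      show "det (mat g g (\<lambda>(i, j). \<phi> j (n + 1 + int i))) \<noteq> 0"
        using casorati_nonzero[of "n + 1"] by (simp add: casorati_states)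
      fix j assume "j < g"
      have "0 = (\<Sum>i<Suc g. c i n * \<phi> j (n + int i))"
        using c_annihilates[OF \<open>j < g\<close>] by (simp add: lessThan_Suc_atMost)
      also have "\<dots> = (\<Sum>i<g. c (Suc i) n * \<phi> j (n + 1 + int i))"
        by (subst sum.lessThan_Suc_shift) (simp add: c0 add_ac)
      finally show "(\<Sum>i<g. c (Suc i) n * \<phi> j (n + 1 + int i)) = 0" by simp
    qed (use Suc in auto)
    then show False using Suc c_top[of n] by simp
  qed
qed

lemma T_kernel_zero:
  assumes h: "T h = 0" and init: "\<And>i. i < g \<Longrightarrow> h (int i) = 0"
  shows "h = 0"
proof -
  have eq: "(\<Sum>i\<le>g. c i n * h (n + int i)) = 0" for n
    using fun_cong[OF h, of n] by (simp add: T_def forward_op_def)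
  have "\<forall>i<g. h (n + int i) = 0" for n
  proof (induction n rule: int_induct[of _ 0])
    case (step1 n)
    have "(\<Sum>i<g. c i n * h (n + int i)) = 0" using step1(2) by (intro sum.neutral) auto
    then have top: "h (n + int g) = 0" using eq[of n] by (simp add: lessThan_Suc_atMost[symmetric] c_top)
    show ?case
    proof (intro allI impI)
      fix i assume "i < g"
      show "h (n + 1 + int i) = 0"
        using step1(2)[rule_format, of "Suc i"] top \<open>i < g\<close> by (cases "Suc i = g") (auto simp: add_ac)
    qed
  next
    case (step2 n)
    have "0 = (\<Sum>i<Suc g. c i (n - 1) * h (n - 1 + int i))" using eq[of "n - 1"] by (simp add: lessThan_Suc_atMost)
    also have "\<dots> = c 0 (n - 1) * h (n - 1) + (\<Sum>i<g. c (Suc i) (n - 1) * h (n + int i))"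
      by (subst sum.lessThan_Suc_shift) simp
    also have "(\<Sum>i<g. c (Suc i) (n - 1) * h (n + int i)) = 0" using step2(2) by (intro sum.neutral) auto
    finally have bot: "h (n - 1) = 0" using c_0_nonzero[of "n - 1"] by simp
    show ?case
    proof (intro allI impI)
      fix i assume "i < g"
      then show "h (n - 1 + int i) = 0"
        using step2(2)[rule_format, of "i - 1"] bot by (cases i) (auto simp: add_ac)
    qed
  qed (use init in auto)
  note all = this
  show ?thesis
  proof (cases "g = 0")
    case True
    then show ?thesis using eq c_top by (auto simp: fun_eq_iff)
  next
    case False
    then show ?thesis using all by (force simp: fun_eq_iff)
  qed
qed

lemma T_sum_states: "T (\<lambda>n. \<Sum>j<g. a j * \<phi> j n) = 0"
proof (rule ext)
  fix n
  have "T (\<phi> j) n = 0" if "j < g" for j using c_annihilates[OF that] by (simp add: T_def forward_op_def)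
  then show "T (\<lambda>n. \<Sum>j<g. a j * \<phi> j n) n = 0 n"
    using diff_op_sum[OF is_diff_op_T, where A = "{..<g}" and c = a and h = \<phi> and n = n] by simp
qed

lemma seq_span_states: "seq_span states = {h. \<exists>a. h = (\<lambda>n. \<Sum>j<g. a j * \<phi> j n)}"
  by (simp add: seq_span_def)

lemma T_kernel: "{h. T h = 0} = seq_span states"
proof (intro subset_antisym subsetI)
  fix h assume "h \<in> {h. T h = 0}"
  then have h: "T h = 0" by simp
  \<comment> \<open>The initial values of \<open>h\<close> are adjoined as a last column to those of
    the states: g equations in g + 1 unknowns have a nonzero solution, and the Casoratian at 0
    forces its last entry to be nonzero. This gives a combination of states with the initial values
    of \<open>h\<close>.\<close>
  define f where "f = (\<lambda>i (j::nat). if j < g then \<phi> j (int i) else h (int i))"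
  have "\<exists>\<eta>. (\<exists>j\<in>{..g}. \<eta> j \<noteq> 0) \<and> (\<forall>i\<in>{..<g}. (\<Sum>j\<in>{..g}. f i j * \<eta> j) = 0)"
    by (rule underdetermined_solution) auto
  then obtain \<eta> where \<eta>: "\<exists>j\<le>g. \<eta> j \<noteq> 0" "\<And>i. i < g \<Longrightarrow> (\<Sum>j\<le>g. f i j * \<eta> j) = 0" by auto
  have sys: "(\<Sum>j<g. \<phi> j (int i) * \<eta> j) + h (int i) * \<eta> g = 0" if "i < g" for i
  proof -
    have "(\<Sum>j\<le>g. f i j * \<eta> j) = (\<Sum>j<g. f i j * \<eta> j) + f i g * \<eta> g"
      by (simp add: lessThan_Suc_atMost[symmetric])
    also have "(\<Sum>j<g. f i j * \<eta> j) = (\<Sum>j<g. \<phi> j (int i) * \<eta> j)"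
      by (intro sum.cong) (auto simp: f_def)
    finally show ?thesis using \<eta>(2)[OF that] by (simp add: f_def)
  qed
  have "\<eta> g \<noteq> 0"
  proof
    assume z: "\<eta> g = 0"
    have "\<eta> j = 0" if "j < g" for j
    proof (rule det_nonzero_right_kernel[of g "\<lambda>i j. \<phi> j (int i)"])
      show "det (mat g g (\<lambda>(i, j). \<phi> j (int i))) \<noteq> 0"
        using casorati_nonzero[of 0] by (simp add: casorati_states)
    qed (use sys z that in auto)
    then show False using \<eta>(1) z le_neq_implies_less by blast
  qed
  define a where "a j = - \<eta> j / \<eta> g" for j
  define k where "k = (\<lambda>n. \<Sum>j<g. a j * \<phi> j n)"
  have "h - k = 0"
  proof (rule T_kernel_zero)
    have "h = (h - k) + k" by simp
    then have "T h = T (h - k) + T k" using diff_op_additive[OF is_diff_op_T] by metis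
    then show "T (h - k) = 0" using h T_sum_states[of a] by (simp add: k_def)
    fix i assume "i < g"
    have "k (int i) = - (\<Sum>j<g. \<phi> j (int i) * \<eta> j) / \<eta> g"
      by (simp add: k_def a_def sum_negf sum_divide_distrib mult_ac)
    also have "\<dots> = h (int i)"
    proof -
      have "- (\<Sum>j<g. \<phi> j (int i) * \<eta> j) = h (int i) * \<eta> g"
        using sys[OF \<open>i < g\<close>] by (simp add: neg_eq_iff_add_eq_0)
      then show ?thesis using \<open>\<eta> g \<noteq> 0\<close> by simp
    qed
    finally show "(h - k) (int i) = 0" by simp
  qed
  then have "h = k" by simp
  then show "h \<in> seq_span states" unfolding seq_span_states k_def by blast
next
  fix h assume "h \<in> seq_span states"
  then show "h \<in> {h. T h = 0}" unfolding seq_span_states using T_sum_states by auto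
qed

end

section \<open>The ring of difference operators and its spectral curve\<close>

definition joukowski :: "complex \<Rightarrow> complex" where
  "joukowski z = z + inverse z"

lemma joukowski_inverse [simp]: "joukowski (inverse z) = joukowski z"
  by (simp add: joukowski_def)

lemma joukowski_surj: "\<exists>z. z \<noteq> 0 \<and> joukowski z = r"
proof -
  define z where "z = (r + csqrt (r\<^sup>2 - 4)) / 2"
  define y where "y = (r - csqrt (r\<^sup>2 - 4)) / 2"
  have "z * y = (r\<^sup>2 - (csqrt (r\<^sup>2 - 4))\<^sup>2) / 4"
    by (simp add: z_def y_def power2_eq_square algebra_simps)
  then have "z * y = 1" by simp
  then have "z \<noteq> 0" "inverse z = y" by (auto simp: inverse_unique)
  moreover have "z + y = r" by (simp add: z_def y_def field_simps)
  ultimately show ?thesis by (auto simp: joukowski_def)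
qed

lemma poly_joukowski_eq_0:
  assumes "finite F" "\<And>z. z \<notin> F \<Longrightarrow> poly A (joukowski z) = 0"
  shows "A = 0"
proof (rule ccontr)
  assume "A \<noteq> 0"
  have "UNIV \<subseteq> joukowski ` F \<union> {r. poly A r = 0}"
  proof
    fix r :: complex
    obtain z where "joukowski z = r" using joukowski_surj by blast
    then show "r \<in> joukowski ` F \<union> {r. poly A r = 0}" using assms(2)[of z] by blast
  qed
  then have "finite (UNIV :: complex set)"
    using assms(1) poly_roots_finite[OF \<open>A \<noteq> 0\<close>] by (meson finite_UnI finite_imageI finite_subset)
  then show False using infinite_UNIV_char_0 by blast
qed

lemma isCont_eq_off_finite:
  fixes f h :: "complex \<Rightarrow> complex"
  assumes "isCont f z" "isCont h z" "finite F" "\<And>w. w \<notin> F \<Longrightarrow> f w = h w"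
  shows "f z = h z"
proof -
  have "finite (F - {z})" using assms(3) by simp
  then have "open (- (F - {z}))" by (intro open_Compl finite_imp_closed)
  then have "eventually (\<lambda>w. w \<in> - (F - {z})) (at z)"
    by (rule eventually_at_in_open') simp
  moreover have "eventually (\<lambda>w. w \<noteq> z) (at z)" by (simp add: eventually_at_filter)
  ultimately have "eventually (\<lambda>w. f w = h w) (at z)"
    by eventually_elim (use assms(4) in auto)
  then have "f \<midarrow>z\<rightarrow> h z" using assms(2) by (simp add: isCont_def tendsto_cong)
  then show ?thesis using assms(1) LIM_unique by (auto simp: isCont_def)
qed

text \<open>Every Laurent polynomial in \<open>z\<close> is of the form \<open>a(u) + b(u) (z - z\<^sup>-\<^sup>1)\<close> with \<open>u = z + z\<^sup>-\<^sup>1\<close>.\<close>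

definition laurent :: "complex poly \<Rightarrow> complex poly \<Rightarrow> complex \<Rightarrow> complex" where
  "laurent a b z = poly a (joukowski z) + poly b (joukowski z) * (z - inverse z)"

lemma isCont_laurent: "z \<noteq> 0 \<Longrightarrow> isCont (laurent a b) z"
  unfolding laurent_def joukowski_def by (intro continuous_intros) auto

lemma laurent_inverse: "laurent a b (inverse z) = poly a (joukowski z) - poly b (joukowski z) * (z - inverse z)"
  by (simp add: laurent_def algebra_simps)

definition is_laurent :: "(complex \<Rightarrow> complex) \<Rightarrow> bool" where
  "is_laurent w \<longleftrightarrow> (\<exists>a b. \<forall>z. z \<noteq> 0 \<longrightarrow> w z = laurent a b z)"

lemma is_laurent_const: "is_laurent (\<lambda>z. k)"
  unfolding is_laurent_def by (rule exI[of _ "[:k:]"], rule exI[of _ 0]) (simp add: laurent_def)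

lemma is_laurent_add:
  assumes "is_laurent w" "is_laurent w'" shows "is_laurent (\<lambda>z. w z + w' z)"
proof -
  obtain a b a' b' where ab: "\<And>z. z \<noteq> 0 \<Longrightarrow> w z = laurent a b z" "\<And>z. z \<noteq> 0 \<Longrightarrow> w' z = laurent a' b' z"
    using assms unfolding is_laurent_def by blast
  show ?thesis unfolding is_laurent_def
    by (rule exI[of _ "a + a'"], rule exI[of _ "b + b'"]) (simp add: ab laurent_def algebra_simps)
qed

lemma is_laurent_mult:
  assumes "is_laurent w" "is_laurent w'" shows "is_laurent (\<lambda>z. w z * w' z)"
proof -
  obtain a b a' b' where ab: "\<And>z. z \<noteq> 0 \<Longrightarrow> w z = laurent a b z" "\<And>z. z \<noteq> 0 \<Longrightarrow> w' z = laurent a' b' z"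
    using assms unfolding is_laurent_def by blast
  have "w z * w' z = laurent (a * a' + b * b' * [:-4, 0, 1:]) (a * b' + b * a') z" if "z \<noteq> 0" for z
  proof -
    have "(z - inverse z) * (z - inverse z) = poly [:-4, 0, 1:] (joukowski z)"
      using that by (simp add: joukowski_def field_simps)
    moreover have "(A + B * y) * (A' + B' * y) = A * A' + B * B' * (y * y) + (A * B' + B * A') * y"
      for A B A' B' y :: complex by (simp add: algebra_simps)
    ultimately show ?thesis unfolding ab[OF that] laurent_def poly_add poly_mult by presburger
  qed
  then show ?thesis unfolding is_laurent_def by blast
qed

lemma is_laurent_ident: "is_laurent (\<lambda>z. z)"
  unfolding is_laurent_def
  by (rule exI[of _ "[:0, 1/2:]"], rule exI[of _ "[:1/2:]"]) (simp add: laurent_def joukowski_def field_simps)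

lemma is_laurent_inverse: "is_laurent (\<lambda>z. inverse z)"
  unfolding is_laurent_def
  by (rule exI[of _ "[:0, 1/2:]"], rule exI[of _ "[:-1/2:]"]) (simp add: laurent_def joukowski_def field_simps)

lemma is_laurent_power: "is_laurent w \<Longrightarrow> is_laurent (\<lambda>z. w z ^ n)"
  by (induction n) (auto intro: is_laurent_const is_laurent_mult)

lemma is_laurent_sum: "(\<And>i. i \<in> A \<Longrightarrow> is_laurent (w i)) \<Longrightarrow> is_laurent (\<lambda>z. \<Sum>i\<in>A. w i z)"
  by (induction A rule: infinite_finite_induct) (auto intro: is_laurent_const is_laurent_add)

lemma is_laurent_powi: "is_laurent (\<lambda>z. z powi n)"
  unfolding power_int_def
  by (cases "n \<ge> 0") (auto intro: is_laurent_power is_laurent_ident is_laurent_inverse)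

lemma is_laurent_poly: "is_laurent (\<lambda>z. poly p z)"
  unfolding poly_altdef
  by (intro is_laurent_sum is_laurent_mult is_laurent_const is_laurent_power is_laurent_ident)

lemma is_laurent_isCont: "is_laurent w \<Longrightarrow> z \<noteq> 0 \<Longrightarrow> isCont w z"
proof -
  assume "is_laurent w" and z: "z \<noteq> 0"
  then obtain a b where ab: "\<And>z. z \<noteq> 0 \<Longrightarrow> w z = laurent a b z" unfolding is_laurent_def by blast
  have "eventually (\<lambda>y. y \<in> - {0}) (nhds z)"
    by (rule eventually_nhds_in_open) (use z in auto)
  then have "eventually (\<lambda>y. w y = laurent a b y) (nhds z)"
    by eventually_elim (use ab in auto)
  then show ?thesis using isCont_cong isCont_laurent[OF z] by blast
qed

lemma is_laurent_eq_off_finite: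
  assumes "is_laurent w" "is_laurent w'" "finite F" "\<And>z. z \<notin> F \<Longrightarrow> w z = w' z" "z \<noteq> 0"
  shows "w z = w' z"
  using assms is_laurent_isCont isCont_eq_off_finite by metis

lemma nondegenerate_tridiagonal_is_diff_op: "nondegenerate_tridiagonal L \<Longrightarrow> is_diff_op L"
  unfolding nondegenerate_tridiagonal_def is_diff_op_def
  by (elim exE conjE) (rule exI[of _ "{-1, 0, 1}"], auto)

context bound_states
begin

section \<open>Difference operators and their symbols\<close>

definition bad :: "complex set" where
  "bad = insert 0 (l ` {..<g})"

lemma finite_bad: "finite bad" and zero_bad: "0 \<in> bad"
  by (auto simp: bad_def)

definition symbol :: "(seq \<Rightarrow> seq) \<Rightarrow> (complex \<Rightarrow> complex) \<Rightarrow> bool" where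
  "symbol L f \<longleftrightarrow> is_diff_op L \<and> (\<forall>n z. z \<notin> bad \<longrightarrow> L (\<lambda>m. W m z) n = f z * W n z)"

lemma symbol_iff: "symbol L f \<longleftrightarrow> is_diff_op L \<and> has_symbol g l d L f"
proof (cases "is_diff_op L")
  case True
  have "L (\<lambda>m. wave id g l d m z) n = f z * wave id g l d n z \<longleftrightarrow> L (\<lambda>m. W m z) n = f z * W n z"
    if z: "z \<noteq> 0" "\<forall>j<g. z \<noteq> l j" for n z
  proof -
    have "(\<Prod>j<g. z - l j) \<noteq> 0" using z by auto
    moreover have "L (\<lambda>m. inverse (\<Prod>j<g. z - l j) * W m z) n = inverse (\<Prod>j<g. z - l j) * L (\<lambda>m. W m z) n"
      by (rule diff_op_scale[OF True])
    ultimately show ?thesis using z by (simp add: wave_id divide_inverse mult.commute)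
  qed
  moreover have "z \<notin> bad \<longleftrightarrow> z \<noteq> 0 \<and> (\<forall>j<g. z \<noteq> l j)" for z by (auto simp: bad_def)
  ultimately show ?thesis using True unfolding symbol_def has_symbol_def by blast
qed (simp add: symbol_def)

lemma spectral_ring_eq: "spectral_ring g l d = {L. \<exists>f. symbol L f}"
  by (auto simp: spectral_ring_def symbol_iff)

lemma annihilates_W:
  assumes "is_diff_op L" "finite F" "\<And>n z. z \<notin> F \<Longrightarrow> z \<noteq> 0 \<Longrightarrow> L (\<lambda>m. W m z) n = 0"
  shows "L = 0"
proof (rule diff_op_faithful[of L "insert 0 F" P g])
  show "L (\<lambda>m. z powi m * poly (P m) z) n = 0" if "z \<notin> insert 0 F" for n z
    using assms(3)[of z n] that by (simp add: W_def)
qed (use assms degree_P coeff_P c_top in auto)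

lemma symbol_unique:
  assumes "symbol L f" "symbol M e" "finite F" "\<And>z. z \<notin> F \<Longrightarrow> z \<noteq> 0 \<Longrightarrow> f z = e z"
  shows "L = M"
proof -
  have "L - M = 0"
  proof (rule annihilates_W[of _ "F \<union> bad"])
    show "is_diff_op (L - M)" using assms(1,2) diff_op_closed(4) by (auto simp: symbol_def is_diff_op_eq)
  qed (use assms finite_bad in \<open>auto simp: symbol_def\<close>)
  then show ?thesis by simp
qed

lemma symbol_add: "symbol L f \<Longrightarrow> symbol M e \<Longrightarrow> symbol (L + M) (\<lambda>z. f z + e z)"
  using diff_op_closed(2) by (auto simp: symbol_def is_diff_op_eq distrib_right)

lemma symbol_uminus: "symbol L f \<Longrightarrow> symbol (- L) (\<lambda>z. - f z)"
  using diff_op_closed(3) by (auto simp: symbol_def is_diff_op_eq)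

lemma symbol_comp:
  assumes "symbol L f" "symbol M e" shows "symbol (L \<circ> M) (\<lambda>z. f z * e z)"
  unfolding symbol_def
proof (intro conjI allI impI)
  show "is_diff_op (L \<circ> M)" using assms diff_op_closed(5) by (auto simp: symbol_def is_diff_op_eq)
  fix n z assume z: "z \<notin> bad"
  then have "M (\<lambda>m. W m z) = (\<lambda>m. e z * W m z)" using assms(2) by (auto simp: symbol_def)
  then show "(L \<circ> M) (\<lambda>m. W m z) n = f z * e z * W n z"
    using assms(1) z diff_op_scale[of L "e z" "\<lambda>m. W m z" n] by (simp add: symbol_def mult_ac)
qed

lemma symbol_scalar: "symbol (scalar_op k) (\<lambda>z. k)"
  using is_diff_op_scalar by (simp add: symbol_def scalar_op_def)

lemma cring_spectral_ring: "cring (op_ring (spectral_ring g l d))"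
proof (rule cring_op_ring)
  fix L M assume "L \<in> spectral_ring g l d" "M \<in> spectral_ring g l d"
  then obtain f e where fe: "symbol L f" "symbol M e" by (auto simp: spectral_ring_eq)
  show "L + M \<in> spectral_ring g l d" "- L \<in> spectral_ring g l d" "L \<circ> M \<in> spectral_ring g l d"
    using symbol_add[OF fe] symbol_uminus[OF fe(1)] symbol_comp[OF fe] by (auto simp: spectral_ring_eq)
  show "L \<circ> M = M \<circ> L"
    by (rule symbol_unique[OF symbol_comp[OF fe] symbol_comp[OF fe(2,1)], of "{}"]) auto
next
  show "0 \<in> spectral_ring g l d"
    using symbol_scalar[of 0] by (auto simp: spectral_ring_eq scalar_op_def zero_fun_def)
  show "id \<in> spectral_ring g l d"
    using symbol_scalar[of 1] by (auto simp: spectral_ring_eq scalar_op_def id_def)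
qed (auto simp: spectral_ring_eq symbol_def intro: diff_op_additive)

text \<open>The hypothesis says that z^(-N) F(z) takes equal values at \<open>l j\<close> and its
  inverse, so multiplication by it preserves V. Expanding its product with \<open>W n\<close> in the
  basis gives the coefficients of the operator at n, and degrees confine the shifts to
  -N..N.\<close>

lemma symbol_exists:
  assumes deg: "degree F \<le> 2 * N"
    and F: "\<And>j. j < g \<Longrightarrow> l j powi (- int N) * poly F (l j) = l j powi int N * poly F (inverse (l j))"
  shows "\<exists>a. symbol (diff_op {- int N..int N} a) (\<lambda>z. z powi (- int N) * poly F z) \<and>
    (\<forall>n. a (int N) n = coeff F (2 * N))"
proof -
  have "\<exists>a. a (2 * N) = coeff F (2 * N) \<and> (\<forall>z. z \<noteq> 0 \<longrightarrow> z powi (n - int N) * poly (F * P n) z =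
      (\<Sum>i\<le>2 * N. a i * W (n - int N + int i) z))" for n
  proof -
    have "gluing (n - int N) (F * P n)"
      unfolding gluing_def
    proof (intro allI impI)
      fix j assume j: "j < g"
      have inv: "inverse (l j) powi (- int N) = l j powi int N" by (simp add: power_int_minus power_inverse)
      have "l j powi (n - int N) * poly (F * P n) (l j) =
          (l j powi (- int N) * poly F (l j)) * (l j powi n * poly (P n) (l j))"
        using l_nonzero[OF j] power_int_add[of "l j" n "- int N"] by (simp add: mult_ac)
      also have "\<dots> = (inverse (l j) powi (- int N) * poly F (inverse (l j))) *
          (d j * inverse (l j) powi n * poly (P n) (inverse (l j)))"
        using F[OF j] gluing_P[of n] j by (simp add: gluing_def inv)
      also have "\<dots> = d j * inverse (l j) powi (n - int N) * poly (F * P n) (inverse (l j))"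
        using l_nonzero[OF j] power_int_add[of "inverse (l j)" n "- int N"] by (simp add: mult_ac)
      finally show "l j powi (n - int N) * poly (F * P n) (l j) =
          d j * inverse (l j) powi (n - int N) * poly (F * P n) (inverse (l j))" .
    qed
    moreover have "degree (F * P n) \<le> g + 2 * N"
      using degree_mult_le[of F "P n"] deg degree_P[of n] by simp
    moreover have "coeff (F * P n) (g + 2 * N) = coeff F (2 * N)"
    proof -
      have "coeff (F * P n) (g + 2 * N) = (\<Sum>i\<le>g + 2 * N. coeff F i * coeff (P n) (g + 2 * N - i))"
        by (rule coeff_mult)
      also have "\<dots> = (\<Sum>i\<le>g + 2 * N. if i = 2 * N then coeff F (2 * N) else 0)"
      proof (rule sum.cong)
        fix i assume "i \<in> {..g + 2 * N}"
        show "coeff F i * coeff (P n) (g + 2 * N - i) = (if i = 2 * N then coeff F (2 * N) else 0)"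
          using deg by (cases i "2 * N" rule: linorder_cases) (auto simp: coeff_P c_top coeff_eq_0)
      qed simp
      finally show ?thesis by simp
    qed
    ultimately show ?thesis using W_expansion[of "n - int N" "F * P n" "2 * N"] by simp
  qed
  then have "\<exists>a. \<forall>n. a n (2 * N) = coeff F (2 * N) \<and>
      (\<forall>z. z \<noteq> 0 \<longrightarrow> z powi (n - int N) * poly (F * P n) z = (\<Sum>i\<le>2 * N. a n i * W (n - int N + int i) z))"
    by (intro choice allI)
  then obtain a where a: "\<And>n. a n (2 * N) = coeff F (2 * N)"
    "\<And>n z. z \<noteq> 0 \<Longrightarrow> z powi (n - int N) * poly (F * P n) z = (\<Sum>i\<le>2 * N. a n i * W (n - int N + int i) z)"
    by blast
  define b where "b = (\<lambda>j n. a n (nat (j + int N)))"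
  have "symbol (diff_op {- int N..int N} b) (\<lambda>z. z powi (- int N) * poly F z)"
    unfolding symbol_def
  proof (intro conjI allI impI)
    show "is_diff_op (diff_op {- int N..int N} b)" unfolding is_diff_op_def by blast
    fix n z assume "z \<notin> bad"
    then have z: "z \<noteq> 0" using zero_bad by auto
    have "(\<Sum>j\<in>{- int N..int N}. b j n * W (n + j) z) = (\<Sum>i\<le>2 * N. a n i * W (n - int N + int i) z)"
      by (rule sum.reindex_bij_witness[of _ "\<lambda>i. int i - int N" "\<lambda>j. nat (j + int N)"]) (auto simp: b_def)
    also have "\<dots> = z powi (n - int N) * poly (F * P n) z" using a(2)[OF z] by simp
    also have "\<dots> = z powi (- int N) * poly F z * W n z"
      using z power_int_add[of z n "- int N"] by (simp add: W_def mult_ac)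
    finally show "diff_op {- int N..int N} b (\<lambda>m. W m z) n = z powi (- int N) * poly F z * W n z"
      by (simp add: diff_op_def)
  qed
  moreover have "b (int N) n = coeff F (2 * N)" for n
  proof -
    have "nat (int N + int N) = 2 * N" by linarith
    then show ?thesis using a(1)[of n] by (simp only: b_def)
  qed
  ultimately show ?thesis by (intro exI[of _ b] conjI allI)
qed

lemma symbol_cong:
  assumes "symbol L f" "\<And>z. z \<noteq> 0 \<Longrightarrow> f z = e z" shows "symbol L e"
proof -
  have "f z = e z" if "z \<notin> bad" for z using assms(2)[of z] that zero_bad by auto
  then show ?thesis using assms(1) by (auto simp: symbol_def)
qed

lemma ex_joukowski_op: "\<exists>a. symbol (diff_op {-1, 0, 1} a) joukowski \<and> (\<forall>n. a 1 n = 1)"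
proof -
  \<comment> \<open>This is z + 1/z = z^(-1) (1 + z^2) with N = 1; the top coefficient 1 makes the
    order equal to 1.\<close>
  have "\<exists>a. symbol (diff_op {- int 1..int 1} a) (\<lambda>z. z powi (- int 1) * poly [:1, 0, 1:] z) \<and>
    (\<forall>n. a (int 1) n = coeff [:1, 0, 1:] (2 * 1))"
    using l_nonzero by (intro symbol_exists) (auto simp: field_simps)
  moreover have "{- int 1..int 1} = {-1, 0, 1}" by auto
  ultimately obtain a where a: "symbol (diff_op {-1, 0, 1} a) (\<lambda>z. z powi (- int 1) * poly [:1, 0, 1:] z)"
    "\<And>n. a 1 n = 1" by (auto simp: numeral_2_eq_2)
  then show ?thesis
    by (intro exI[of _ a] conjI symbol_cong[OF a(1)]) (auto simp: joukowski_def field_simps)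
qed

section \<open>The coordinates u and v, and the operators attached to plane polynomials\<close>

definition pole_factor :: "complex poly" where
  "pole_factor = (\<Prod>j<g. [:- joukowski (l j), 1:])"

definition curve_v :: "complex \<Rightarrow> complex" where
  "curve_v z = (z - inverse z) * poly pole_factor (joukowski z)"

text \<open>This is z^g times \<open>pole_factor\<close> at z + 1/z. Vanishing at both points of
  every pair, it satisfies the gluing conditions whatever the parameters are, and so do its
  multiples.\<close>

definition node_poly :: "complex poly" where
  "node_poly = (\<Prod>j<g. [:- l j, 1:]) * (\<Prod>j<g. [:- inverse (l j), 1:])"

lemma node_poly_joukowski: "z \<noteq> 0 \<Longrightarrow> z powi (- int g) * poly node_poly z = poly pole_factor (joukowski z)"
proof -
  assume z: "z \<noteq> 0"
  have "z powi (- int g) * poly node_poly z = (\<Prod>j<g. inverse z) * (\<Prod>j<g. (z - l j) * (z - inverse (l j)))"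
    by (simp add: power_int_minus node_poly_def poly_prod power_inverse prod.distrib)
  also have "\<dots> = (\<Prod>j<g. joukowski z - joukowski (l j))"
    unfolding prod.distrib[symmetric]
  proof (rule prod.cong)
    fix j assume "j \<in> {..<g}"
    then show "inverse z * ((z - l j) * (z - inverse (l j))) = joukowski z - joukowski (l j)"
      using z l_nonzero[of j] by (simp add: joukowski_def field_simps)
  qed simp
  finally show ?thesis by (simp add: pole_factor_def poly_prod)
qed

lemma degree_node_poly: "degree node_poly \<le> 2 * g"
proof -
  have "degree (\<Prod>j<g. [:- f j, 1:]) = g" for f :: "nat \<Rightarrow> complex"
    by (subst degree_prod_eq_sum_degree) auto
  then show ?thesis
    using degree_mult_le[of "\<Prod>j<g. [:- l j, 1:]" "\<Prod>j<g. [:- inverse (l j), 1:]"]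
    by (simp add: node_poly_def)
qed

lemma node_poly_zero: "j < g \<Longrightarrow> poly node_poly (l j) = 0" "j < g \<Longrightarrow> poly node_poly (inverse (l j)) = 0"
  by (auto simp: node_poly_def poly_prod)

lemma pole_factor_zero: "j < g \<Longrightarrow> poly pole_factor (joukowski (l j)) = 0"
  by (auto simp: pole_factor_def poly_prod)

lemma ex_curve_v_op: "\<exists>L. symbol L curve_v"
proof -
  \<comment> \<open>The factor z - 1/z = z^(-1) (z^2 - 1) adds one to the exponent g of
    \<open>node_poly\<close>, so N = g + 1; both sides of the symbol condition are 0.\<close>
  define F where "F = [:-1, 0, 1:] * node_poly"
  have "degree F \<le> 2 * (g + 1)"
    using degree_mult_le[of "[:-1, 0, 1:]" node_poly] degree_node_poly by (simp add: F_def)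
  then obtain a where "symbol (diff_op {- int (g + 1)..int (g + 1)} a) (\<lambda>z. z powi (- int (g + 1)) * poly F z)"
    using symbol_exists[of F "g + 1"] node_poly_zero by (auto simp: F_def)
  moreover have "z powi (- int (g + 1)) * poly F z = curve_v z" if "z \<noteq> 0" for z
  proof -
    have "z powi (- int (g + 1)) = inverse z * z powi (- int g)"
      using that power_int_add[of z "-1" "- int g"] by (simp add: algebra_simps)
    moreover have "inverse z * poly [:-1, 0, 1:] z = z - inverse z" using that by (simp add: field_simps)
    moreover have "(inverse z * z powi (- int g)) * (poly [:-1, 0, 1:] z * poly node_poly z) =
        (inverse z * poly [:-1, 0, 1:] z) * (z powi (- int g) * poly node_poly z)"
      by (simp only: mult_ac)
    ultimately show ?thesis
      unfolding curve_v_def node_poly_joukowski[OF that, symmetric] F_def poly_mult by metis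
  qed
  ultimately show ?thesis using symbol_cong by blast
qed

definition plane_eval :: "complex poly poly \<Rightarrow> complex \<Rightarrow> complex" where
  "plane_eval p z = poly (poly p [:curve_v z:]) (joukowski z)"

lemma ex_plane_op: "\<exists>L. symbol L (plane_eval p)"
proof -
  obtain U where U: "symbol U joukowski" using ex_joukowski_op by blast
  obtain V where V: "symbol V curve_v" using ex_curve_v_op by blast
  have poly_op: "\<exists>L. symbol L (\<lambda>z. poly a (joukowski z))" for a
  proof (induction a)
    case 0
    then show ?case using symbol_scalar[of 0] by auto
  next
    case (pCons k a)
    then show ?case using symbol_add[OF symbol_scalar symbol_comp[OF U]] by fastforce
  qed
  show ?thesis
  proof (induction p)
    case 0
    then show ?case using symbol_scalar[of 0] by (auto simp: plane_eval_def[abs_def])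
  next
    case (pCons a p)
    then obtain L where L: "symbol L (plane_eval p)" by blast
    obtain A where A: "symbol A (\<lambda>z. poly a (joukowski z))" using poly_op by blast
    show ?case using symbol_add[OF A symbol_comp[OF V L]] by (auto simp: plane_eval_def[abs_def])
  qed
qed

text \<open>The choice is unambiguous by \<open>symbol_unique\<close>.\<close>

definition plane_op :: "complex poly poly \<Rightarrow> seq \<Rightarrow> seq" where
  "plane_op p = (SOME L. symbol L (plane_eval p))"

lemma symbol_plane_op: "symbol (plane_op p) (plane_eval p)"
  unfolding plane_op_def using ex_plane_op by (rule someI_ex)

lemma plane_op_eqI:
  assumes "symbol L f" "finite F" "\<And>z. z \<notin> F \<Longrightarrow> z \<noteq> 0 \<Longrightarrow> f z = plane_eval p z"
  shows "plane_op p = L"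
  using symbol_unique[OF assms(1) symbol_plane_op assms(2,3)] by simp

lemma plane_op_scalar: "plane_op [:[:k:]:] = scalar_op k"
  by (rule plane_op_eqI[OF symbol_scalar, of "{}"]) (auto simp: plane_eval_def)

lemma plane_op_add: "plane_op (p + r) = plane_op p + plane_op r"
  by (rule plane_op_eqI[OF symbol_add[OF symbol_plane_op symbol_plane_op], of "{}"])
    (auto simp: plane_eval_def)

lemma plane_op_mult: "plane_op (p * r) = plane_op p \<circ> plane_op r"
  by (rule plane_op_eqI[OF symbol_comp[OF symbol_plane_op symbol_plane_op], of "{}"])
    (auto simp: plane_eval_def)

text \<open>At the two points of a pair u agrees, while z - 1/z is nonzero and changes sign, so the
  two values separate the even part \<open>a\<close> from the odd part \<open>b\<close>.\<close>

lemma laurent_values_imp: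
  assumes "j < g"
  shows "laurent a b (l j) = laurent a b (inverse (l j)) \<Longrightarrow> poly b (joukowski (l j)) = 0"
    and "laurent a b (l j) = 0 \<Longrightarrow> laurent a b (inverse (l j)) = 0 \<Longrightarrow> poly a (joukowski (l j)) = 0"
proof -
  have nz: "l j - inverse (l j) \<noteq> 0"
    using l_mult[OF assms assms] l_nonzero[OF assms] by (simp add: field_simps)
  show "laurent a b (l j) = laurent a b (inverse (l j)) \<Longrightarrow> poly b (joukowski (l j)) = 0"
    unfolding laurent_inverse using nz by (simp add: laurent_def)
  show "laurent a b (l j) = 0 \<Longrightarrow> laurent a b (inverse (l j)) = 0 \<Longrightarrow> poly a (joukowski (l j)) = 0"
    unfolding laurent_inverse by (simp add: laurent_def)
qed

lemma inj_joukowski: "inj_on (\<lambda>j. joukowski (l j)) {..<g}"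
proof (rule inj_onI, rule ccontr)
  fix i j assume ij: "i \<in> {..<g}" "j \<in> {..<g}" "joukowski (l i) = joukowski (l j)" "i \<noteq> j"
  have nz: "l i \<noteq> 0" "l j \<noteq> 0" using l_nonzero ij by auto
  have "(l i - l j) * (l i * l j - 1) = l i * l j * (joukowski (l i) - joukowski (l j))"
    using nz by (simp add: joukowski_def field_simps)
  then show False using ij l_distinct[of i j] l_mult[of i j] by simp
qed

lemma pole_factor_dvd: "(\<And>j. j < g \<Longrightarrow> poly b (joukowski (l j)) = 0) \<Longrightarrow> pole_factor dvd b"
  unfolding pole_factor_def using prod_linear_dvd[OF _ inj_joukowski, of b] by simp

text \<open>This is f V \<subseteq> V: expand the element of V in the functions \<open>W\<close> and
  let \<open>L\<close> act on each. The result is a Laurent polynomial in V that agrees with the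
  product wherever \<open>f\<close> is controlled.\<close>

lemma symbol_times_glued:
  assumes "symbol L f" "gluing n G"
  shows "\<exists>h. is_laurent h \<and> (\<forall>j<g. h (l j) = d j * h (inverse (l j))) \<and>
    (\<forall>z. z \<notin> bad \<longrightarrow> f z * (z powi n * poly G z) = h z)"
proof -
  obtain S a where S: "L = diff_op S a" using assms(1) by (auto simp: symbol_def is_diff_op_def)
  have "degree G \<le> g + degree G" by simp
  then obtain b where b: "\<And>z. z \<noteq> 0 \<Longrightarrow> z powi n * poly G z = (\<Sum>i\<le>degree G. b i * W (n + int i) z)"
    using W_expansion[OF assms(2)] by blast
  define h where "h = (\<lambda>z. \<Sum>i\<le>degree G. b i * (\<Sum>j\<in>S. a j (n + int i) * W (n + int i + j) z))"
  have "is_laurent (W m)" for m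
    unfolding W_def[abs_def] by (intro is_laurent_mult is_laurent_powi is_laurent_poly)
  then have "is_laurent h"
    unfolding h_def by (intro is_laurent_sum is_laurent_mult is_laurent_const)
  moreover have "h (l j) = d j * h (inverse (l j))" if "j < g" for j
  proof -
    have "W m (l j) = d j * W m (inverse (l j))" for m
      using gluing_P[of m] that by (simp add: W_def gluing_def mult_ac)
    then show ?thesis by (simp add: h_def sum_distrib_left mult_ac)
  qed
  moreover have "f z * (z powi n * poly G z) = h z" if "z \<notin> bad" for z
  proof -
    have "z \<noteq> 0" using that zero_bad by auto
    have "f z * W m z = (\<Sum>j\<in>S. a j m * W (m + j) z)" for m
      using assms(1) that unfolding symbol_def S diff_op_def by simp
    then show ?thesis unfolding b[OF \<open>z \<noteq> 0\<close>] h_def by (simp add: sum_distrib_left mult.left_commute)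
  qed
  ultimately show ?thesis by blast
qed

text \<open>\<open>H\<close> vanishes at all other pairs, so only the condition at j is left, and a
  linear factor can arrange it.\<close>

lemma gluing_separates:
  assumes "j < g"
  shows "\<exists>G. gluing 0 G \<and> poly G (l j) \<noteq> 0 \<and> poly G (inverse (l j)) \<noteq> 0"
proof -
  define H where "H = (\<Prod>i\<in>{..<g} - {j}. [:- l i, 1:]) * (\<Prod>i\<in>{..<g} - {j}. [:- inverse (l i), 1:])"
  have H0: "poly H (l i) = 0" "poly H (inverse (l i)) = 0" if "i < g" "i \<noteq> j" for i
    using that by (force simp: H_def poly_prod)+
  have ne: "l j - l i \<noteq> 0" "l j - inverse (l i) \<noteq> 0" "inverse (l j) - l i \<noteq> 0"
    "inverse (l j) - inverse (l i) \<noteq> 0" if "i < g" "i \<noteq> j" for i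
    using that assms l_distinct[of i j] l_mult[of i j] l_nonzero by (auto simp: field_simps)
  have Hl: "poly H (l j) \<noteq> 0" "poly H (inverse (l j)) \<noteq> 0"
    using ne by (auto simp: H_def poly_prod)
  have nz: "l j - inverse (l j) \<noteq> 0"
    using l_mult[OF assms assms] l_nonzero[OF assms] by (simp add: field_simps)
  \<comment> \<open>\<open>B\<close> interpolates so that \<open>H * B\<close> takes the values d
    H(l) H(1/l) at l and H(l) H(1/l) at 1/l, whose ratio is the required \<open>d j\<close>.\<close>
  define \<alpha> where "\<alpha> = (d j * poly H (inverse (l j)) - poly H (l j)) / (l j - inverse (l j))"
  define B where "B = [:poly H (l j) - \<alpha> * inverse (l j), \<alpha>:]"
  have B2: "poly B (inverse (l j)) = poly H (l j)" by (simp add: B_def)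
  have "poly B (l j) = poly H (l j) + \<alpha> * (l j - inverse (l j))" by (simp add: B_def algebra_simps)
  then have B1: "poly B (l j) = d j * poly H (inverse (l j))" using nz by (simp add: \<alpha>_def)
  have "poly (H * B) (l i) = d i * poly (H * B) (inverse (l i))" if "i < g" for i
    by (cases "i = j") (use H0 that B1 B2 in auto)
  then have "gluing 0 (H * B)" by (auto simp: gluing_def)
  moreover have "poly (H * B) (l j) \<noteq> 0" "poly (H * B) (inverse (l j)) \<noteq> 0"
    using Hl B1 B2 d_nonzero[OF assms] by auto
  ultimately show ?thesis by blast
qed

text \<open>Multiplying \<open>f\<close> by an element of V vanishing at all pairs shows that
  \<open>f\<close> is a Laurent polynomial \<open>h\<close> divided by \<open>w\<close>. Multiplying
  by elements that do not vanish at the j-th pair shows that \<open>h\<close> vanishes there, so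
  \<open>w\<close> divides out. The gluing of both f G and G then gives \<open>f\<close> equal
  values on each pair, so its odd part is divisible by \<open>pole_factor\<close>, that is,
  \<open>f\<close> is a polynomial in u and v.\<close>

lemma symbol_is_plane_eval:
  assumes L: "symbol L f"
  shows "\<exists>p F. finite F \<and> (\<forall>z. z \<notin> F \<longrightarrow> z \<noteq> 0 \<longrightarrow> f z = plane_eval p z)"
proof -
  define w where "w = (\<lambda>z. poly pole_factor (joukowski z))"
  have "is_laurent w" unfolding is_laurent_def w_def
    by (rule exI[of _ pole_factor], rule exI[of _ 0]) (simp add: laurent_def)
  have w0: "w (l j) = 0" "w (inverse (l j)) = 0" if "j < g" for j
    using pole_factor_zero[OF that] by (auto simp: w_def)
  have "gluing (- int g) node_poly" using node_poly_zero by (auto simp: gluing_def)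
  from symbol_times_glued[OF L this] obtain h where h: "is_laurent h"
    "\<And>z. z \<notin> bad \<Longrightarrow> f z * (z powi (- int g) * poly node_poly z) = h z" by blast
  have h_w: "h z = f z * w z" if "z \<notin> bad" for z
  proof -
    have "z \<noteq> 0" using that zero_bad by auto
    then show ?thesis using h(2)[OF that] unfolding node_poly_joukowski[OF \<open>z \<noteq> 0\<close>] w_def by simp
  qed
  have "\<exists>G k. gluing 0 G \<and> poly G (l j) \<noteq> 0 \<and> poly G (inverse (l j)) \<noteq> 0 \<and> is_laurent k \<and>
      k (l j) = d j * k (inverse (l j)) \<and> (\<forall>z. z \<notin> bad \<longrightarrow> f z * poly G z = k z)" if j: "j < g" for j
  proof -
    obtain G where G: "gluing 0 G" "poly G (l j) \<noteq> 0" "poly G (inverse (l j)) \<noteq> 0"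
      using gluing_separates[OF j] by blast
    then show ?thesis using symbol_times_glued[OF L G(1)] j by (intro exI[of _ G]) auto
  qed
  then have "\<exists>G k. \<forall>j<g. gluing 0 (G j) \<and> poly (G j) (l j) \<noteq> 0 \<and> poly (G j) (inverse (l j)) \<noteq> 0 \<and>
      is_laurent (k j) \<and> k j (l j) = d j * k j (inverse (l j)) \<and> (\<forall>z. z \<notin> bad \<longrightarrow> f z * poly (G j) z = k j z)"
    by metis
  then obtain G k where G: "\<And>j. j < g \<Longrightarrow> gluing 0 (G j)" "\<And>j. j < g \<Longrightarrow> poly (G j) (l j) \<noteq> 0"
      "\<And>j. j < g \<Longrightarrow> poly (G j) (inverse (l j)) \<noteq> 0"
    and k: "\<And>j. j < g \<Longrightarrow> is_laurent (k j)" "\<And>j. j < g \<Longrightarrow> k j (l j) = d j * k j (inverse (l j))"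
      "\<And>j z. j < g \<Longrightarrow> z \<notin> bad \<Longrightarrow> f z * poly (G j) z = k j z" by blast
  \<comment> \<open>Both sides are f w G_j off \<open>bad\<close>; by continuity they agree at the
    j-th pair too, where \<open>w\<close> vanishes and \<open>G j\<close> does not.\<close>
  have hG: "h z * poly (G j) z = k j z * w z" if "j < g" "z \<noteq> 0" for j z
  proof (rule is_laurent_eq_off_finite[of "\<lambda>z. h z * poly (G j) z" "\<lambda>z. k j z * w z" bad])
    show "h z * poly (G j) z = k j z * w z" if "z \<notin> bad" for z
      using h_w[OF that] k(3)[OF \<open>j < g\<close> that] by (simp add: mult_ac)
    show "is_laurent (\<lambda>z. h z * poly (G j) z)" by (intro is_laurent_mult is_laurent_poly h(1))
    show "is_laurent (\<lambda>z. k j z * w z)" by (intro is_laurent_mult k(1)[OF that(1)] \<open>is_laurent w\<close>)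
  qed (use that finite_bad in simp_all)
  obtain a b where ab: "\<And>z. z \<noteq> 0 \<Longrightarrow> h z = laurent a b z" using h(1) unfolding is_laurent_def by blast
  have hz: "laurent a b (l j) = 0" "laurent a b (inverse (l j)) = 0" if "j < g" for j
    using hG[OF that, of "l j"] hG[OF that, of "inverse (l j)"] G(2,3)[OF that] w0[OF that] l_nonzero[OF that]
      ab[of "l j"] ab[of "inverse (l j)"] by auto
  have "pole_factor dvd a" "pole_factor dvd b"
    using hz laurent_values_imp(1)[of _ a b] laurent_values_imp(2)[of _ a b] by (auto intro!: pole_factor_dvd)
  then obtain a' b' where a': "a = pole_factor * a'" "b = pole_factor * b'" by (auto elim!: dvdE)
  have h_e: "h z = w z * laurent a' b' z" if "z \<noteq> 0" for z
    using ab[OF that] by (simp add: a' laurent_def w_def algebra_simps)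
  define F where "F = bad \<union> (\<lambda>j. inverse (l j)) ` {..<g}"
  have "finite F" using finite_bad by (simp add: F_def)
  have f_e: "f z = laurent a' b' z" if "z \<notin> F" for z
  proof -
    have z: "z \<notin> bad" "z \<noteq> 0" using that zero_bad by (auto simp: F_def)
    have "poly node_poly z \<noteq> 0" using that by (auto simp: F_def bad_def node_poly_def poly_prod)
    then have "w z \<noteq> 0" using node_poly_joukowski[OF z(2)] z(2) by (auto simp: w_def)
    then show ?thesis using h_w[OF z(1)] h_e[OF z(2)] by simp
  qed
  have "is_laurent (laurent a' b')" unfolding is_laurent_def by blast
  have kG: "k j z = laurent a' b' z * poly (G j) z" if "j < g" "z \<noteq> 0" for j z
  proof (rule is_laurent_eq_off_finite[of "k j" "\<lambda>z. laurent a' b' z * poly (G j) z" F])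
    show "k j z = laurent a' b' z * poly (G j) z" if "z \<notin> F" for z
      using f_e[OF that] k(3)[OF \<open>j < g\<close>, of z] that by (auto simp: F_def)
    show "is_laurent (\<lambda>z. laurent a' b' z * poly (G j) z)"
      by (intro is_laurent_mult is_laurent_poly \<open>is_laurent (laurent a' b')\<close>)
  qed (use that k(1) \<open>finite F\<close> in simp_all)
  have "laurent a' b' (l j) = laurent a' b' (inverse (l j))" if "j < g" for j
  proof -
    have "laurent a' b' (l j) * poly (G j) (l j) = d j * (laurent a' b' (inverse (l j)) * poly (G j) (inverse (l j)))"
      using kG[OF that, of "l j"] kG[OF that, of "inverse (l j)"] k(2)[OF that] l_nonzero[OF that] by simp
    moreover have "poly (G j) (l j) = d j * poly (G j) (inverse (l j))"
      using G(1)[OF that] that by (simp add: gluing_def)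
    ultimately show ?thesis using G(2)[OF that] by (simp add: mult_ac)
  qed
  then have "pole_factor dvd b'" using laurent_values_imp(1) by (auto intro!: pole_factor_dvd)
  then obtain b'' where "b' = pole_factor * b''" by (auto elim!: dvdE)
  then have "laurent a' b' z = plane_eval [:a', b'':] z" for z
    by (simp add: laurent_def plane_eval_def curve_v_def mult_ac)
  then show ?thesis using f_e \<open>finite F\<close> by auto
qed

lemma plane_op_surj: "range plane_op = spectral_ring g l d"
proof (intro subset_antisym subsetI)
  fix L assume "L \<in> spectral_ring g l d"
  then obtain f where f: "symbol L f" by (auto simp: spectral_ring_eq)
  from symbol_is_plane_eval[OF f] obtain p F where "finite F" "\<And>z. z \<notin> F \<Longrightarrow> z \<noteq> 0 \<Longrightarrow> f z = plane_eval p z"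
    by blast
  then have "plane_op p = L" using plane_op_eqI[OF f] by blast
  then show "L \<in> range plane_op" by blast
next
  fix L assume "L \<in> range plane_op"
  then show "L \<in> spectral_ring g l d" using symbol_plane_op by (auto simp: spectral_ring_eq)
qed

section \<open>The kernel and the equation of the curve\<close>

definition disc_poly :: "complex poly" where
  "disc_poly = [:-4, 0, 1:] * pole_factor\<^sup>2"

definition curve_poly :: "complex poly poly" where
  "curve_poly = [:- disc_poly, 0, 1:]"

lemma plane_eval_curve: "z \<noteq> 0 \<Longrightarrow> plane_eval curve_poly z = 0"
proof -
  assume z: "z \<noteq> 0"
  have "(z - inverse z) * (z - inverse z) = poly [:-4, 0, 1:] (joukowski z)"
    using z by (simp add: joukowski_def field_simps)
  moreover have "y * A * (y * A) = (y * y) * (A * A)" for y A :: complex by (simp add: mult_ac)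
  ultimately have "curve_v z * curve_v z = poly disc_poly (joukowski z)"
    unfolding curve_v_def disc_poly_def poly_mult poly_power power2_eq_square by presburger
  then show ?thesis by (simp add: plane_eval_def curve_poly_def)
qed

lemma division_by_curve: "\<exists>s a b. p = curve_poly * s + [:a, b:]"
proof (induction p)
  case 0
  then show ?case by (intro exI[of _ 0]) auto
next
  case (pCons k p)
  then obtain s a b where "p = curve_poly * s + [:a, b:]" by blast
  then have "pCons k p = curve_poly * ([:0, 1:] * s + [:b:]) + [:k + b * disc_poly, a:]"
    by (simp add: curve_poly_def algebra_simps)
  then show ?case by blast
qed

text \<open>Only the remainder a(u) + b(u) v matters. Inverting z fixes u and changes the sign of v,
  so a(u) and b(u) v vanish separately, and both polynomials are zero since u takes every complex
  value.\<close>

lemma plane_op_zero_iff: "plane_op p = 0 \<longleftrightarrow> curve_poly dvd p"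
proof
  assume "curve_poly dvd p"
  then obtain s where s: "p = curve_poly * s" by (auto elim: dvdE)
  have "symbol 0 (\<lambda>z. 0)" using symbol_scalar[of 0] by (simp add: scalar_op_def zero_fun_def)
  then show "plane_op p = 0"
    by (rule plane_op_eqI[of _ _ "{}"]) (use plane_eval_curve in \<open>auto simp: s plane_eval_def\<close>)
next
  assume p: "plane_op p = 0"
  obtain s a b where s: "p = curve_poly * s + [:a, b:]" using division_by_curve by blast
  \<comment> \<open>Outside the roots of \<open>P 0\<close> the factor \<open>W 0 z\<close> can be
    cancelled from the eigenvalue equation.\<close>
  define F where "F = bad \<union> {z. poly (P 0) z = 0}"
  have "P 0 \<noteq> 0" using coeff_P[of 0 g] c_top[of 0] by auto
  then have "finite F" using finite_bad poly_roots_finite by (auto simp: F_def)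
  have ab: "poly a (joukowski z) + curve_v z * poly b (joukowski z) = 0" if z: "z \<notin> F" for z
  proof -
    have nz: "z \<noteq> 0" "z \<notin> bad" "W 0 z \<noteq> 0" using z zero_bad by (auto simp: F_def W_def)
    have "plane_eval p z * W 0 z = plane_op p (\<lambda>m. W m z) 0"
      using symbol_plane_op[of p] nz(2) by (simp add: symbol_def)
    then have "plane_eval p z = 0" using p nz(3) by simp
    then show ?thesis using plane_eval_curve[OF nz(1)] by (simp add: s plane_eval_def)
  qed
  define F' where "F' = F \<union> inverse ` F"
  have "finite F'" using \<open>finite F\<close> by (simp add: F'_def)
  have *: "poly a (joukowski z) = 0 \<and> curve_v z * poly b (joukowski z) = 0" if "z \<notin> F'" for z
  proof -
    have "inverse z \<notin> F" using that by (metis F'_def UnI2 image_eqI inverse_inverse_eq)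
    moreover have "curve_v (inverse z) = - curve_v z" by (simp add: curve_v_def algebra_simps)
    ultimately have "poly a (joukowski z) - curve_v z * poly b (joukowski z) = 0" using ab[of "inverse z"] by simp
    moreover have "poly a (joukowski z) + curve_v z * poly b (joukowski z) = 0"
      using ab[of z] that by (simp add: F'_def)
    moreover have "2 * A = 0" if "A - y = 0" "A + y = 0" for A y :: complex
    proof -
      have "2 * A = (A - y) + (A + y)" by simp
      then show ?thesis unfolding that by simp
    qed
    ultimately have "2 * poly a (joukowski z) = 0" by blast
    then have "poly a (joukowski z) = 0" by simp
    then show ?thesis using \<open>poly a (joukowski z) + curve_v z * poly b (joukowski z) = 0\<close> by simp
  qed
  have "a = 0" by (rule poly_joukowski_eq_0[OF \<open>finite F'\<close>]) (use * in blast)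
  \<comment> \<open>One more factor z - 1/z turns b(u) v into a polynomial in u.\<close>
  moreover have "pole_factor * ([:-4, 0, 1:] * b) = 0"
  proof (rule poly_joukowski_eq_0[of "insert 0 F'"])
    fix z assume z: "z \<notin> insert 0 F'"
    have "(z - inverse z) * (z - inverse z) = poly [:-4, 0, 1:] (joukowski z)"
      using z by (simp add: joukowski_def field_simps)
    then have "poly (pole_factor * ([:-4, 0, 1:] * b)) (joukowski z) =
        (z - inverse z) * (curve_v z * poly b (joukowski z))"
      unfolding poly_mult curve_v_def by (simp only: mult.assoc[symmetric]) (simp only: mult_ac)
    then show "poly (pole_factor * ([:-4, 0, 1:] * b)) (joukowski z) = 0" using * z by simp
  qed (use \<open>finite F'\<close> in simp)
  moreover have "pole_factor \<noteq> 0" by (simp add: pole_factor_def)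
  moreover have "[:-4, 0, 1:] \<noteq> (0 :: complex poly)" by simp
  ultimately have "b = 0" by (simp only: mult_eq_0_iff simp_thms)
  then show "curve_poly dvd p" using s \<open>a = 0\<close> by simp
qed

end

lemma cring_plane_ring: "cring plane_ring"
proof (rule cringI)
  show "abelian_group plane_ring"
    by (rule abelian_groupI) (auto simp: plane_ring_def algebra_simps intro: exI[of _ "- x" for x])
  show "comm_monoid plane_ring"
    by (rule comm_monoidI) (auto simp: plane_ring_def algebra_simps)
qed (auto simp: plane_ring_def algebra_simps)

context bound_states
begin

lemma plane_op_ring_hom: "ring_hom_ring plane_ring (op_ring (spectral_ring g l d)) plane_op"
proof (rule ring_hom_ringI2)
  show "ring plane_ring" "ring (op_ring (spectral_ring g l d))"
    using cring_plane_ring cring_spectral_ring by (auto simp: cring.axioms)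
  show "plane_op \<in> Ring.ring_hom plane_ring (op_ring (spectral_ring g l d))"
  proof (rule ring_hom_memI)
    have "plane_op 1 = id" using plane_op_scalar[of 1]
      by (simp add: scalar_op_def id_def one_pCons)
    then show "plane_op \<one>\<^bsub>plane_ring\<^esub> = \<one>\<^bsub>op_ring (spectral_ring g l d)\<^esub>"
      by (simp add: plane_ring_def op_ring_def)
  qed (use plane_op_surj in \<open>auto simp: plane_ring_def op_ring_def plane_op_add plane_op_mult\<close>)
qed

lemma plane_op_kernel: "a_kernel plane_ring (op_ring (spectral_ring g l d)) plane_op = curve_ideal curve_poly"
proof -
  interpret cring plane_ring by (rule cring_plane_ring)
  have "curve_ideal curve_poly = PIdl\<^bsub>plane_ring\<^esub> curve_poly"
    unfolding curve_ideal_def by (rule cgenideal_eq_genideal[symmetric]) (simp add: plane_ring_def)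
  also have "\<dots> = {p. curve_poly dvd p}"
    by (auto simp: cgenideal_def plane_ring_def dvd_def mult.commute)
  finally show ?thesis
    by (auto simp: a_kernel_def kernel_def plane_op_zero_iff plane_ring_def op_ring_def)
qed

lemma spectral_curve: "has_spectral_curve (spectral_ring g l d) curve_poly"
proof -
  let ?S = "op_ring (spectral_ring g l d)"
  interpret h: ring_hom_ring plane_ring ?S plane_op by (rule plane_op_ring_hom)
  have im: "plane_op ` carrier plane_ring = carrier ?S"
    using plane_op_surj by (simp add: plane_ring_def op_ring_def)
  define H where "H = (\<lambda>X. the_elem (plane_op ` X))"
  have H: "H \<in> ring_iso (curve_ring curve_poly) ?S"
    using h.FactRing_iso_set[OF im] by (simp add: H_def plane_op_kernel curve_ring_def)
  have "ideal (curve_ideal curve_poly) plane_ring" using h.kernel_is_ideal by (simp add: plane_op_kernel)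
  then have "ring (curve_ring curve_poly)" unfolding curve_ring_def by (rule ideal.quotient_is_ring)
  then have "inv_into (carrier (curve_ring curve_poly)) H \<in> ring_iso ?S (curve_ring curve_poly)"
    by (rule ring_iso_set_sym[OF _ H])
  moreover have "inv_into (carrier (curve_ring curve_poly)) H (scalar_op k) =
      a_r_coset plane_ring (curve_ideal curve_poly) [:[:k:]:]" for k
  proof -
    let ?C = "a_r_coset plane_ring (curve_ideal curve_poly) [:[:k:]:]"
    have "[:[:k:]:] \<in> carrier plane_ring" by (simp add: plane_ring_def)
    then have "H ?C = scalar_op k"
      using h.the_elem_simp[of "[:[:k:]:]"] by (simp add: H_def plane_op_kernel plane_op_scalar)
    moreover have "?C \<in> carrier (curve_ring curve_poly)"
      by (auto simp: curve_ring_def FactRing_def A_RCOSETS_def' plane_ring_def)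
    moreover have "inj_on H (carrier (curve_ring curve_poly))"
      using H by (auto simp: ring_iso_def bij_betw_def)
    ultimately show ?thesis by (metis inv_into_f_f)
  qed
  ultimately show ?thesis unfolding has_spectral_curve_def by blast
qed

section \<open>Rank 1, and comparison with the Darboux process\<close>

lemma rank_spectral_ring:
  assumes "symbol (diff_op {-1, 0, 1} a) joukowski" "\<And>n. a 1 n = 1"
  shows "op_rank diff_order (spectral_ring g l d) = 1"
proof -
  have "a 1 \<noteq> 0" using assms(2)[of 0] by auto
  then have "diff_order (diff_op {-1, 0, 1} a) 1"
    unfolding diff_order_def by (intro exI[of _ "{-1, 0, 1}"] exI[of _ a]) auto
  then have "1 \<in> {m. \<exists>L\<in>spectral_ring g l d. diff_order L m}"
    using assms(1) by (auto simp: spectral_ring_eq)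
  then have "Gcd {m. \<exists>L\<in>spectral_ring g l d. diff_order L m} dvd 1" by (rule Gcd_dvd)
  then show ?thesis
    using Gcd_int_greater_eq_0[of "{m. \<exists>L\<in>spectral_ring g l d. diff_order L m}"]
    by (simp add: op_rank_def)
qed

text \<open>Test on the sequences z^n: they are eigenfunctions of \<open>free_op\<close>,
  \<open>T\<close> turns them into the functions \<open>W\<close>, and they already determine an
  operator (the case P = 1 of faithfulness).\<close>

lemma symbol_intertwines:
  assumes "symbol L joukowski" shows "L \<circ> T = T \<circ> free_op"
proof -
  have free: "is_diff_op free_op"
    using nondegenerate_tridiagonal_free by (rule nondegenerate_tridiagonal_is_diff_op)
  have "(L \<circ> T) - (T \<circ> free_op) = 0"
  proof (rule diff_op_faithful[of _ bad "\<lambda>_. 1" 0])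
    show "is_diff_op ((L \<circ> T) - (T \<circ> free_op))"
      using assms is_diff_op_T free diff_op_closed(4,5) by (auto simp: symbol_def is_diff_op_eq)
    fix n z assume z: "z \<notin> bad"
    then have "z \<noteq> 0" using zero_bad by auto
    then have T: "T (\<lambda>n. z powi n) = (\<lambda>n. W n z)" using T_exp by auto
    have "free_op (\<lambda>n. z powi n) = (\<lambda>n. joukowski z * z powi n)"
      using \<open>z \<noteq> 0\<close> by (auto simp: free_op_def joukowski_def fun_eq_iff power_int_add power_int_diff field_simps)
    then have "T (free_op (\<lambda>n. z powi n)) n = joukowski z * W n z"
      using diff_op_scale[OF is_diff_op_T, of "joukowski z" "\<lambda>n. z powi n" n] T by simp
    then show "((L \<circ> T) - (T \<circ> free_op)) (\<lambda>m. z powi m * poly 1 z) n = 0"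
      using assms z by (simp add: T symbol_def)
  qed (use finite_bad zero_bad in auto)
  then show ?thesis by simp
qed

text \<open>\<open>T\<close> can be cancelled on the right, since its image contains the functions
  \<open>W n z\<close>, on which operators are faithful.\<close>

lemma intertwined_by_multiple:
  assumes L: "is_diff_op L" and M: "symbol M joukowski" and \<gamma>: "\<And>n. \<gamma> n \<noteq> 0"
    and comm: "L \<circ> (mult_op \<gamma> \<circ> T) = (mult_op \<gamma> \<circ> T) \<circ> free_op"
  shows "L = mult_op \<gamma> \<circ> M \<circ> mult_op (\<lambda>n. inverse (\<gamma> n))"
proof -
  have eq: "L \<circ> mult_op \<gamma> \<circ> T = mult_op \<gamma> \<circ> M \<circ> T"
    using comm symbol_intertwines[OF M] by (metis comp_assoc)
  have "(L \<circ> mult_op \<gamma>) - (mult_op \<gamma> \<circ> M) = 0"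
  proof (rule annihilates_W[of _ "{}"])
    show "is_diff_op ((L \<circ> mult_op \<gamma>) - (mult_op \<gamma> \<circ> M))"
      using L M is_diff_op_mult[of \<gamma>] unfolding symbol_def is_diff_op_eq
      by (intro seq_ops.is_opr_diff seq_ops.is_opr_compose) blast+
    fix n and z :: complex assume "z \<noteq> 0"
    then have T: "T (\<lambda>n. z powi n) = (\<lambda>n. W n z)" using T_exp by auto
    show "((L \<circ> mult_op \<gamma>) - (mult_op \<gamma> \<circ> M)) (\<lambda>m. W m z) n = 0"
      using fun_cong[OF fun_cong[OF eq, of "\<lambda>n. z powi n"], of n] by (simp add: T)
  qed simp
  then have *: "L \<circ> mult_op \<gamma> = mult_op \<gamma> \<circ> M" by simp
  have "mult_op \<gamma> \<circ> mult_op (\<lambda>n. inverse (\<gamma> n)) = id"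
    using \<gamma> by (auto simp: mult_op_def fun_eq_iff)
  then have "L = L \<circ> mult_op \<gamma> \<circ> mult_op (\<lambda>n. inverse (\<gamma> n))" by (metis comp_assoc comp_id)
  then show ?thesis using * by simp
qed

text \<open>Whatever the order of the points, the product of the factors kills the same states, so
  it is the monic \<open>T\<close> up to its leading coefficient. Scaling the factors
  \<open>Q\<close> on the left is thus the only freedom in the process, and it acts by
  conjugation.\<close>

lemma darboux_conjugate:
  assumes D: "darboux (map (\<lambda>i. (x i, \<phi> i)) js) L (forward_op g t)"
    and js: "distinct js" "set js = {..<g}" and M: "symbol M joukowski"
    and t: "\<And>n. t g n \<noteq> 0"
  shows "L = mult_op (t g) \<circ> M \<circ> mult_op (\<lambda>n. inverse (t g n))"
proof (rule intertwined_by_multiple[OF _ M t])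
  show "is_diff_op L" using darboux_invariants(2)[OF D]
    by (rule nondegenerate_tridiagonal_is_diff_op)
  have kill: "forward_op g t f n = 0" if "f \<in> set states" for f n
  proof -
    from that obtain j where "j < g" "f = \<phi> j" by auto
    then have "(x j, f) \<in> set (map (\<lambda>i. (x i, \<phi> i)) js)" using js by auto
    then show ?thesis using darboux_invariants(4)[OF D] by (metis zero_fun_apply)
  qed
  have "forward_op g c f n = 0" if "f \<in> set states" for f n
    using that c_annihilates by (auto simp: forward_op_def)
  then have tc: "t i n = t g n * c i n" if "i \<le> g" for i n
    using forward_op_unique[of states n g t c i] casorati_nonzero kill that by (simp add: c_top)
  have "forward_op g t = mult_op (t g) \<circ> T"
  proof (intro ext)
    fix h n
    have "forward_op g t h n = (\<Sum>i\<le>g. t g n * c i n * h (n + int i))"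
      unfolding forward_op_def
    proof (rule sum.cong[OF refl])
      fix i assume "i \<in> {..g}"
      then have "t i n = t g n * c i n" by (intro tc) simp
      then show "t i n * h (n + int i) = t g n * c i n * h (n + int i)" by (rule arg_cong)
    qed
    then show "forward_op g t h n = (mult_op (t g) \<circ> T) h n"
      by (simp add: mult_op_def T_def forward_op_def sum_distrib_left mult.assoc)
  qed
  then show "L \<circ> (mult_op (t g) \<circ> T) = mult_op (t g) \<circ> T \<circ> free_op"
    using darboux_invariants(1)[OF D] by simp
qed

lemma free_op_bound_state: "j < g \<Longrightarrow> free_op (\<phi> j) = scalar_op (joukowski (l j)) (\<phi> j)"
proof
  fix n assume j: "j < g"
  have *: "y powi (n + 1) + y powi (n - 1) = joukowski y * y powi n" if "y \<noteq> 0" for y :: complex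
    using that by (simp add: power_int_add power_int_diff joukowski_def divide_inverse distrib_left distrib_right mult_ac)
  have "free_op (\<phi> j) n = (l j powi (n + 1) + l j powi (n - 1)) -
      d j * (inverse (l j) powi (n + 1) + inverse (l j) powi (n - 1))"
    by (simp only: free_op_def bound_state_def distrib_left) simp
  also have "\<dots> = scalar_op (joukowski (l j)) (\<phi> j) n"
    using *[of "l j"] *[of "inverse (l j)"] l_nonzero[OF j]
    by (simp only: nonzero_imp_inverse_nonzero simp_thms joukowski_inverse)
      (simp add: scalar_op_def bound_state_def right_diff_distrib)
  finally show "free_op (\<phi> j) n = scalar_op (joukowski (l j)) (\<phi> j) n" .
qed

end

section \<open>Dilations and \<open>q\<close>-difference operators\<close>

lemma pcompose_dilation_nonzero: "c \<noteq> 0 \<Longrightarrow> p \<noteq> 0 \<Longrightarrow> pcompose p [:0, c:] \<noteq> (0 :: complex poly)"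
  using pcompose_eq_0[of p "[:0, c:]"] by auto

lemma dilate_to_fract: "c \<noteq> 0 \<Longrightarrow> dilate c (to_fract p) = to_fract (pcompose p [:0, c:])"
  by (simp add: to_fract_def dilate_Fract pcompose_1)

lemma dilate_add:
  assumes "c \<noteq> 0" shows "dilate c (x + y) = dilate c x + dilate c y"
proof (cases x rule: Fract_cases, cases y rule: Fract_cases)
  fix a b a' b' :: "complex poly"
  assume "x = Fract a b" "b \<noteq> 0" "y = Fract a' b'" "b' \<noteq> 0"
  then show ?thesis using assms
    by (simp add: dilate_Fract pcompose_dilation_nonzero pcompose_add pcompose_mult)
qed

lemma dilate_mult:
  assumes "c \<noteq> 0" shows "dilate c (x * y) = dilate c x * dilate c y"
proof (cases x rule: Fract_cases, cases y rule: Fract_cases)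
  fix a b a' b' :: "complex poly"
  assume "x = Fract a b" "b \<noteq> 0" "y = Fract a' b'" "b' \<noteq> 0"
  then show ?thesis using assms
    by (simp add: dilate_Fract pcompose_dilation_nonzero pcompose_mult)
qed

lemma dilate_dilate:
  assumes "c \<noteq> 0" "e \<noteq> 0" shows "dilate c (dilate e x) = dilate (c * e) x"
proof (cases x rule: Fract_cases)
  fix a b :: "complex poly"
  assume "x = Fract a b" "b \<noteq> 0"
  then show ?thesis using assms
    by (simp add: dilate_Fract pcompose_dilation_nonzero pcompose_assoc[symmetric] pcompose_pCons mult.commute)
qed

lemma dilate_1: "dilate 1 x = x"
  by (cases x rule: Fract_cases) (simp add: dilate_Fract pcompose_idR)

lemma comm_ring_hom_rat_const: "comm_ring_hom rat_const"
proof
  show "rat_const (x * y) = rat_const x * rat_const y" for x y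
    unfolding rat_const_def to_fract_mult[symmetric] by simp
  show "rat_const (x + y) = rat_const x + rat_const y" for x y
    unfolding rat_const_def to_fract_add[symmetric] by simp
qed (auto simp: rat_const_def one_pCons[symmetric])

interpretation rat_const: comm_ring_hom rat_const by (rule comm_ring_hom_rat_const)

lemma rat_const_eq_0_iff [simp]: "rat_const c = 0 \<longleftrightarrow> c = 0"
  by (simp add: rat_const_def)

lemma rat_const_diff: "rat_const (x - y) = rat_const x - rat_const y"
  by (rule rat_const.hom_minus)

lemma rat_const_inverse: "rat_const (inverse c) = inverse (rat_const c)"
proof (cases "c = 0")
  case False
  then have "rat_const c * rat_const (inverse c) = 1"
    unfolding rat_const.hom_mult[symmetric] by simp
  then show ?thesis by (simp add: inverse_unique)
qed simp

lemma rat_const_powi: "rat_const (c powi n) = rat_const c powi n"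
  by (simp add: power_int_def rat_const.hom_power rat_const_inverse)

lemma rat_z_nonzero [simp]: "rat_z \<noteq> 0"
  by (simp add: rat_z_def)

lemma to_fract_eq_sum: "to_fract p = (\<Sum>i\<le>degree p. rat_const (coeff p i) * rat_z ^ i)"
proof (induction p)
  case (pCons a p)
  have *: "to_fract (pCons a p) = rat_const a + rat_z * to_fract p"
    unfolding rat_const_def rat_z_def to_fract_mult[symmetric] to_fract_add[symmetric] by simp
  show ?case
  proof (cases "p = 0")
    case False
    then have "(\<Sum>i\<le>degree (pCons a p). rat_const (coeff (pCons a p) i) * rat_z ^ i) =
        rat_const a + rat_z * (\<Sum>i\<le>degree p. rat_const (coeff p i) * rat_z ^ i)"
      by (simp add: sum.atMost_Suc_shift sum_distrib_left mult_ac del: sum.atMost_Suc)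
    then show ?thesis using * pCons.IH by simp
  qed (use * in simp)
qed simp

lemma to_fract_eq_sum': "degree p \<le> n \<Longrightarrow> to_fract p = (\<Sum>i\<le>n. rat_const (coeff p i) * rat_z ^ i)"
  unfolding to_fract_eq_sum by (rule sum.mono_neutral_left) (auto simp: coeff_eq_0)

lemma dilate_rat_const: "c \<noteq> 0 \<Longrightarrow> dilate c (rat_const a) = rat_const a"
  by (simp add: rat_const_def dilate_to_fract)

lemma dilate_rat_z: "c \<noteq> 0 \<Longrightarrow> dilate c rat_z = rat_const c * rat_z"
  unfolding rat_z_def rat_const_def to_fract_mult[symmetric]
  by (simp add: dilate_to_fract pcompose_pCons)

lemma dilate_power: "c \<noteq> 0 \<Longrightarrow> dilate c (x ^ n) = dilate c x ^ n"
  using dilate_rat_const[of c 1] by (induction n) (simp_all add: dilate_mult)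

lemma dilate_inverse: "c \<noteq> 0 \<Longrightarrow> dilate c (inverse x) = inverse (dilate c x)"
proof (cases "x = 0")
  case True
  then show "c \<noteq> 0 \<Longrightarrow> ?thesis" using dilate_rat_const[of c 0] by simp
next
  case False
  assume c: "c \<noteq> 0"
  have "dilate c x * dilate c (inverse x) = 1"
    using dilate_mult[OF c, of x "inverse x"] False dilate_rat_const[OF c, of 1] by simp
  then show ?thesis by (simp add: inverse_unique)
qed

lemma dilate_powi: "c \<noteq> 0 \<Longrightarrow> dilate c (x powi n) = dilate c x powi n"
  by (simp add: power_int_def dilate_power dilate_inverse)

lemma dilate_rat_z_powi: "c \<noteq> 0 \<Longrightarrow> dilate c (rat_z powi n) = rat_const (c powi n) * rat_z powi n"
  by (simp add: dilate_powi dilate_rat_z power_int_mult_distrib rat_const_powi)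

text \<open>Clear denominators and evaluate at the pole \<open>c i\<close>. This serves to show that
  the operator Y is not zero.\<close>

lemma partial_fractions_independent:
  assumes J: "finite J" "inj_on c J" and z: "(\<Sum>j\<in>J. rat_const (\<beta> j) / (rat_z - rat_const (c j))) = 0"
    and i: "i \<in> J"
  shows "\<beta> i = 0"
proof -
  have lin: "rat_z - rat_const (c j) = to_fract [:- c j, 1:]" for j
    unfolding rat_z_def rat_const_def to_fract_diff[symmetric] by simp
  define R where "R j = (\<Prod>m\<in>J - {j}. [:- c m, 1:])" for j
  have prod: "[:- c j, 1:] * R j = (\<Prod>m\<in>J. [:- c m, 1:])" if "j \<in> J" for j
    unfolding R_def using J that by (simp only: prod.remove[of J j])
  have "to_fract (\<Sum>j\<in>J. Polynomial.smult (\<beta> j) (R j)) =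
      (\<Sum>j\<in>J. rat_const (\<beta> j) * to_fract (R j))"
    by (simp add: to_fract_sum rat_const_def to_fract_mult[symmetric] del: to_fract_mult)
  also have "\<dots> = (\<Sum>j\<in>J. rat_const (\<beta> j) / (rat_z - rat_const (c j)) * to_fract (\<Prod>m\<in>J. [:- c m, 1:]))"
  proof (rule sum.cong)
    fix j assume "j \<in> J"
    have "to_fract [:- c j, 1:] \<noteq> 0" by simp
    then show "rat_const (\<beta> j) * to_fract (R j) =
        rat_const (\<beta> j) / (rat_z - rat_const (c j)) * to_fract (\<Prod>m\<in>J. [:- c m, 1:])"
      unfolding prod[OF \<open>j \<in> J\<close>, symmetric] lin to_fract_mult by simp
  qed simp
  also have "\<dots> = 0" unfolding sum_distrib_right[symmetric] z by simp
  finally have "(\<Sum>j\<in>J. Polynomial.smult (\<beta> j) (R j)) = 0" by (simp only: to_fract_eq_0_iff)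
  then have "poly (\<Sum>j\<in>J. Polynomial.smult (\<beta> j) (R j)) (c i) = 0" by simp
  moreover have "poly (\<Sum>j\<in>J. Polynomial.smult (\<beta> j) (R j)) (c i) = (\<Sum>j\<in>J. if j = i then \<beta> i * poly (R i) (c i) else 0)"
    unfolding poly_sum
  proof (rule sum.cong)
    fix j assume "j \<in> J"
    show "poly (Polynomial.smult (\<beta> j) (R j)) (c i) = (if j = i then \<beta> i * poly (R i) (c i) else 0)"
      using J i by (auto simp: R_def poly_prod)
  qed simp
  moreover have "poly (R i) (c i) \<noteq> 0" using J i by (auto simp: R_def poly_prod inj_on_def)
  ultimately show ?thesis using J i by simp
qed

locale qdiff =
  fixes q :: real
  assumes q: "0 < q" "q < 1"
begin

abbreviation dil :: "int \<Rightarrow> ratfun \<Rightarrow> ratfun" where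
  "dil j \<equiv> dilate (of_real q powi j)"

lemma qj_nonzero: "(of_real q :: complex) powi j \<noteq> 0"
  using q by simp

sublocale int_action dil
  using q by unfold_locales
    (simp_all add: dilate_add dilate_mult dilate_dilate dilate_1 power_int_add)

lemma qdiff_op_eq: "qdiff_op q = opr"
  by (intro ext) (simp add: qdiff_op_def opr_def)

lemma is_qdiff_op_eq: "is_qdiff_op q = is_opr"
  by (intro ext) (simp add: is_qdiff_op_def is_opr_def qdiff_op_eq)

lemma dil_eq_0_iff: "dil j x = 0 \<longleftrightarrow> x = 0"
proof
  assume "dil j x = 0"
  then have "dil (- j) (dil j x) = 0" by simp
  then show "x = 0" unfolding s_comp by (simp add: dilate_1)
qed simp

lemma qdiff_order_imp: "qdiff_order q B m \<Longrightarrow> is_opr B"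
  by (auto simp: qdiff_order_def is_opr_def qdiff_op_eq)

lemma qdiff_order_monomial: "b \<noteq> 0 \<Longrightarrow> qdiff_order q (\<lambda>h. b * dil j h) j"
  unfolding qdiff_order_def qdiff_op_eq
  by (rule exI[of _ "{j}"], rule exI[of _ "\<lambda>_. b"]) (auto simp: opr_def)

lemma qdiff_order_mult: "b \<noteq> 0 \<Longrightarrow> qdiff_order q (\<lambda>h. b * h) 0"
  using qdiff_order_monomial[of b 0] by (simp add: dilate_1)

lemma ex_qdiff_order:
  assumes "finite S" "j \<in> S" "a j \<noteq> 0"
  shows "\<exists>m. qdiff_order q (opr S a) m"
proof -
  define S' where "S' = {i \<in> S. a i \<noteq> 0}"
  have S': "finite S'" "S' \<noteq> {}" using assms by (auto simp: S'_def)
  have "opr S a = opr S' a"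
    unfolding opr_def S'_def using assms(1) by (intro ext sum.mono_neutral_right) auto
  moreover have "Max S' \<in> S'" "\<forall>i\<in>S'. i \<le> Max S'" using S' by auto
  moreover have "a (Max S') \<noteq> 0" using \<open>Max S' \<in> S'\<close> by (auto simp: S'_def)
  ultimately show ?thesis unfolding qdiff_order_def qdiff_op_eq using S'(1) by blast
qed

text \<open>The leading coefficient \<open>a m * dil m (b m')\<close> is nonzero because dilations
  are injective and the coefficients lie in a field.\<close>

lemma qdiff_order_compose:
  assumes "qdiff_order q B m" "qdiff_order q C m'"
  shows "qdiff_order q (B \<circ> C) (m + m')"
proof -
  obtain S a where S: "finite S" "m \<in> S" "\<forall>j\<in>S. j \<le> m" "a m \<noteq> 0" "B = opr S a"
    using assms(1) unfolding qdiff_order_def qdiff_op_eq by blast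
  obtain S' b where S': "finite S'" "m' \<in> S'" "\<forall>j\<in>S'. j \<le> m'" "b m' \<noteq> 0" "C = opr S' b"
    using assms(2) unfolding qdiff_order_def qdiff_op_eq by blast
  define U where "U = (\<lambda>(i, j). i + j) ` (S \<times> S')"
  define D where "D k = (\<Sum>(i, j)\<in>{p \<in> S \<times> S'. (case p of (i, j) \<Rightarrow> i + j) = k}. a i * dil i (b j))" for k
  have U: "finite U" "m + m' \<in> U" "\<forall>k\<in>U. k \<le> m + m'"
    using S S' by (force simp: U_def add_mono)+
  have "{p \<in> S \<times> S'. (case p of (i, j) \<Rightarrow> i + j) = m + m'} = {(m, m')}"
    using S(2,3) S'(2,3) by force
  then have "D (m + m') = a m * dil m (b m')" by (simp add: D_def)
  then have D0: "D (m + m') \<noteq> 0" using S(4) S'(4) dil_eq_0_iff by simp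
  have "B \<circ> C = opr U D"
  proof
    fix h
    have "(B \<circ> C) h = (\<Sum>(i, j)\<in>S \<times> S'. (a i * dil i (b j)) * dil (i + j) h)"
      unfolding S(5) S'(5) opr_compose_eq by (simp add: sum.cartesian_product)
    also have "\<dots> = (\<Sum>k\<in>U. \<Sum>(i, j)\<in>{p \<in> S \<times> S'. (case p of (i, j) \<Rightarrow> i + j) = k}. (a i * dil i (b j)) * dil (i + j) h)"
      by (rule sum.group[symmetric]) (use S(1) S'(1) U(1) in \<open>auto simp: U_def\<close>)
    also have "\<dots> = (\<Sum>k\<in>U. D k * dil k h)"
      unfolding D_def sum_distrib_right by (intro sum.cong) auto
    finally show "(B \<circ> C) h = opr U D h" by (simp add: opr_def)
  qed
  then show ?thesis unfolding qdiff_order_def qdiff_op_eq using U D0 by blast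
qed

lemma opr_scale: "is_opr B \<Longrightarrow> B (rat_const c * h) = rat_const c * B h"
  by (auto simp: is_opr_def opr_def s_mult dilate_rat_const[OF qj_nonzero] sum_distrib_left mult.left_commute)

lemma opr_sum:
  assumes "is_opr B" shows "B (\<Sum>i\<in>A. f i) = (\<Sum>i\<in>A. B (f i))"
proof -
  have "B 0 = 0" using assms by (auto simp: is_opr_def opr_def)
  then show ?thesis
    using opr_additive[OF assms] by (induction A rule: infinite_finite_induct) simp_all
qed

end

section \<open>The ring of \<open>q\<close>-difference operators\<close>

lemma power_powi_swap: "((y :: complex) ^ e) powi n = (y powi n) ^ e"
  by (metis mult.commute power_int_mult power_int_of_nat)

lemma sum_two_point:
  fixes F :: "nat \<Rightarrow> 'r::comm_ring_1"
  assumes "i \<le> N" "i' \<le> N"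
  shows "(\<Sum>a\<le>N. (u * (if i = a then 1 else 0) - w * (if i' = a then 1 else 0)) * F a) = u * F i - w * F i'"
proof -
  have "(\<Sum>a\<le>N. (u * (if i = a then 1 else 0) - w * (if i' = a then 1 else 0)) * F a) =
      (\<Sum>a\<le>N. (if i = a then u * F a else 0) - (if i' = a then w * F a else 0))"
    by (intro sum.cong) (auto simp: left_diff_distrib)
  then show ?thesis using assms by (simp add: sum_subtractf)
qed

lemma coeff_sum_monom: "coeff (\<Sum>i\<le>g. monom (f i) i) m = (if m \<le> g then f m else 0)"
  by (simp add: coeff_sum if_distrib cong: if_cong)

lemma degree_sum_monom: "degree (\<Sum>i\<le>g. monom (f i) i) \<le> g"
  by (rule degree_le) (simp add: coeff_sum_monom)

lemma to_fract_sum_monom: "to_fract (\<Sum>i\<le>g. monom (f i) i) = (\<Sum>i\<le>g. rat_const (f i) * rat_z ^ i)"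
  unfolding to_fract_eq_sum'[OF degree_sum_monom] by (intro sum.cong) (auto simp: coeff_sum_monom)

lemma to_fract_smult: "to_fract (Polynomial.smult a p) = rat_const a * to_fract p"
  unfolding rat_const_def to_fract_mult[symmetric] by simp

lemma rat_z_minus_const: "rat_z - rat_const a = to_fract [:- a, 1:]" "rat_z - rat_const a \<noteq> 0"
proof -
  show *: "rat_z - rat_const a = to_fract [:- a, 1:]"
    unfolding rat_z_def rat_const_def to_fract_diff[symmetric] by simp
  show "rat_z - rat_const a \<noteq> 0" unfolding * by simp
qed

text \<open>The geometric sum for (z^s - a^s) / (z - a), applied termwise. The explicit quotient
  shows which power of the root accompanies which power of z.\<close>

lemma divide_linear_at_root:
  assumes "(\<Sum>s\<le>g. v s * a ^ s) = 0"
  shows "(\<Sum>s\<le>g. rat_const (v s) * rat_z ^ s) / (rat_z - rat_const a) =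
    (\<Sum>s\<le>g. \<Sum>r<s. rat_const (v s * a ^ (s - Suc r)) * rat_z ^ r)"
proof -
  have "(\<Sum>s\<le>g. rat_const (v s) * rat_const a ^ s) = rat_const (\<Sum>s\<le>g. v s * a ^ s)"
    by (simp add: rat_const.hom_sum rat_const.hom_mult rat_const.hom_power)
  then have "(\<Sum>s\<le>g. rat_const (v s) * rat_z ^ s) = (\<Sum>s\<le>g. rat_const (v s) * (rat_z ^ s - rat_const a ^ s))"
    using assms by (simp add: right_diff_distrib sum_subtractf)
  also have "\<dots> = (rat_z - rat_const a) * (\<Sum>s\<le>g. \<Sum>r<s. rat_const (v s * a ^ (s - Suc r)) * rat_z ^ r)"
    unfolding power_diff_sumr2
    by (simp add: sum_distrib_left rat_const.hom_mult rat_const.hom_power mult_ac)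
  finally show ?thesis using rat_z_minus_const(2)[of a] by simp
qed

locale q_bound_states = bound_states g l d + qdiff q for g l d q +
  fixes k :: "nat \<Rightarrow> nat"
  assumes k_pos: "j < g \<Longrightarrow> k j > 0"
    and l_squared: "j < g \<Longrightarrow> (l j)\<^sup>2 = of_real q ^ k j"
begin

abbreviation Q :: complex where "Q \<equiv> of_real q"

lemma dil_rat_z_powi: "dil (int e) (rat_z powi n) = rat_const ((Q powi n) ^ e) * rat_z powi n"
  using dilate_rat_z_powi[OF qj_nonzero, of "int e" n] by (simp add: power_powi_swap)

lemma l_powi_squared: "j < g \<Longrightarrow> l j powi n * l j powi n = (Q powi n) ^ k j"
  using power_powi_swap[of Q "k j" n] power_powi_swap[of "l j" 2 n] l_squared[of j]
  by (simp add: power2_eq_square)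

section \<open>Operators between the monomials and the numerators of the wave function\<close>

definition K :: nat where "K = (\<Sum>j<g. k j)"

lemma k_le_K: "j < g \<Longrightarrow> k j \<le> K"
  unfolding K_def by (rule member_le_sum) auto

definition wave_num :: "int \<Rightarrow> ratfun" where
  "wave_num n = rat_z powi n * to_fract (P n)"

definition wave_denom :: ratfun where
  "wave_denom = (\<Prod>j<g. rat_z - rat_const (l j))"

lemma wave_denom_nonzero: "wave_denom \<noteq> 0"
  using rat_z_minus_const(2) by (simp add: wave_denom_def)

lemma wave_rat_const: "wave rat_const g l d n rat_z = wave_num n / wave_denom"
proof -
  have "(\<Sum>i\<le>g. rat_const (c i n) * rat_z ^ i) = to_fract (P n)"
    unfolding P_def by (rule to_fract_sum_monom[symmetric])
  then show ?thesis
    using wave_eq[OF comm_ring_hom_rat_const, of n rat_z] casorati_nonzero[of n]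
    by (simp add: wave_num_def wave_denom_def)
qed

lemma wave_num_eq: "wave_num n = (\<Sum>s\<le>g. rat_const (c s n) * rat_z powi (n + int s))"
  unfolding wave_num_def P_def to_fract_sum_monom sum_distrib_left
  by (intro sum.cong) (simp_all add: power_int_add mult_ac)

text \<open>Multiplied by \<open>\<lambda>\<^sub>j\<^sup>n\<close>, the conditions that characterise the coefficients of \<open>P n\<close> become
  polynomial in \<open>q\<^sup>n\<close> since \<open>\<lambda>\<^sub>j\<^sup>2\<^sup>n = (q\<^sup>n)\<^sup>k\<^sup>j\<close>. Counting unknowns gives a polynomial solution, and
  replacing \<open>q\<^sup>n\<close> by the dilation turns it into an operator.\<close>

lemma ex_raising_op:
  "\<exists>X m \<theta>. qdiff_order q X m \<and> (\<forall>n. X (rat_z powi n) = rat_const (\<theta> n) * wave_num n)"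
proof -
  \<comment> \<open>With powers of q^n up to E there are (g + 1) (E + 1) unknowns and g (E + K + 1)
    equations; E = g K leaves exactly one more unknown than equations.\<close>
  define E where "E = g * K"
  define A where "A = {..g} \<times> {..E}"
  \<comment> \<open>The contribution of the unknown (i, e), which stands for (q^n)^e z^i, to the
    coefficient of (q^n)^a in the j-th condition.\<close>
  define M where "M = (\<lambda>(j, a) (i, e). l j ^ i * (if e + k j = a then 1 else 0) -
     d j * inverse (l j) ^ i * (if e = a then 1 else 0))"
  have "card ({..<g} \<times> {..E + K}) < card A"
    by (simp add: A_def E_def card_cartesian_product algebra_simps)
  then have "\<exists>\<xi>. (\<exists>p\<in>A. \<xi> p \<noteq> 0) \<and> (\<forall>b\<in>{..<g} \<times> {..E + K}. (\<Sum>p\<in>A. M b p * \<xi> p) = 0)"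
    by (intro underdetermined_solution) (auto simp: A_def)
  then obtain \<xi> where \<xi>: "\<exists>p\<in>A. \<xi> p \<noteq> 0"
    "\<And>j a. j < g \<Longrightarrow> a \<le> E + K \<Longrightarrow> (\<Sum>p\<in>A. M (j, a) p * \<xi> p) = 0" by auto
  define m where "m i n = (\<Sum>e\<le>E. \<xi> (i, e) * (Q powi n) ^ e)" for i n
  define G where "G n = (\<Sum>i\<le>g. monom (m i n) i)" for n
  have "gluing n (G n)" for n
    unfolding gluing_def
  proof (intro allI impI)
    fix j assume j: "j < g"
    define x where "x = Q powi n"
    have poly_G: "poly (G n) y = (\<Sum>p\<in>A. case p of (i, e) \<Rightarrow> \<xi> p * (x ^ e * y ^ i))" for y
    proof -
      have "poly (G n) y = (\<Sum>i\<le>g. \<Sum>e\<le>E. \<xi> (i, e) * (x ^ e * y ^ i))"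
        by (simp add: G_def poly_sum poly_monom m_def x_def sum_distrib_right) (simp add: mult_ac)
      then show ?thesis unfolding A_def sum.cartesian_product by (simp add: case_prod_beta)
    qed
    have "x ^ k j * poly (G n) (l j) - d j * poly (G n) (inverse (l j)) =
        (\<Sum>p\<in>A. \<xi> p * (\<Sum>a\<le>E + K. M (j, a) p * x ^ a))"
      unfolding poly_G sum_distrib_left[of "x ^ k j"] sum_distrib_left[of "d j"] sum_subtractf[symmetric]
    proof (rule sum.cong)
      fix p assume "p \<in> A"
      then obtain i e where p: "p = (i, e)" "e \<le> E" by (auto simp: A_def)
      then have *: "(\<Sum>a\<le>E + K. M (j, a) p * x ^ a) = l j ^ i * x ^ (e + k j) - d j * inverse (l j) ^ i * x ^ e"
        using k_le_K[OF j] sum_two_point[of "e + k j" "E + K" e "l j ^ i" "d j * inverse (l j) ^ i" "\<lambda>a. x ^ a"]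
        by (simp add: M_def)
      show "x ^ k j * (case p of (i, e) \<Rightarrow> \<xi> p * (x ^ e * l j ^ i)) -
          d j * (case p of (i, e) \<Rightarrow> \<xi> p * (x ^ e * inverse (l j) ^ i)) =
          \<xi> p * (\<Sum>a\<le>E + K. M (j, a) p * x ^ a)"
        unfolding * by (simp add: p power_add algebra_simps)
    qed simp
    also have "\<dots> = (\<Sum>a\<le>E + K. x ^ a * (\<Sum>p\<in>A. M (j, a) p * \<xi> p))"
      unfolding sum_distrib_left by (subst sum.swap) (simp add: mult_ac)
    also have "\<dots> = 0" using \<xi>(2)[OF j] by simp
    finally have eq: "x ^ k j * poly (G n) (l j) = d j * poly (G n) (inverse (l j))" by simp
    have "l j powi n * (l j powi n * poly (G n) (l j)) = x ^ k j * poly (G n) (l j)"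
      using l_powi_squared[OF j, of n] by (simp add: x_def mult.assoc[symmetric])
    also have "\<dots> = l j powi n * (d j * inverse (l j) powi n * poly (G n) (inverse (l j)))"
      using l_nonzero[OF j] by (simp add: eq power_int_inverse)
    finally show "l j powi n * poly (G n) (l j) = d j * inverse (l j) powi n * poly (G n) (inverse (l j))"
      using l_nonzero[OF j] by simp
  qed
  \<comment> \<open>\<open>m g n\<close> may vanish for some n; then X merely sends z^n to
    0.\<close>
  then have G: "G n = Polynomial.smult (m g n) (P n)" for n
    using gluing_unique[of n "G n"] degree_sum_monom[of "\<lambda>i. m i n" g] by (simp add: G_def coeff_sum_monom)
  define B where "B e = (\<Sum>i\<le>g. rat_const (\<xi> (i, e)) * rat_z ^ i)" for e
  define X where "X = opr (int ` {..E}) (\<lambda>j. B (nat j))"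
  have X_eq: "X h = (\<Sum>e\<le>E. B e * dil (int e) h)" for h
    unfolding X_def opr_def by (subst sum.reindex) (auto simp: inj_on_def)
  have "X (rat_z powi n) = rat_const (m g n) * wave_num n" for n
  proof -
    have "X (rat_z powi n) = (\<Sum>e\<le>E. \<Sum>i\<le>g. rat_z powi n * (rat_const (\<xi> (i, e) * (Q powi n) ^ e) * rat_z ^ i))"
      unfolding X_eq B_def dil_rat_z_powi sum_distrib_right rat_const.hom_mult by (simp only: mult_ac)
    also have "\<dots> = rat_z powi n * (\<Sum>i\<le>g. rat_const (m i n) * rat_z ^ i)"
      unfolding m_def rat_const.hom_sum sum_distrib_left sum_distrib_right by (rule sum.swap)
    also have "(\<Sum>i\<le>g. rat_const (m i n) * rat_z ^ i) = to_fract (G n)"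
      unfolding G_def by (rule to_fract_sum_monom[symmetric])
    finally show ?thesis by (simp add: G to_fract_smult wave_num_def mult_ac)
  qed
  moreover have "\<exists>r. qdiff_order q X r"
  proof -
    obtain i e where ie: "i \<le> g" "e \<le> E" "\<xi> (i, e) \<noteq> 0" using \<xi>(1) by (auto simp: A_def)
    have "coeff (\<Sum>i\<le>g. monom (\<xi> (i, e)) i) i \<noteq> 0" using ie by (simp add: coeff_sum_monom)
    then have "(\<Sum>i\<le>g. monom (\<xi> (i, e)) i) \<noteq> 0" by (metis coeff_0)
    then have "B e \<noteq> 0" unfolding B_def to_fract_sum_monom[symmetric] by (simp only: to_fract_eq_0_iff simp_thms)
    then show ?thesis unfolding X_def using ie(2) by (intro ex_qdiff_order[of _ "int e"]) auto
  qed
  ultimately show ?thesis by blast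
qed

text \<open>At \<open>z = q\<^sup>-\<^sup>i \<lambda>\<^sub>j\<^sup>-\<^sup>1\<close> the operator \<open>D\<^sup>i\<^sup>+\<^sup>k\<^sup>j - \<delta>\<^sub>j D\<^sup>i\<close> evaluates a function at \<open>\<lambda>\<^sub>j\<close> and \<open>\<lambda>\<^sub>j\<^sup>-\<^sup>1\<close>, so
  that its value on the numerator of \<open>\<Psi>\<close> vanishes there and the quotient by \<open>z - q\<^sup>-\<^sup>i \<lambda>\<^sub>j\<^sup>-\<^sup>1\<close> is again
  \<open>z\<^sup>n\<close> times a polynomial. The coefficients of a combination of these operators are
  chosen so that all terms of positive degree of this polynomial cancel.\<close>

lemma ex_lowering_op:
  "\<exists>Y m \<theta>. qdiff_order q Y m \<and> (\<forall>n. Y (wave_num n) = rat_const (\<theta> n) * rat_z powi n)"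
proof (cases "g = 0")
  case True
  have "wave_num n = rat_z powi n" for n
  proof -
    have *: "{..g} = {g}" "int g = 0" using True by auto
    have "wave_num n = rat_const (c g n) * rat_z powi (n + int g)" unfolding wave_num_eq *(1) by simp
    then show ?thesis by (simp only: c_top *(2) rat_const.hom_one mult_1 add_0_right)
  qed
  then show ?thesis
    by (intro exI[of _ "\<lambda>h. 1 * h"] exI[of _ 0] exI[of _ "\<lambda>_. 1"] conjI qdiff_order_mult) auto
next
  case False
  \<comment> \<open>There are g (N + 1) unknowns and (N + K + 1) (g - 1) conditions; N = g K leaves
    K + 1 unknowns to spare.\<close>
  define N where "N = g * K"
  define A where "A = {..<g} \<times> {..N}"
  define y where "y = (\<lambda>(j, i). inverse (Q ^ i * l j))"
  \<comment> \<open>The coefficient of x^a in y^t u(x), where u(x) is the factor by which D^(i +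
    k_j) - d_j D^i multiplies a monomial whose eigenvalue under D is x, and y^t will stem from the
    division by z - y.\<close>
  define M where "M = (\<lambda>(a::nat, t::nat) p. case p of (j, i) \<Rightarrow>
     y p ^ t * (1 * (if i + k j = a then 1 else 0) - d j * (if i = a then 1 else 0)))"
  have "(N + K + 1) * (g - 1) < g * (N + 1)"
  proof -
    obtain g' where "g = Suc g'" using False by (cases g) auto
    then show ?thesis by (simp add: N_def algebra_simps)
  qed
  then have "card ({..N + K} \<times> {..<g - 1}) < card A"
    by (simp add: A_def card_cartesian_product)
  then have "\<exists>\<eta>. (\<exists>p\<in>A. \<eta> p \<noteq> 0) \<and> (\<forall>b\<in>{..N + K} \<times> {..<g - 1}. (\<Sum>p\<in>A. M b p * \<eta> p) = 0)"
    by (intro underdetermined_solution) (auto simp: A_def)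
  then obtain \<eta> where \<eta>: "\<exists>p\<in>A. \<eta> p \<noteq> 0"
    "\<And>a t. a \<le> N + K \<Longrightarrow> t < g - 1 \<Longrightarrow> (\<Sum>p\<in>A. M (a, t) p * \<eta> p) = 0" by auto
  define u where "u x = (\<lambda>(j, i). (x::complex) ^ (i + k j) - d j * x ^ i)" for x
  have u_sum: "y p ^ t * u x p = (\<Sum>a\<le>N + K. M (a, t) p * x ^ a)" if "p \<in> A" for p t x
  proof -
    from that obtain j i where p: "p = (j, i)" "j < g" "i \<le> N" by (auto simp: A_def)
    have "(\<Sum>a\<le>N + K. M (a, t) p * x ^ a) =
        y p ^ t * (\<Sum>a\<le>N + K. (1 * (if i + k j = a then 1 else 0) - d j * (if i = a then 1 else 0)) * x ^ a)"
      unfolding sum_distrib_left by (simp add: M_def p mult.assoc)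
    also have "\<dots> = y p ^ t * u x p"
      using sum_two_point[of "i + k j" "N + K" i 1 "d j" "\<lambda>a. x ^ a"] k_le_K[OF p(2)] p by (simp add: u_def)
    finally show ?thesis by simp
  qed
  define V where "V x t = (\<Sum>p\<in>A. \<eta> p * (y p ^ t * u x p))" for x t
  \<comment> \<open>The vanishing must hold identically in x, because the monomials z^(n + s) of one
    numerator have different eigenvalues q^(n + s).\<close>
  have V0: "V x t = 0" if "t < g - 1" for x t
  proof -
    have "V x t = (\<Sum>p\<in>A. \<Sum>a\<le>N + K. x ^ a * (M (a, t) p * \<eta> p))"
      unfolding V_def by (rule sum.cong[OF refl], subst u_sum, assumption) (simp add: sum_distrib_left mult_ac)
    also have "\<dots> = (\<Sum>a\<le>N + K. x ^ a * (\<Sum>p\<in>A. M (a, t) p * \<eta> p))"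
      unfolding sum_distrib_left by (rule sum.swap)
    finally show ?thesis using \<eta>(2) that by simp
  qed
  define B where "B a = (\<Sum>p\<in>A. rat_const (\<eta> p) / (rat_z - rat_const (y p)) * rat_const (M (a, 0) p))" for a
  define Y where "Y = opr (int ` {..N + K}) (\<lambda>j. B (nat j))"
  have Y_eq: "Y h = (\<Sum>p\<in>A. rat_const (\<eta> p) / (rat_z - rat_const (y p)) *
      (case p of (j, i) \<Rightarrow> dil (int (i + k j)) h - rat_const (d j) * dil (int i) h))" for h
  proof -
    have "Y h = (\<Sum>a\<le>N + K. B a * dil (int a) h)"
      unfolding Y_def opr_def by (subst sum.reindex) (auto simp: inj_on_def)
    also have "\<dots> = (\<Sum>p\<in>A. rat_const (\<eta> p) / (rat_z - rat_const (y p)) *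
        (\<Sum>a\<le>N + K. rat_const (M (a, 0) p) * dil (int a) h))"
      unfolding B_def sum_distrib_right sum_distrib_left by (subst sum.swap) (simp add: mult_ac)
    also have "\<dots> = (\<Sum>p\<in>A. rat_const (\<eta> p) / (rat_z - rat_const (y p)) *
      (case p of (j, i) \<Rightarrow> dil (int (i + k j)) h - rat_const (d j) * dil (int i) h))"
    proof (rule sum.cong)
      fix p assume "p \<in> A"
      then obtain j i where p: "p = (j, i)" "j < g" "i \<le> N" by (auto simp: A_def)
      have "rat_const (M (a, 0) p) = 1 * (if i + k j = a then 1 else 0) - rat_const (d j) * (if i = a then 1 else 0)" for a
        by (simp add: M_def p rat_const_diff)
      then have "(\<Sum>a\<le>N + K. rat_const (M (a, 0) p) * dil (int a) h) =
          dil (int (i + k j)) h - rat_const (d j) * dil (int i) h"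
        using sum_two_point[of "i + k j" "N + K" i 1 "rat_const (d j)" "\<lambda>a. dil (int a) h"] k_le_K[OF p(2)] p
        by (simp only: mult_1 add_mono trans_le_add1)
      then show "rat_const (\<eta> p) / (rat_z - rat_const (y p)) * (\<Sum>a\<le>N + K. rat_const (M (a, 0) p) * dil (int a) h) =
          rat_const (\<eta> p) / (rat_z - rat_const (y p)) *
          (case p of (j, i) \<Rightarrow> dil (int (i + k j)) h - rat_const (d j) * dil (int i) h)"
        by (simp only: p prod.case)
    qed simp
    finally show ?thesis .
  qed
  have "Y (wave_num n) = rat_const (V (Q powi (n + int g)) (g - 1)) * rat_z powi n" for n
  proof -
    define x where "x s = Q powi (n + int s)" for s
    have dil_num: "dil (int e) (wave_num n) = rat_z powi n * (\<Sum>s\<le>g. rat_const (c s n * x s ^ e) * rat_z ^ s)" for e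
    proof -
      have "dil (int e) (wave_num n) = (\<Sum>s\<le>g. rat_const (c s n) * dil (int e) (rat_z powi (n + int s)))"
        unfolding wave_num_eq by (simp only: s_sum s_mult dilate_rat_const[OF qj_nonzero])
      also have "\<dots> = (\<Sum>s\<le>g. rat_const (c s n) * (rat_const (x s ^ e) * rat_z powi (n + int s)))"
        by (simp only: dil_rat_z_powi x_def)
      finally show ?thesis
        by (simp add: power_int_add rat_const.hom_mult sum_distrib_left mult_ac)
    qed
    have root: "(\<Sum>s\<le>g. (c s n * u (x s) p) * y p ^ s) = 0" if "p \<in> A" for p
    proof -
      from that obtain j i where p: "p = (j, i)" "j < g" "i \<le> N" by (auto simp: A_def)
      have nz: "Q \<noteq> 0" "l j \<noteq> 0" using q l_nonzero[OF p(2)] by auto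
      have lQ: "Q ^ k j * inverse (l j) = l j"
        using nz l_squared[OF p(2)] by (simp add: power2_eq_square[of "l j"] flip: l_squared[OF p(2)])
      have xs: "x s ^ e * y p ^ s = (Q powi n) ^ e * (Q ^ e * y p) ^ s" for s e
      proof -
        have "x s = Q powi n * Q ^ s" using nz by (simp add: x_def power_int_add)
        then show ?thesis by (simp add: power_mult_distrib power_mult[symmetric] mult.commute[of s e] mult_ac)
      qed
      have y1: "Q ^ i * y p = inverse (l j)" using nz by (simp add: y_def p)
      have "Q ^ (i + k j) * y p = Q ^ k j * (Q ^ i * y p)" by (simp add: power_add mult_ac)
      then have y2: "Q ^ (i + k j) * y p = l j" by (simp only: y1 lQ)
      have "(c s n * u (x s) p) * y p ^ s =
          (Q powi n) ^ i * (Q powi n) ^ k j * (c s n * l j ^ s) - (Q powi n) ^ i * d j * (c s n * inverse (l j) ^ s)" for s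
      proof -
        have "(c s n * u (x s) p) * y p ^ s = c s n * (x s ^ (i + k j) * y p ^ s) - c s n * d j * (x s ^ i * y p ^ s)"
          by (simp add: u_def p algebra_simps)
        then show ?thesis unfolding xs y1 y2 by (simp add: power_add mult_ac)
      qed
      then have "(\<Sum>s\<le>g. (c s n * u (x s) p) * y p ^ s) =
          (Q powi n) ^ i * (Q powi n) ^ k j * poly (P n) (l j) - (Q powi n) ^ i * d j * poly (P n) (inverse (l j))"
        by (simp add: sum_subtractf poly_P sum_distrib_left)
      also have "(Q powi n) ^ i * (Q powi n) ^ k j * poly (P n) (l j) =
          (Q powi n) ^ i * (l j powi n * (l j powi n * poly (P n) (l j)))"
        unfolding l_powi_squared[OF p(2), of n, symmetric] by (simp only: mult.assoc)
      also have "l j powi n * poly (P n) (l j) = d j * inverse (l j) powi n * poly (P n) (inverse (l j))"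
        using gluing_P[of n] p(2) by (simp add: gluing_def)
      finally show ?thesis using nz by (simp add: power_int_inverse)
    qed
    have "Y (wave_num n) = (\<Sum>p\<in>A. rat_const (\<eta> p) * rat_z powi n *
        ((\<Sum>s\<le>g. rat_const (c s n * u (x s) p) * rat_z ^ s) / (rat_z - rat_const (y p))))"
      unfolding Y_eq
    proof (rule sum.cong)
      fix p assume "p \<in> A"
      obtain j i where p: "p = (j, i)" by (cases p)
      have "dil (int (i + k j)) (wave_num n) - rat_const (d j) * dil (int i) (wave_num n) =
          rat_z powi n * (\<Sum>s\<le>g. rat_const (c s n * u (x s) p) * rat_z ^ s)"
        unfolding dil_num u_def p prod.case
        by (simp add: rat_const_diff rat_const.hom_mult sum_distrib_left sum_subtractf algebra_simps)
      then show "rat_const (\<eta> p) / (rat_z - rat_const (y p)) *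
          (case p of (j, i) \<Rightarrow> dil (int (i + k j)) (wave_num n) - rat_const (d j) * dil (int i) (wave_num n)) =
        rat_const (\<eta> p) * rat_z powi n *
          ((\<Sum>s\<le>g. rat_const (c s n * u (x s) p) * rat_z ^ s) / (rat_z - rat_const (y p)))"
        by (simp add: p)
    qed simp
    also have "\<dots> = (\<Sum>p\<in>A. rat_const (\<eta> p) * rat_z powi n *
        (\<Sum>s\<le>g. \<Sum>r<s. rat_const (c s n * u (x s) p * y p ^ (s - Suc r)) * rat_z ^ r))"
      by (intro sum.cong refl) (simp only: divide_linear_at_root[OF root])
    also have "\<dots> = (\<Sum>p\<in>A. \<Sum>s\<le>g. \<Sum>r<s. rat_z powi n * rat_z ^ r *
        rat_const (c s n * (\<eta> p * (y p ^ (s - Suc r) * u (x s) p))))"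
      by (simp add: sum_distrib_left rat_const.hom_mult mult_ac)
    also have "\<dots> = (\<Sum>s\<le>g. \<Sum>r<s. \<Sum>p\<in>A. rat_z powi n * rat_z ^ r *
        rat_const (c s n * (\<eta> p * (y p ^ (s - Suc r) * u (x s) p))))"
      by (subst sum.swap, intro sum.cong refl, rule sum.swap)
    also have "\<dots> = (\<Sum>s\<le>g. \<Sum>r<s. rat_z powi n * rat_z ^ r * rat_const (c s n * V (x s) (s - Suc r)))"
      by (simp add: V_def rat_const.hom_sum sum_distrib_left)
    \<comment> \<open>The exponent s - 1 - r of y equals g - 1 only for s = g and r = 0; all other
      terms vanish by \<open>V0\<close>.\<close>
    also have "\<dots> = (\<Sum>s\<le>g. if s = g then rat_z powi n * rat_const (V (x g) (g - 1)) else 0)"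
    proof (rule sum.cong)
      fix s assume "s \<in> {..g}"
      show "(\<Sum>r<s. rat_z powi n * rat_z ^ r * rat_const (c s n * V (x s) (s - Suc r))) =
          (if s = g then rat_z powi n * rat_const (V (x g) (g - 1)) else 0)"
      proof (cases "s = g")
        case True
        have "(\<Sum>r<s. rat_z powi n * rat_z ^ r * rat_const (c s n * V (x s) (s - Suc r))) =
            (\<Sum>r<g. if r = 0 then rat_z powi n * rat_const (V (x g) (g - 1)) else 0)"
          unfolding True
        proof (rule sum.cong)
          fix r assume "r \<in> {..<g}"
          then show "rat_z powi n * rat_z ^ r * rat_const (c g n * V (x g) (g - Suc r)) =
              (if r = 0 then rat_z powi n * rat_const (V (x g) (g - 1)) else 0)"
            using V0[of "g - Suc r" "x g"] by (cases r) (auto simp: c_top)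
        qed simp
        then show ?thesis using True \<open>g \<noteq> 0\<close> by simp
      next
        case False
        then have "V (x s) (s - Suc r) = 0" if "r < s" for r
          using \<open>s \<in> {..g}\<close> that by (intro V0) auto
        then show ?thesis using False by simp
      qed
    qed simp
    finally show ?thesis by (simp add: x_def mult.commute)
  qed
  moreover have "\<exists>r. qdiff_order q Y r"
  proof -
    \<comment> \<open>At the least i with some nonzero \<open>\<eta> (j, i)\<close>, terms D^(i' +
      k_j) with i' + k_j = i have i' < i, as k_j > 0, and are absent. So the coefficient of D^i is a
      sum of partial fractions with distinct poles, which is not zero.\<close>
    define i where "i = (LEAST i. \<exists>j<g. i \<le> N \<and> \<eta> (j, i) \<noteq> 0)"
    have "\<exists>i j. j < g \<and> i \<le> N \<and> \<eta> (j, i) \<noteq> 0" using \<eta>(1) by (auto simp: A_def)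
    then have "\<exists>j<g. i \<le> N \<and> \<eta> (j, i) \<noteq> 0" unfolding i_def by (rule LeastI_ex)
    then obtain j where j: "j < g" "i \<le> N" "\<eta> (j, i) \<noteq> 0" by blast
    have min: "\<eta> (j, i') = 0" if "i' < i" "j < g" for i' j
      using not_less_Least[of i' "\<lambda>i. \<exists>j<g. i \<le> N \<and> \<eta> (j, i) \<noteq> 0"] that \<open>i \<le> N\<close> by (auto simp: i_def[symmetric])
    have "B i = (\<Sum>j<g. \<Sum>i'\<le>N. rat_const (\<eta> (j, i')) / (rat_z - rat_const (y (j, i'))) * rat_const (M (i, 0) (j, i')))"
      unfolding B_def A_def sum.cartesian_product by (simp add: case_prod_beta)
    also have "\<dots> = (\<Sum>j<g. \<Sum>i'\<le>N. if i' = i then rat_const (- d j * \<eta> (j, i)) / (rat_z - rat_const (y (j, i))) else 0)"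
    proof (intro sum.cong refl)
      fix j i' assume j: "j \<in> {..<g}" and "i' \<in> {..N}"
      show "rat_const (\<eta> (j, i')) / (rat_z - rat_const (y (j, i'))) * rat_const (M (i, 0) (j, i')) =
          (if i' = i then rat_const (- d j * \<eta> (j, i)) / (rat_z - rat_const (y (j, i))) else 0)"
      proof (cases "i' = i")
        case True
        have "M (i, 0) (j, i) = - d j" using k_pos[of j] j by (simp add: M_def)
        then show ?thesis using True by (simp add: rat_const.hom_mult rat_const.hom_uminus mult_ac)
      next
        case False
        then have "i' + k j = i \<Longrightarrow> \<eta> (j, i') = 0" using k_pos[of j] j min[of i' j] by auto
        then show ?thesis using False by (cases "i' + k j = i") (auto simp: M_def)
      qed
    qed
    also have "\<dots> = (\<Sum>j<g. rat_const (- d j * \<eta> (j, i)) / (rat_z - rat_const (y (j, i))))"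
      using \<open>i \<le> N\<close> by simp
    finally have Bi: "B i = (\<Sum>j<g. rat_const (- d j * \<eta> (j, i)) / (rat_z - rat_const (y (j, i))))" .
    have "inj_on (\<lambda>j. y (j, i)) {..<g}"
      using q l_distinct by (auto simp: inj_on_def y_def)
    then have "B i \<noteq> 0"
      using partial_fractions_independent[of "{..<g}" "\<lambda>j. y (j, i)" "\<lambda>j. - d j * \<eta> (j, i)" j] j d_nonzero[of j]
      unfolding Bi by auto
    then show ?thesis unfolding Y_def using \<open>i \<le> N\<close> by (intro ex_qdiff_order[of _ "int i"]) auto
  qed
  ultimately show ?thesis
    by (elim exE) (rule exI[of _ Y], rule exI, rule exI[of _ "\<lambda>n. V (Q powi (n + int g)) (g - 1)"], simp)
qed

section \<open>The commutative ring of q-difference operators\<close>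

abbreviation \<Psi> :: "int \<Rightarrow> ratfun" where
  "\<Psi> n \<equiv> wave rat_const g l d n rat_z"

definition bispectral_ring :: "(ratfun \<Rightarrow> ratfun) set" where
  "bispectral_ring = {B. is_qdiff_op q B \<and> (\<exists>\<theta>. \<forall>n. B (\<Psi> n) = rat_const (\<theta> n) * \<Psi> n)}"

lemma bispectral_ringI:
  assumes "is_opr B" "\<And>n. B (\<Psi> n) = rat_const (\<theta> n) * \<Psi> n"
  shows "B \<in> bispectral_ring"
  unfolding bispectral_ring_def is_qdiff_op_eq using assms by auto

text \<open>Multiples of \<open>node_poly\<close> satisfy all gluing conditions, so for one fixed
  nonzero h every z^m h is a combination of wave functions. Replacing h by z^m h multiplies the j-th
  term of its image by (q^j)^m, up to the common z^m, and these powers are independent.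
  Commutativity follows from this.\<close>

lemma annihilates_wave:
  assumes B: "is_opr B" and zero: "\<And>n. B (\<Psi> n) = 0"
  shows "B = 0"
proof -
  obtain S a where S: "finite S" "B = opr S a" using B by (auto simp: is_opr_def)
  define h where "h = to_fract node_poly / wave_denom"
  have "node_poly \<noteq> 0" by (simp add: node_poly_def)
  then have "h \<noteq> 0" using wave_denom_nonzero by (simp add: h_def)
  have Bz: "B (rat_z ^ m * h) = 0" for m
  proof -
    let ?G = "monom 1 m * node_poly"
    have "gluing 0 ?G" using node_poly_zero by (auto simp: gluing_def)
    moreover have "degree ?G \<le> g + degree ?G" by simp
    ultimately obtain b where b: "?G = (\<Sum>i\<le>degree ?G. Polynomial.smult (b i) (monom 1 i * P (0 + int i)))"
      using gluing_expansion by blast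
    have mon: "to_fract (monom 1 i) = rat_z ^ i" for i
    proof -
      have "to_fract (monom 1 i) = (\<Sum>e\<le>i. rat_const (coeff (monom 1 i) e) * rat_z ^ e)"
        by (rule to_fract_eq_sum') (simp add: degree_monom_le)
      also have "\<dots> = (\<Sum>e\<le>i. if e = i then rat_z ^ i else 0)" by (intro sum.cong) auto
      finally show ?thesis by simp
    qed
    have "rat_z ^ m * h = to_fract ?G / wave_denom" by (simp add: h_def mon)
    also have "\<dots> = (\<Sum>i\<le>degree ?G. rat_const (b i) * \<Psi> (int i))"
      by (subst b) (simp add: to_fract_smult mon sum_divide_distrib wave_rat_const wave_num_def)
    finally show ?thesis using zero by (simp add: opr_sum[OF B] opr_scale[OF B])
  qed
  have "a j = 0" if "j \<in> S" for j
  proof -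
    have "a j * dil j h = 0"
    proof (rule power_sum_independent[of S "\<lambda>j. rat_const (Q powi j)" "\<lambda>j. a j * dil j h"])
      show "inj_on (\<lambda>j. rat_const (Q powi j)) S"
      proof (rule inj_onI)
        fix i j assume "rat_const (Q powi i) = rat_const (Q powi j)"
        then have "rat_const (Q powi i - Q powi j) = 0" by (simp add: rat_const_diff)
        then have "complex_of_real (q powi i) = complex_of_real (q powi j)" by (simp add: of_real_power_int)
        then have "q powi i = q powi j" by (simp only: of_real_eq_iff)
        then show "i = j"
          using q power_int_strict_decreasing[of i j q] power_int_strict_decreasing[of j i q]
          by (cases i j rule: linorder_cases) auto
      qed
      fix m
      have "B (rat_z ^ m * h) = rat_z ^ m * (\<Sum>j\<in>S. a j * dil j h * rat_const (Q powi j) ^ m)"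
        unfolding S(2) opr_def sum_distrib_left
      proof (rule sum.cong)
        fix j
        show "a j * dil j (rat_z ^ m * h) = rat_z ^ m * (a j * dil j h * rat_const (Q powi j) ^ m)"
          by (simp only: s_mult dilate_power[OF qj_nonzero] dilate_rat_z[OF qj_nonzero] power_mult_distrib mult_ac)
      qed simp
      then show "(\<Sum>j\<in>S. a j * dil j h * rat_const (Q powi j) ^ m) = 0" using Bz[of m] by simp
    qed (use S(1) that in auto)
    then show ?thesis using \<open>h \<noteq> 0\<close> dil_eq_0_iff by simp
  qed
  then show ?thesis by (auto simp: S(2) opr_def fun_eq_iff)
qed

lemma cring_bispectral_ring: "cring (op_ring bispectral_ring)"
proof (rule cring_op_ring)
  fix L M assume "L \<in> bispectral_ring" "M \<in> bispectral_ring"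
  then obtain \<theta> \<mu> where L: "is_opr L" "\<And>n. L (\<Psi> n) = rat_const (\<theta> n) * \<Psi> n"
    and M: "is_opr M" "\<And>n. M (\<Psi> n) = rat_const (\<mu> n) * \<Psi> n"
    by (auto simp: bispectral_ring_def is_qdiff_op_eq)
  have "(L + M) (\<Psi> n) = rat_const (\<theta> n + \<mu> n) * \<Psi> n" for n
    by (simp add: L M rat_const.hom_add distrib_right)
  then show "L + M \<in> bispectral_ring"
    by (rule bispectral_ringI[OF is_opr_add[OF L(1) M(1)]])
  have "(- L) (\<Psi> n) = rat_const (- \<theta> n) * \<Psi> n" for n
    by (simp add: L rat_const.hom_uminus)
  then show "- L \<in> bispectral_ring"
    by (rule bispectral_ringI[OF is_opr_uminus[OF L(1)]])
  have LM: "(L \<circ> M) (\<Psi> n) = rat_const (\<theta> n * \<mu> n) * \<Psi> n" for n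
    by (simp add: L M opr_scale[OF L(1)] rat_const.hom_mult mult_ac)
  then show "L \<circ> M \<in> bispectral_ring"
    by (rule bispectral_ringI[OF is_opr_compose[OF L(1) M(1)]])
  have "(L \<circ> M) - (M \<circ> L) = 0"
  proof (rule annihilates_wave)
    show "is_opr ((L \<circ> M) - (M \<circ> L))"
      by (intro is_opr_diff is_opr_compose L(1) M(1))
    show "((L \<circ> M) - (M \<circ> L)) (\<Psi> n) = 0" for n
      by (simp add: L M opr_scale[OF L(1)] opr_scale[OF M(1)] mult_ac)
  qed
  then show "L \<circ> M = M \<circ> L" by simp
next
  show "0 \<in> bispectral_ring"
    unfolding bispectral_ring_def is_qdiff_op_eq using is_opr_zero
    by (auto intro!: exI[of _ "\<lambda>_. 0"])
  have "is_opr id" using is_opr_id'[of 1] by (simp add: id_def)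
  then show "id \<in> bispectral_ring"
    unfolding bispectral_ring_def is_qdiff_op_eq by (auto intro!: exI[of _ "\<lambda>_. 1"])
qed (auto simp: bispectral_ring_def is_qdiff_op_eq intro: opr_additive)

lemma rank_bispectral_ring: "op_rank (qdiff_order q) bispectral_ring = 1"
proof -
  obtain X mx \<theta> where X: "qdiff_order q X mx" "\<And>n. X (rat_z powi n) = rat_const (\<theta> n) * wave_num n"
    using ex_raising_op by blast
  obtain Y my \<mu> where Y: "qdiff_order q Y my" "\<And>n. Y (wave_num n) = rat_const (\<mu> n) * rat_z powi n"
    using ex_lowering_op by blast
  \<comment> \<open>X and Y act between numerators and monomials, hence the conjugation by
    \<open>wave_denom\<close>, which does not change the order.\<close>
  define B where "B e = (\<lambda>h. inverse wave_denom * h) \<circ> (X \<circ> ((\<lambda>h. 1 * dil (int e) h) \<circ> (Y \<circ> (\<lambda>h. wave_denom * h))))" for e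
  have order: "qdiff_order q (B e) (0 + (mx + (int e + (my + 0))))" for e
    unfolding B_def using wave_denom_nonzero
    by (intro qdiff_order_compose qdiff_order_mult qdiff_order_monomial X(1) Y(1)) auto
  have "B e (\<Psi> n) = rat_const (\<mu> n * (Q powi n) ^ e * \<theta> n) * \<Psi> n" for e n
  proof -
    have "wave_denom * \<Psi> n = wave_num n" using wave_denom_nonzero by (simp add: wave_rat_const)
    then have "B e (\<Psi> n) = inverse wave_denom * X (rat_const (\<mu> n * (Q powi n) ^ e) * rat_z powi n)"
      by (simp add: B_def Y(2) s_mult dilate_rat_const[OF qj_nonzero] dil_rat_z_powi rat_const.hom_mult mult_ac
          del: power_int_of_nat)
    also have "\<dots> = inverse wave_denom * (rat_const (\<mu> n * (Q powi n) ^ e) * (rat_const (\<theta> n) * wave_num n))"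
      by (simp only: opr_scale[OF qdiff_order_imp[OF X(1)]] X(2))
    finally show ?thesis by (simp add: wave_rat_const rat_const.hom_mult divide_inverse mult_ac)
  qed
  then have "B e \<in> bispectral_ring" for e
    by (rule bispectral_ringI[OF qdiff_order_imp[OF order[of e]]])
  then have "mx + int e + my \<in> {m. \<exists>L\<in>bispectral_ring. qdiff_order q L m}" for e
    using order[of e] by (auto simp: add_ac)
  \<comment> \<open>Nothing is known about mx + my, but a common divisor of two orders that differ
    by 1 divides 1.\<close>
  from this[of 0] this[of 1] have
    "Gcd {m. \<exists>L\<in>bispectral_ring. qdiff_order q L m} dvd mx + my"
    "Gcd {m. \<exists>L\<in>bispectral_ring. qdiff_order q L m} dvd mx + 1 + my"
    by (auto intro!: Gcd_dvd)
  then have "Gcd {m. \<exists>L\<in>bispectral_ring. qdiff_order q L m} dvd (mx + 1 + my) - (mx + my)"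
    using dvd_diff by blast
  then show ?thesis
    using Gcd_int_greater_eq_0[of "{m. \<exists>L\<in>bispectral_ring. qdiff_order q L m}"]
    by (simp add: op_rank_def)
qed

end

section \<open>The bound states of the theorem\<close>

lemma bound_pt_eq: "bound_pt q k J i = joukowski (bound_lam q k J i)"
  by (simp add: bound_pt_def bound_lam_def joukowski_def powr_minus of_real_inverse)

lemma norm_bound_lam: "norm (bound_lam q k J i) = q powr (real (k i) / 2)" if "0 < q"
  using that by (simp add: bound_lam_def norm_mult)

lemma bound_lam_squared: "0 < q \<Longrightarrow> (bound_lam q k J i)\<^sup>2 = of_real q ^ k i"
  by (simp add: bound_lam_def power_mult_distrib of_real_power[symmetric] powr_realpow[symmetric] powr_powr
      flip: powr_add power2_eq_square del: of_real_power)

text \<open>All these \<open>bound_lam\<close> have modulus q^(k_i / 2) < 1, so no product of two of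
  them is 1; they are distinct because the bound points are functions of them.\<close>

lemma q_bound_statesI:
  assumes q: "0 < q" "q < 1" and k: "\<And>i. i < g \<Longrightarrow> k i > 0"
    and inj: "inj_on (bound_pt q k J) {..<g}" and \<delta>: "\<And>i. i < g \<Longrightarrow> \<delta> i \<noteq> 0"
    and \<tau>: "\<And>n. casorati (map (\<lambda>j. bound_state (bound_lam q k J j) (\<delta> j)) [0..<g]) n \<noteq> 0"
  shows "q_bound_states g (bound_lam q k J) \<delta> q k"
proof
  have less_1: "q powr (real (k i) / 2) < 1" if "i < g" for i
    using powr_less_mono'[of q 0 "real (k i) / 2"] k[OF that] q by simp
  show "bound_lam q k J i \<noteq> 0" if "i < g" for i
    using norm_bound_lam[OF q(1), of k J i] q by auto
  show "bound_lam q k J i \<noteq> bound_lam q k J j" if "i < g" "j < g" "i \<noteq> j" for i j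
    using inj_onD[OF inj, of i j] that by (auto simp: bound_pt_eq)
  show "bound_lam q k J i * bound_lam q k J j \<noteq> 1" if "i < g" "j < g" for i j
  proof
    assume "bound_lam q k J i * bound_lam q k J j = 1"
    then have "q powr (real (k i) / 2) * q powr (real (k j) / 2) = 1"
      by (metis norm_mult norm_one norm_bound_lam[OF q(1)])
    moreover have "q powr (real (k i) / 2) * q powr (real (k j) / 2) < 1 * 1"
      by (intro mult_strict_mono less_1 that) auto
    ultimately show False by simp
  qed
qed (use assms bound_lam_squared in auto)

lemma bound_curve_eq:
  assumes "q_bound_states g (bound_lam q k J) \<delta> q k" and JK: "J \<union> K = {..<g}" "J \<inter> K = {}"
  shows "bound_curve q k J K = bound_states.curve_poly g (bound_lam q k J)"
proof -
  interpret q_bound_states g "bound_lam q k J" \<delta> q k by fact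
  define a :: "nat \<Rightarrow> complex" where "a i = of_real (q powr (real (k i) / 2) + q powr (- real (k i) / 2))" for i
  have fin: "finite J" "finite K" using JK(1) by (metis finite_Un finite_lessThan)+
  have "pole_factor = (\<Prod>i\<in>J. [:- joukowski (bound_lam q k J i), 1:]) * (\<Prod>i\<in>K. [:- joukowski (bound_lam q k J i), 1:])"
    unfolding pole_factor_def JK(1)[symmetric] by (rule prod.union_disjoint[OF fin JK(2)])
  also have "(\<Prod>i\<in>J. [:- joukowski (bound_lam q k J i), 1:]) = (\<Prod>i\<in>J. [:0, 1:] - [:a i:])"
    by (rule prod.cong) (auto simp: bound_pt_eq[symmetric] bound_pt_def a_def)
  also have "(\<Prod>i\<in>K. [:- joukowski (bound_lam q k J i), 1:]) = (\<Prod>i\<in>K. [:0, 1:] + [:a i:])"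
    using JK(2) by (intro prod.cong) (auto simp: bound_pt_eq[symmetric] bound_pt_def a_def)
  finally have pf: "pole_factor\<^sup>2 = (\<Prod>i\<in>J. ([:0, 1:] - [:a i:])\<^sup>2) * (\<Prod>i\<in>K. ([:0, 1:] + [:a i:])\<^sup>2)"
    by (simp only: power_mult_distrib prod_power_distrib)
  have u: "[:0, 1:]\<^sup>2 - 4 = [:-4, 0, 1 :: complex:]"
    by (simp add: power2_eq_square numeral_poly)
  have v: "[:0, 1:]\<^sup>2 - [:p:] = [:- p, 0, 1:]" for p :: "complex poly"
    by (simp add: power2_eq_square)
  show ?thesis
    unfolding bound_curve_def Let_def a_def[symmetric] v u curve_poly_def disc_poly_def pf
    by (simp only: mult.assoc)
qed

text \<open>A factor \<open>Q\<close> is determined only up to a function of n on the left, hence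
  the conjugation by \<open>\<gamma>\<close>; monic factors give \<open>Lhat\<close> itself. Nonzero
  intermediate Casoratians ensure that no step meets an eigenfunction with zeros.\<close>

theorem theorem8p1:
  fixes q :: real and g :: nat and k :: "nat \<Rightarrow> nat" and J K :: "nat set"
    and \<delta> :: "nat \<Rightarrow> complex"
  defines "l \<equiv> bound_lam q k J"
    and "x \<equiv> bound_pt q k J"
  defines "\<phi> \<equiv> (\<lambda>j. bound_state (l j) (\<delta> j))"
  assumes q: "0 < q" "q < 1"
    and k: "\<And>i. i < g \<Longrightarrow> k i > 0"
    and JK: "J \<union> K = {..<g}" "J \<inter> K = {}"
    and distinct_pts: "inj_on x {..<g}"
    and \<delta>: "\<And>i. i < g \<Longrightarrow> \<delta> i \<noteq> 0"
    and \<tau>: "\<And>n. casorati (map \<phi> [0..<g]) n \<noteq> 0"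
  shows
    "(\<exists>Lhat.
        (\<forall>L. is_diff_op L \<and> has_symbol g l \<delta> L (\<lambda>z. z + inverse z) \<longleftrightarrow> L = Lhat)
      \<and> (\<forall>js. distinct js \<and> set js = {..<g} \<longrightarrow>
            (\<forall>L T. darboux (map (\<lambda>i. (x i, \<phi> i)) js) L T \<longrightarrow>
               (\<exists>\<gamma>. (\<forall>n. \<gamma> n \<noteq> 0) \<and> L = mult_op \<gamma> \<circ> Lhat \<circ> mult_op (\<lambda>n. inverse (\<gamma> n))))
          \<and> ((\<forall>m\<le>g. \<forall>n. casorati (map \<phi> (take m js)) n \<noteq> 0) \<longrightarrow>
               (\<exists>T. darboux (map (\<lambda>i. (x i, \<phi> i)) js) Lhat T)))
      \<and> (\<exists>T. is_diff_op T \<and> Lhat \<circ> T = T \<circ> free_op \<and>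
             {h. T h = 0} = seq_span (map \<phi> [0..<g]))
      \<and> tridiagonal Lhat
      \<and> Lhat \<in> spectral_ring g l \<delta>)
   \<and> cring (op_ring (spectral_ring g l \<delta>))
   \<and> op_rank diff_order (spectral_ring g l \<delta>) = 1
   \<and> has_spectral_curve (spectral_ring g l \<delta>) (bound_curve q k J K)
   \<and> (\<exists>R. (\<forall>B\<in>R. is_qdiff_op q B)
        \<and> cring (op_ring R)
        \<and> op_rank (qdiff_order q) R = 1
        \<and> (\<forall>B\<in>R. \<exists>\<theta>. \<forall>n.
             B (wave rat_const g l \<delta> n rat_z) = rat_const (\<theta> n) * wave rat_const g l \<delta> n rat_z))"
proof -
  have qb: "q_bound_states g l \<delta> q k"
    unfolding l_def
    by (rule q_bound_statesI)
      (use q k distinct_pts \<delta> \<tau> in \<open>simp_all add: x_def \<phi>_def l_def\<close>)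
  interpret q_bound_states g l \<delta> q k by (rule qb)
  have x_eq: "x i = joukowski (l i)" for i by (simp add: x_def l_def bound_pt_eq)
  obtain a where a: "symbol (diff_op {-1, 0, 1} a) joukowski" "\<And>n. a 1 n = 1"
    using ex_joukowski_op by blast
  define Lhat where "Lhat = diff_op {-1, 0, 1} a"
  have Lhat: "symbol Lhat joukowski" using a(1) by (simp add: Lhat_def)
  have j_def: "(\<lambda>z. z + inverse z) = joukowski" by (simp add: joukowski_def fun_eq_iff)
  have unique: "\<forall>L. is_diff_op L \<and> has_symbol g l \<delta> L (\<lambda>z. z + inverse z) \<longleftrightarrow> L = Lhat"
    unfolding j_def symbol_iff[symmetric]
  proof (intro allI iffI)
    show "L = Lhat" if "symbol L joukowski" for L
      by (rule symbol_unique[OF that Lhat finite.emptyI]) simp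
    show "symbol L joukowski" if "L = Lhat" for L unfolding that by (rule Lhat)
  qed
  have "(\<forall>L T. darboux (map (\<lambda>i. (x i, \<phi> i)) js) L T \<longrightarrow>
        (\<exists>\<gamma>. (\<forall>n. \<gamma> n \<noteq> 0) \<and> L = mult_op \<gamma> \<circ> Lhat \<circ> mult_op (\<lambda>n. inverse (\<gamma> n)))) \<and>
      ((\<forall>m\<le>g. \<forall>n. casorati (map \<phi> (take m js)) n \<noteq> 0) \<longrightarrow> (\<exists>T. darboux (map (\<lambda>i. (x i, \<phi> i)) js) Lhat T))"
    if js: "distinct js" "set js = {..<g}" for js
  proof (intro conjI allI impI)
    let ?bs = "map (\<lambda>i. (x i, \<phi> i)) js"
    have len: "length ?bs = g" using distinct_card[OF js(1)] js(2) by simp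
    have conj: "L = mult_op (t g) \<circ> Lhat \<circ> mult_op (\<lambda>n. inverse (t g n))"
      if "darboux ?bs L (forward_op g t)" "\<And>n. t g n \<noteq> 0" for L t
      using darboux_conjugate[OF _ js Lhat, of x L t] that by (simp add: \<phi>_def)
    show "\<exists>\<gamma>. (\<forall>n. \<gamma> n \<noteq> 0) \<and> L = mult_op \<gamma> \<circ> Lhat \<circ> mult_op (\<lambda>n. inverse (\<gamma> n))"
      if D: "darboux ?bs L T" for L T
    proof -
      obtain t where "T = forward_op g t" "\<And>n. t g n \<noteq> 0"
        using darboux_invariants(3)[OF D] unfolding len by blast
      then show ?thesis using conj[of L t] D by (intro exI[of _ "t g"]) auto
    qed
    assume cas: "\<forall>m\<le>g. \<forall>n. casorati (map \<phi> (take m js)) n \<noteq> 0"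
    have "\<exists>L t. darboux ?bs L (forward_op (length ?bs) t) \<and> (\<forall>n. t (length ?bs) n = 1)"
    proof (rule darboux_exists)
      show "free_op f = scalar_op y f" if "(y, f) \<in> set ?bs" for y f
        using that js(2) free_op_bound_state by (auto simp: x_eq \<phi>_def)
      show "casorati (map snd (take m ?bs)) n \<noteq> 0" if "m \<le> length ?bs" for m n
        using cas that by (simp add: take_map[symmetric] len comp_def del: length_map)
    qed
    then obtain L t where D: "darboux ?bs L (forward_op g t)" and t: "\<And>n. t g n = 1"
      unfolding len by blast
    \<comment> \<open>The product of the factors is monic, so the conjugating function is 1.\<close>
    have "mult_op (\<lambda>n. 1) = id" by (simp add: mult_op_def fun_eq_iff)
    then have "L = Lhat" using conj[OF D] t by (simp add: mult_op_def fun_eq_iff)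
    then show "\<exists>T. darboux ?bs Lhat T" using D by blast
  qed
  then have darboux: "\<forall>js. distinct js \<and> set js = {..<g} \<longrightarrow>
      (\<forall>L T. darboux (map (\<lambda>i. (x i, \<phi> i)) js) L T \<longrightarrow>
        (\<exists>\<gamma>. (\<forall>n. \<gamma> n \<noteq> 0) \<and> L = mult_op \<gamma> \<circ> Lhat \<circ> mult_op (\<lambda>n. inverse (\<gamma> n)))) \<and>
      ((\<forall>m\<le>g. \<forall>n. casorati (map \<phi> (take m js)) n \<noteq> 0) \<longrightarrow> (\<exists>T. darboux (map (\<lambda>i. (x i, \<phi> i)) js) Lhat T))"
    by (intro allI impI) (elim conjE)
  have intertwiner: "\<exists>T. is_diff_op T \<and> Lhat \<circ> T = T \<circ> free_op \<and> {h. T h = 0} = seq_span (map \<phi> [0..<g])"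
    unfolding \<phi>_def by (intro exI[of _ T] conjI is_diff_op_T symbol_intertwines[OF Lhat] T_kernel)
  have tri: "tridiagonal Lhat" unfolding tridiagonal_def Lhat_def by (rule exI[of _ a]) (rule refl)
  have mem: "Lhat \<in> spectral_ring g l \<delta>" using Lhat by (auto simp: spectral_ring_eq)
  have curve: "has_spectral_curve (spectral_ring g l \<delta>) (bound_curve q k J K)"
    using spectral_curve bound_curve_eq[OF qb[unfolded l_def] JK] by (simp add: l_def)
  have bispectral: "\<forall>B\<in>bispectral_ring. is_qdiff_op q B"
    "\<forall>B\<in>bispectral_ring. \<exists>\<theta>. \<forall>n. B (wave rat_const g l \<delta> n rat_z) = rat_const (\<theta> n) * wave rat_const g l \<delta> n rat_z"
    by (auto simp: bispectral_ring_def)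
  show ?thesis
    by (rule conjI, rule exI[of _ Lhat], intro conjI unique darboux intertwiner tri mem,
        intro conjI cring_spectral_ring rank_spectral_ring[OF a] curve, rule exI[of _ bispectral_ring],
        intro conjI bispectral cring_bispectral_ring rank_bispectral_ring)
qed

end
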